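(* Let $A=\bigoplus_{0\le i<a}A_i$ be a graded truncated discrete valuation ring of length $a$ ($1\le a\le\infty$), let $R=A[x_1,\dots,x_n]$, let $L=Re_1\oplus\cdots\oplus Re_r$ be a free $R$-module of rank $r\ge1$ with a fixed term order on $\mathbb X_e$, and let $M$ be a non-zero graded $R$-submodule of $L$. Let $G=\{g_1,\dots,g_t\}$ be a homogeneous Gröbner basis for $M$ and write $c_j=\operatorname{lc}(g_j)$, $X_j=\operatorname{lp}(g_j)$. For $X\in\mathbb X_e$ put $$m_X=\begin{cases}\min\{v(c_j)\ :\ X_j\mid X\}&\text{if there exists } j \text{ with } X_j\mid X,\\ a&\text{otherwise.}\end{cases}$$ Then the following conditions are equivalent: (a) $L/M$ is flat over $A$; (b) $\{m_X : X\in\mathbb X_e\}\subset\{0,a\}$; (c) for any $j$, there exists $j'$ such that $c_{j'}$ is a unit in $A$ and $X_{j'}\mid X_j$. Furthermore, if $L/M$ is flat over $A$, then $$\operatorname{rank}_A(L/M)=\#\{X\in\mathbb X_e : m_X=a\}.$$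
   Context: All rings are commutative. Let $k$ be a field. A graded truncated discrete valuation ring (graded tdvr) of length $a$ ($1\le a\le\infty$) is a graded ring $A=\bigoplus_{0\le i<a}A_i$ with $A_0=k$ such that each $A_i$ ($0\le i<a$) is a one-dimensional $k$-vector space generated by $(A_1)^i$ (so $A\cong k[\varpi]/(\varpi^a)$ if $a<\infty$, and $A\cong k[\varpi]$ if $a=\infty$, with $A_i=k\varpi^i$). For a non-zero homogeneous $c\in A_i$, put $v(c)=i$. $\mathbb X=\{x_1^{m_1}\cdots x_n^{m_n}: m_i\in\mathbb Z_{\ge0}\}$ and $\mathbb X_e=\{\boldsymbol{x}e_l : \boldsymbol{x}\in\mathbb X,\ 1\le l\le r\}$, an $A$-basis of $L$. $R$ and $L$ are graded by $R_i=\bigoplus_{\boldsymbol{x}\in\mathbb X}A_i\boldsymbol{x}$ and $L_i=R_ie_1\oplus\cdots\oplus R_ie_r$. A graded $R$-submodule $M=\bigoplus_{0\le i<a}M_i$ of $L$ has $M_i=M\cap L_i$. A non-zero element of $L$ is homogeneous of degree $i$ if it lies in $L_i$. A term order is a total order $<$ on $\mathbb X_e$ such that $X<\boldsymbol{x}X$ for all $X\in\mathbb X_e$ and $1\ne\boldsymbol{x}\in\mathbb X$, and $X<Y$ implies $\boldsymbol{x}X<\boldsymbol{x}Y$ for all $\boldsymbol{x}\in\mathbb X$. For $X,Y\in\mathbb X_e$, $X\mid Y$ means $Y=\boldsymbol{x}X$ for some $\boldsymbol{x}\in\mathbb X$. For $0\ne f=a_1Y_1+\cdots+a_sY_s\in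 L$ with $a_i\in A\setminus\{0\}$ and $Y_1>\cdots>Y_s$ in $\mathbb X_e$, put $\operatorname{lp}(f)=Y_1$, $\operatorname{lc}(f)=a_1$, $\operatorname{lt}(f)=a_1Y_1$. For a subset $S\subset L$, $\operatorname{Lt}(S)$ is the $R$-submodule of $L$ generated by the leading terms of the non-zero elements of $S$. A Gröbner basis for a non-zero submodule $M\subset L$ is a finite subset $G\subset M\setminus\{0\}$ with $\operatorname{Lt}(G)=\operatorname{Lt}(M)$; it is homogeneous if all its elements are homogeneous (then each $c_j$ is a homogeneous element of $A$). The rank is the cardinality of an $A$-basis. *)

theory Defs
  imports
    "HOL-Library.Multiset"
    "HOL-Library.Extended_Nat"
    "HOL-Library.Equipollence"
    "HOL-Algebra.Module"
    "HOL-Algebra.Embedded_Algebras"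
    "HOL-Algebra.Free_Abelian_Groups"
begin

section \<open>Graded truncated discrete valuation rings\<close>

primrec set_power :: "('a, 'm) ring_scheme \<Rightarrow> 'a set \<Rightarrow> nat \<Rightarrow> 'a set" where
  "set_power A V 0 = {\<one>\<^bsub>A\<^esub>}"
| "set_power A V (Suc i) = set_power A V i <#>\<^bsub>A\<^esub> V"

text \<open>
  A grading of length \<open>a\<close> is encoded as a family \<open>\<A>\<close> indexed by all natural numbers, with
  \<open>\<A> i = 0\<close> for \<open>a \<le> i\<close>. Existence and uniqueness of the family \<open>h\<close> of homogeneous components
  says that the ring is the direct sum of the \<open>\<A> i\<close>.
\<close>

definition graded_ring :: "('a, 'm) ring_scheme \<Rightarrow> enat \<Rightarrow> (nat \<Rightarrow> 'a set) \<Rightarrow> bool" where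
  "graded_ring A a \<A> \<longleftrightarrow>
     cring A \<and>
     (\<forall>i. subgroup (\<A> i) (add_monoid A)) \<and>
     (\<forall>i. a \<le> enat i \<longrightarrow> \<A> i = {\<zero>\<^bsub>A\<^esub>}) \<and>
     (\<forall>i j. \<A> i <#>\<^bsub>A\<^esub> \<A> j \<subseteq> \<A> (i + j)) \<and>
     (\<forall>x \<in> carrier A. \<exists>!h. (\<forall>i. h i \<in> \<A> i) \<and> finite {i. h i \<noteq> \<zero>\<^bsub>A\<^esub>} \<and>
        x = (\<Oplus>\<^bsub>A\<^esub>i \<in> {i. h i \<noteq> \<zero>\<^bsub>A\<^esub>}. h i))"

text \<open>
  The base field \<open>k\<close> is the subring \<open>\<A> 0\<close>. The additive subgroup generated by the products
  \<open>c \<otimes> y\<close> with \<open>c \<in> k\<close> and \<open>y\<close> a product of \<open>i\<close> elements of \<open>\<A> 1\<close> is the \<open>k\<close>-span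
  of the \<open>i\<close>-th power of \<open>\<A> 1\<close>.
\<close>

definition graded_tdvr :: "('a, 'm) ring_scheme \<Rightarrow> enat \<Rightarrow> (nat \<Rightarrow> 'a set) \<Rightarrow> bool" where
  "graded_tdvr A a \<A> \<longleftrightarrow>
     1 \<le> a \<and> graded_ring A a \<A> \<and> subfield (\<A> 0) A \<and>
     (\<forall>i. enat i < a \<longrightarrow>
        ring.dimension A 1 (\<A> 0) (\<A> i) \<and>
        \<A> i = generate (add_monoid A) (\<A> 0 <#>\<^bsub>A\<^esub> set_power A (\<A> 1) i))"

text \<open>Meaningful only for a non-zero homogeneous element, whose degree is unique.\<close>

definition val :: "(nat \<Rightarrow> 'a set) \<Rightarrow> 'a \<Rightarrow> nat" where
  "val \<A> c = (THE i. c \<in> \<A> i)"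

section \<open>Polynomials and free modules\<close>

text \<open>
  As in \<open>HOL-Algebra.Indexed_Polynomials\<close>, a monomial is the multiset of its variables, so that
  the product of monomials is \<open>+\<close> and the monomial 1 is \<open>{#}\<close>. The pair \<open>(x, l)\<close>
  stands for \<open>x e\<^sub>l\<close>.
\<close>

type_synonym monom = "nat multiset"
type_synonym module_monom = "monom \<times> nat"

definition monoms :: "nat \<Rightarrow> monom set" where
  "monoms n = {x. set_mset x \<subseteq> {1..n}}"

definition module_monoms :: "nat \<Rightarrow> nat \<Rightarrow> module_monom set" where
  "module_monoms n r = monoms n \<times> {1..r}"

fun monom_act :: "monom \<Rightarrow> module_monom \<Rightarrow> module_monom" where
  "monom_act x (y, l) = (x + y, l)"

definition monom_dvd :: "nat \<Rightarrow> module_monom \<Rightarrow> module_monom \<Rightarrow> bool" where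
  "monom_dvd n X Y \<longleftrightarrow> (\<exists>x \<in> monoms n. Y = monom_act x X)"

definition fin_supp_funs :: "('a, 'm) ring_scheme \<Rightarrow> 'b set \<Rightarrow> ('b \<Rightarrow> 'a) set" where
  "fin_supp_funs A B =
     {f. (\<forall>b. f b \<in> carrier A) \<and> {b. f b \<noteq> \<zero>\<^bsub>A\<^esub>} \<subseteq> B \<and> finite {b. f b \<noteq> \<zero>\<^bsub>A\<^esub>}}"

text \<open>The ring \<open>R = A[x\<^sub>1,\<dots>,x\<^sub>n]\<close>; an element is its function of coefficients.\<close>

definition mpoly_ring :: "('a, 'm) ring_scheme \<Rightarrow> nat \<Rightarrow> (monom \<Rightarrow> 'a) ring" where
  "mpoly_ring A n =
     \<lparr>carrier = fin_supp_funs A (monoms n),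
      mult = (\<lambda>p q z. \<Oplus>\<^bsub>A\<^esub>x \<in> {x. x \<subseteq># z}. p x \<otimes>\<^bsub>A\<^esub> q (z - x)),
      one = (\<lambda>z. if z = {#} then \<one>\<^bsub>A\<^esub> else \<zero>\<^bsub>A\<^esub>),
      ring.zero = (\<lambda>z. \<zero>\<^bsub>A\<^esub>),
      add = (\<lambda>p q z. p z \<oplus>\<^bsub>A\<^esub> q z)\<rparr>"

text \<open>
  The free module \<open>L = R e\<^sub>1 \<oplus> \<dots> \<oplus> R e\<^sub>r\<close>, first as an \<open>R\<close>-module and then as an \<open>A\<close>-module.
  An element is its function of coefficients with respect to the \<open>A\<close>-basis of all \<open>x e\<^sub>l\<close>. The
  fields \<open>mult\<close> and \<open>one\<close> of a module record carry no meaning.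
\<close>

definition free_module ::
  "('a, 'm) ring_scheme \<Rightarrow> nat \<Rightarrow> nat \<Rightarrow> (monom \<Rightarrow> 'a, module_monom \<Rightarrow> 'a) module" where
  "free_module A n r =
     \<lparr>carrier = fin_supp_funs A (module_monoms n r),
      mult = undefined, one = undefined,
      ring.zero = (\<lambda>X. \<zero>\<^bsub>A\<^esub>),
      add = (\<lambda>f g X. f X \<oplus>\<^bsub>A\<^esub> g X),
      smult = (\<lambda>p f (z, l). \<Oplus>\<^bsub>A\<^esub>x \<in> {x. x \<subseteq># z}. p x \<otimes>\<^bsub>A\<^esub> f (z - x, l))\<rparr>"

definition free_module_base ::
  "('a, 'm) ring_scheme \<Rightarrow> nat \<Rightarrow> nat \<Rightarrow> ('a, module_monom \<Rightarrow> 'a) module" where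
  "free_module_base A n r =
     \<lparr>carrier = fin_supp_funs A (module_monoms n r),
      mult = undefined, one = undefined,
      ring.zero = (\<lambda>X. \<zero>\<^bsub>A\<^esub>),
      add = (\<lambda>f g X. f X \<oplus>\<^bsub>A\<^esub> g X),
      smult = (\<lambda>c f X. c \<otimes>\<^bsub>A\<^esub> f X)\<rparr>"

definition homog_part ::
  "('a, 'm) ring_scheme \<Rightarrow> (nat \<Rightarrow> 'a set) \<Rightarrow> nat \<Rightarrow> nat \<Rightarrow> nat \<Rightarrow> (module_monom \<Rightarrow> 'a) set" where
  "homog_part A \<A> n r i = {f \<in> carrier (free_module A n r). \<forall>X. f X \<in> \<A> i}"

definition homogeneous ::
  "('a, 'm) ring_scheme \<Rightarrow> enat \<Rightarrow> (nat \<Rightarrow> 'a set) \<Rightarrow> nat \<Rightarrow> nat \<Rightarrow> (module_monom \<Rightarrow> 'a) \<Rightarrow> bool" where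
  "homogeneous A a \<A> n r f \<longleftrightarrow>
     f \<noteq> \<zero>\<^bsub>free_module A n r\<^esub> \<and> (\<exists>i. enat i < a \<and> f \<in> homog_part A \<A> n r i)"

text \<open>
  The sum of the \<open>M \<inter> L\<^sub>i\<close> is automatically direct, because the sum of the \<open>L\<^sub>i\<close> is.
\<close>

definition graded_submodule ::
  "('a, 'm) ring_scheme \<Rightarrow> (nat \<Rightarrow> 'a set) \<Rightarrow> nat \<Rightarrow> nat \<Rightarrow> (module_monom \<Rightarrow> 'a) set \<Rightarrow> bool" where
  "graded_submodule A \<A> n r M \<longleftrightarrow>
     submodule M (mpoly_ring A n) (free_module A n r) \<and>
     (\<forall>f \<in> M. \<exists>h. (\<forall>i. h i \<in> M \<inter> homog_part A \<A> n r i) \<and>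
        finite {i. h i \<noteq> \<zero>\<^bsub>free_module A n r\<^esub>} \<and>
        f = (\<Oplus>\<^bsub>free_module A n r\<^esub>i \<in> {i. h i \<noteq> \<zero>\<^bsub>free_module A n r\<^esub>}. h i))"

section \<open>Term orders and Groebner bases\<close>

definition term_order ::
  "nat \<Rightarrow> nat \<Rightarrow> (module_monom \<Rightarrow> module_monom \<Rightarrow> bool) \<Rightarrow> bool" where
  "term_order n r prec \<longleftrightarrow>
     irreflp_on (module_monoms n r) prec \<and>
     transp_on (module_monoms n r) prec \<and>
     totalp_on (module_monoms n r) prec \<and>
     (\<forall>X \<in> module_monoms n r. \<forall>x \<in> monoms n. x \<noteq> {#} \<longrightarrow> prec X (monom_act x X)) \<and>
     (\<forall>X \<in> module_monoms n r. \<forall>Y \<in> module_monoms n r. \<forall>x \<in> monoms n.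
        prec X Y \<longrightarrow> prec (monom_act x X) (monom_act x Y))"

definition lp ::
  "('a, 'm) ring_scheme \<Rightarrow> (module_monom \<Rightarrow> module_monom \<Rightarrow> bool) \<Rightarrow> (module_monom \<Rightarrow> 'a)
     \<Rightarrow> module_monom" where
  "lp A prec f = (THE Y. f Y \<noteq> \<zero>\<^bsub>A\<^esub> \<and> (\<forall>Z. f Z \<noteq> \<zero>\<^bsub>A\<^esub> \<longrightarrow> Z \<noteq> Y \<longrightarrow> prec Z Y))"

definition lc ::
  "('a, 'm) ring_scheme \<Rightarrow> (module_monom \<Rightarrow> module_monom \<Rightarrow> bool) \<Rightarrow> (module_monom \<Rightarrow> 'a)
     \<Rightarrow> 'a" where
  "lc A prec f = f (lp A prec f)"

definition lt ::
  "('a, 'm) ring_scheme \<Rightarrow> (module_monom \<Rightarrow> module_monom \<Rightarrow> bool) \<Rightarrow> (module_monom \<Rightarrow> 'a)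
     \<Rightarrow> (module_monom \<Rightarrow> 'a)" where
  "lt A prec f = (\<lambda>X. if X = lp A prec f then lc A prec f else \<zero>\<^bsub>A\<^esub>)"

definition submodule_generated ::
  "('a, 'm) ring_scheme \<Rightarrow> ('a, 'b) module \<Rightarrow> 'b set \<Rightarrow> 'b set" where
  "submodule_generated R N S = \<Inter> {H. submodule H R N \<and> S \<subseteq> H}"

definition Lt ::
  "('a, 'm) ring_scheme \<Rightarrow> nat \<Rightarrow> nat \<Rightarrow> (module_monom \<Rightarrow> module_monom \<Rightarrow> bool)
     \<Rightarrow> (module_monom \<Rightarrow> 'a) set \<Rightarrow> (module_monom \<Rightarrow> 'a) set" where
  "Lt A n r prec S = submodule_generated (mpoly_ring A n) (free_module A n r)
     (lt A prec ` (S - {\<zero>\<^bsub>free_module A n r\<^esub>}))"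

definition groebner_basis ::
  "('a, 'm) ring_scheme \<Rightarrow> nat \<Rightarrow> nat \<Rightarrow> (module_monom \<Rightarrow> module_monom \<Rightarrow> bool)
     \<Rightarrow> (module_monom \<Rightarrow> 'a) set \<Rightarrow> (module_monom \<Rightarrow> 'a) set \<Rightarrow> bool" where
  "groebner_basis A n r prec M G \<longleftrightarrow>
     finite G \<and> G \<subseteq> M - {\<zero>\<^bsub>free_module A n r\<^esub>} \<and> Lt A n r prec G = Lt A n r prec M"

definition min_val ::
  "('a, 'm) ring_scheme \<Rightarrow> enat \<Rightarrow> (nat \<Rightarrow> 'a set) \<Rightarrow> nat
     \<Rightarrow> (module_monom \<Rightarrow> module_monom \<Rightarrow> bool) \<Rightarrow> (module_monom \<Rightarrow> 'a) set
     \<Rightarrow> module_monom \<Rightarrow> enat" where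
  "min_val A a \<A> n prec G X =
     (if \<exists>g \<in> G. monom_dvd n (lp A prec g) X
      then Min {enat (val \<A> (lc A prec g)) | g. g \<in> G \<and> monom_dvd n (lp A prec g) X}
      else a)"

section \<open>Quotients, flatness and rank\<close>

definition quotient_module :: "('a, 'b) module \<Rightarrow> 'b set \<Rightarrow> ('a, 'b set) module" where
  "quotient_module N H =
     \<lparr>carrier = a_rcosets\<^bsub>N\<^esub> H,
      mult = undefined, one = undefined,
      ring.zero = H,
      add = (<+>\<^bsub>N\<^esub>),
      smult = (\<lambda>c C. \<Union>x \<in> C. H +>\<^bsub>N\<^esub> (c \<odot>\<^bsub>N\<^esub> x))\<rparr>"

definition module_hom ::
  "('a, 'm) ring_scheme \<Rightarrow> ('a, 'b) module \<Rightarrow> ('a, 'c) module \<Rightarrow> ('b \<Rightarrow> 'c) set" where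
  "module_hom A N N' =
     {\<phi> \<in> hom (add_monoid N) (add_monoid N').
        \<forall>c \<in> carrier A. \<forall>x \<in> carrier N. \<phi> (c \<odot>\<^bsub>N\<^esub> x) = c \<odot>\<^bsub>N'\<^esub> \<phi> x}"

definition tensor_relations ::
  "('a, 'm) ring_scheme \<Rightarrow> ('a, 'b) module \<Rightarrow> ('a, 'c) module \<Rightarrow> ('b \<times> 'c \<Rightarrow>\<^sub>0 int) set" where
  "tensor_relations A N P =
     {frag_of (x \<oplus>\<^bsub>N\<^esub> y, p) - frag_of (x, p) - frag_of (y, p) | x y p.
        x \<in> carrier N \<and> y \<in> carrier N \<and> p \<in> carrier P} \<union>
     {frag_of (x, p \<oplus>\<^bsub>P\<^esub> q) - frag_of (x, p) - frag_of (x, q) | x p q.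
        x \<in> carrier N \<and> p \<in> carrier P \<and> q \<in> carrier P} \<union>
     {frag_of (c \<odot>\<^bsub>N\<^esub> x, p) - frag_of (x, c \<odot>\<^bsub>P\<^esub> p) | c x p.
        c \<in> carrier A \<and> x \<in> carrier N \<and> p \<in> carrier P}"

definition tensor_kernel ::
  "('a, 'm) ring_scheme \<Rightarrow> ('a, 'b) module \<Rightarrow> ('a, 'c) module \<Rightarrow> ('b \<times> 'c \<Rightarrow>\<^sub>0 int) set" where
  "tensor_kernel A N P =
     generate (free_Abelian_group (carrier N \<times> carrier P)) (tensor_relations A N P)"

text \<open>The underlying abelian group of the tensor product, which is all that flatness needs.\<close>

definition tensor_product ::
  "('a, 'm) ring_scheme \<Rightarrow> ('a, 'b) module \<Rightarrow> ('a, 'c) module \<Rightarrow> ('b \<times> 'c \<Rightarrow>\<^sub>0 int) set monoid" where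
  "tensor_product A N P =
     free_Abelian_group (carrier N \<times> carrier P) Mod tensor_kernel A N P"

definition pure_tensor ::
  "('a, 'm) ring_scheme \<Rightarrow> ('a, 'b) module \<Rightarrow> ('a, 'c) module \<Rightarrow> 'b \<Rightarrow> 'c
     \<Rightarrow> ('b \<times> 'c \<Rightarrow>\<^sub>0 int) set" where
  "pure_tensor A N P x p =
     tensor_kernel A N P #>\<^bsub>free_Abelian_group (carrier N \<times> carrier P)\<^esub> frag_of (x, p)"

text \<open>
  \<open>P\<close> is flat if tensoring with \<open>P\<close> preserves injectivity of \<open>A\<close>-linear maps. The map
  \<open>h\<close> below is the map induced by \<open>\<phi>\<close>: its values on the pure tensors determine it, since
  these generate the tensor product.

  A definition cannot quantify over all types, so the test modules have their carriers in
  \<open>'a + 'u\<close>. Here \<open>'u\<close> is an arbitrary type, so that modules on any type are covered (via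
  \<open>Inr\<close>), and the summand \<open>'a\<close> provides room for the ideals of \<open>A\<close> (via \<open>Inl\<close>). Testing the
  inclusions of ideals into \<open>A\<close> is already enough for flatness, so the notion does not depend on
  the choice of \<open>'u\<close>.
\<close>

definition flat ::
  "'u itself \<Rightarrow> ('a, 'm) ring_scheme \<Rightarrow> ('a, 'c) module \<Rightarrow> bool" where
  "flat U A P \<longleftrightarrow> module A P \<and>
     (\<forall>(N' :: ('a, 'a + 'u) module) (N :: ('a, 'a + 'u) module) \<phi>.
        module A N' \<and> module A N \<and> \<phi> \<in> module_hom A N' N \<and> inj_on \<phi> (carrier N') \<longrightarrow>
        (\<exists>h \<in> hom (tensor_product A N' P) (tensor_product A N P).
           (\<forall>x \<in> carrier N'. \<forall>p \<in> carrier P.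
              h (pure_tensor A N' P x p) = pure_tensor A N P (\<phi> x) p) \<and>
           inj_on h (carrier (tensor_product A N' P))))"

definition module_basis ::
  "('a, 'm) ring_scheme \<Rightarrow> ('a, 'b) module \<Rightarrow> 'b set \<Rightarrow> bool" where
  "module_basis A N B \<longleftrightarrow> B \<subseteq> carrier N \<and>
     (\<forall>x \<in> carrier N. \<exists>!c. c \<in> fin_supp_funs A B \<and>
        x = (\<Oplus>\<^bsub>N\<^esub>b \<in> {b. c b \<noteq> \<zero>\<^bsub>A\<^esub>}. c b \<odot>\<^bsub>N\<^esub> b))"

text \<open>
  Ranks may be infinite. The following says that \<open>N\<close> has an \<open>A\<close>-basis, and that the common
  cardinality of the \<open>A\<close>-bases of \<open>N\<close> is the cardinality of \<open>S\<close>.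
\<close>

definition rank_is_card ::
  "('a, 'm) ring_scheme \<Rightarrow> ('a, 'b) module \<Rightarrow> 'd set \<Rightarrow> bool" where
  "rank_is_card A N S \<longleftrightarrow>
     (\<exists>B. module_basis A N B) \<and> (\<forall>B. module_basis A N B \<longrightarrow> B \<approx> S)"

end

theory Submission
  imports Defs
begin

text \<open>
  If every leading coefficient can be replaced by a unit, then each monomial outside
  \<open>{X. m\<^sub>X = a}\<close> can be rewritten modulo \<open>M\<close> by smaller ones, and a term order is well-founded
  by Dickson's lemma; so the monomials with \<open>m\<^sub>X = a\<close> span \<open>L/M\<close>. They are linearly
  independent because the leading monomial of an element of \<open>M\<close> is divisible by one of \<open>G\<close>.
  Hence \<open>L/M\<close> is free.

  Conversely, a homogeneous \<open>g \<in> G\<close> with leading coefficient \<open>w\<close> is \<open>w g\<^sub>0\<close> for some \<open>g\<^sub>0\<close> with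
  coefficients in \<open>k\<close>, so \<open>w\<close> annihilates the class of \<open>g\<^sub>0\<close>. Flatness, applied to the inclusion
  of the ideal \<open>(w)\<close> into \<open>A\<close>, puts \<open>g\<^sub>0\<close> into \<open>M\<close> modulo elements of positive degree, hence into
  \<open>M\<close>. The leading coefficient of \<open>g\<^sub>0\<close> is a unit, so some \<open>g' \<in> G\<close> with unit leading coefficient
  has a leading monomial dividing that of \<open>g\<close>.
\<close>

section \<open>Linear combinations\<close>

text \<open>Flatness is available only as injectivity between tensor products, which are quotients
  of free abelian groups. The two directions need different tools: for a free module every
  coordinate of a tensor can be read off, whereas in the converse direction one well-chosen balanced
  map suffices to exploit that a tensor vanishes. Dividing \<open>g\<close> by its leading
  coefficient \<open>w\<close> is possible because each graded piece of \<open>A\<close> is a line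
  over \<open>k\<close>, even though \<open>w\<close> need not be a unit. Vanishing of the tensor of
  \<open>w\<close> and the class of the quotient over the ideal generated by \<open>w\<close> gives
  information only up to the annihilator of \<open>w\<close>. That annihilator may be non-zero when
  \<open>a\<close> is finite, but it has no degree 0 component. This is why membership in
  \<open>M\<close> is first obtained modulo positive degrees; gradedness of \<open>M\<close> then
  removes the error, since the quotient is concentrated in degree 0. For the rank, \<open>A\<close>
  is in general not a field, so finite bases are compared after passing to the residue field
  \<open>k\<close>; infinite ones are compared by countability of the set of monomials.\<close>

definition lincomb :: "('a, 'm) ring_scheme \<Rightarrow> ('a, 'b, 'n) module_scheme \<Rightarrow> ('b \<Rightarrow> 'a) \<Rightarrow> 'b" where
  "lincomb A N c = (\<Oplus>\<^bsub>N\<^esub>b \<in> {b. c b \<noteq> \<zero>\<^bsub>A\<^esub>}. c b \<odot>\<^bsub>N\<^esub> b)"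

lemma module_basis_iff:
  "module_basis A N B \<longleftrightarrow> B \<subseteq> carrier N \<and>
     (\<forall>x \<in> carrier N. \<exists>!c. c \<in> fin_supp_funs A B \<and> x = lincomb A N c)"
  by (simp add: module_basis_def lincomb_def)

lemma fin_supp_funs_closed: "c \<in> fin_supp_funs A B \<Longrightarrow> c b \<in> carrier A"
  and fin_supp_funs_finite: "c \<in> fin_supp_funs A B \<Longrightarrow> finite {b. c b \<noteq> \<zero>\<^bsub>A\<^esub>}"
  and fin_supp_funs_supp: "c \<in> fin_supp_funs A B \<Longrightarrow> {b. c b \<noteq> \<zero>\<^bsub>A\<^esub>} \<subseteq> B"
  by (auto simp: fin_supp_funs_def)

lemma fin_supp_funs_zero_outside: "c \<in> fin_supp_funs A B \<Longrightarrow> b \<notin> B \<Longrightarrow> c b = \<zero>\<^bsub>A\<^esub>"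
  by (auto simp: fin_supp_funs_def)

lemma fin_supp_funsI:
  assumes "\<And>b. c b \<in> carrier A" "\<And>b. b \<notin> D \<Longrightarrow> c b = \<zero>\<^bsub>A\<^esub>" "finite D" "D \<subseteq> B"
  shows "c \<in> fin_supp_funs A B"
proof -
  have "{b. c b \<noteq> \<zero>\<^bsub>A\<^esub>} \<subseteq> D" using assms(2) by blast
  then show ?thesis using assms by (auto simp: fin_supp_funs_def intro: finite_subset)
qed

context cring
begin

lemma fin_supp_funs_zero: "(\<lambda>b. \<zero>) \<in> fin_supp_funs R B"
  by (simp add: fin_supp_funs_def)

lemma fin_supp_funs_add:
  assumes "c \<in> fin_supp_funs R B" "d \<in> fin_supp_funs R B"
  shows "(\<lambda>b. c b \<oplus> d b) \<in> fin_supp_funs R B"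
  by (rule fin_supp_funsI[where D = "{b. c b \<noteq> \<zero>} \<union> {b. d b \<noteq> \<zero>}"])
     (use assms in \<open>auto simp: fin_supp_funs_def\<close>)

lemma fin_supp_funs_smult:
  assumes "c \<in> fin_supp_funs R B" "u \<in> carrier R"
  shows "(\<lambda>b. u \<otimes> c b) \<in> fin_supp_funs R B"
  by (rule fin_supp_funsI[where D = "{b. c b \<noteq> \<zero>}"])
     (use assms in \<open>auto simp: fin_supp_funs_def\<close>)

lemma fin_supp_funs_minus:
  assumes "c \<in> fin_supp_funs R B"
  shows "(\<lambda>b. \<ominus> c b) \<in> fin_supp_funs R B"
  by (rule fin_supp_funsI[where D = "{b. c b \<noteq> \<zero>}"])
     (use assms in \<open>auto simp: fin_supp_funs_def\<close>)

lemma fin_supp_funs_unit: "b \<in> B \<Longrightarrow> (\<lambda>x. if x = b then \<one> else \<zero>) \<in> fin_supp_funs R B"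
  by (rule fin_supp_funsI[where D = "{b}"]) auto

end

context module
begin

text \<open>Supports shrink when coefficients cancel, so two combinations are compared over a common
  index set; terms outside the support vanish and may be added freely.\<close>

lemma lincomb_superset:
  assumes "c \<in> fin_supp_funs R B" "{b. c b \<noteq> \<zero>} \<subseteq> D" "D \<subseteq> carrier M" "finite D"
  shows "lincomb R M c = (\<Oplus>\<^bsub>M\<^esub>b \<in> D. c b \<odot>\<^bsub>M\<^esub> b)"
  unfolding lincomb_def
  by (rule M.add.finprod_mono_neutral_cong_left)
     (use assms in \<open>auto simp: fin_supp_funs_def\<close>)

lemma lincomb_closed:
  assumes "c \<in> fin_supp_funs R B" "B \<subseteq> carrier M"
  shows "lincomb R M c \<in> carrier M"
  unfolding lincomb_def
  by (rule M.finsum_closed) (use assms in \<open>auto simp: fin_supp_funs_def\<close>)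

lemma lincomb_add:
  assumes c: "c \<in> fin_supp_funs R B" and d: "d \<in> fin_supp_funs R B" and B: "B \<subseteq> carrier M"
  shows "lincomb R M (\<lambda>b. c b \<oplus> d b) = lincomb R M c \<oplus>\<^bsub>M\<^esub> lincomb R M d"
proof -
  let ?D = "{b. c b \<noteq> \<zero>} \<union> {b. d b \<noteq> \<zero>}"
  have D: "?D \<subseteq> carrier M" "finite ?D"
    using assms by (auto simp: fin_supp_funs_def)
  have sub: "{b. c b \<oplus> d b \<noteq> \<zero>} \<subseteq> ?D" by auto
  have cl: "\<And>b. c b \<in> carrier R" "\<And>b. d b \<in> carrier R"
    using c d by (auto simp: fin_supp_funs_def)
  have "lincomb R M (\<lambda>b. c b \<oplus> d b) = (\<Oplus>\<^bsub>M\<^esub>b \<in> ?D. (c b \<oplus> d b) \<odot>\<^bsub>M\<^esub> b)"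
    by (rule lincomb_superset[OF fin_supp_funs_add[OF c d] sub D])
  also have "\<dots> = (\<Oplus>\<^bsub>M\<^esub>b \<in> ?D. c b \<odot>\<^bsub>M\<^esub> b \<oplus>\<^bsub>M\<^esub> d b \<odot>\<^bsub>M\<^esub> b)"
    by (rule M.finsum_cong') (use D cl in \<open>auto simp: smult_l_distr subset_iff\<close>)
  also have "\<dots> = (\<Oplus>\<^bsub>M\<^esub>b \<in> ?D. c b \<odot>\<^bsub>M\<^esub> b) \<oplus>\<^bsub>M\<^esub> (\<Oplus>\<^bsub>M\<^esub>b \<in> ?D. d b \<odot>\<^bsub>M\<^esub> b)"
    by (rule M.finsum_addf) (use D cl in \<open>auto simp: subset_iff\<close>)
  also have "\<dots> = lincomb R M c \<oplus>\<^bsub>M\<^esub> lincomb R M d"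
    using lincomb_superset[OF c _ D] lincomb_superset[OF d _ D] by simp
  finally show ?thesis .
qed

lemma lincomb_smult:
  assumes c: "c \<in> fin_supp_funs R B" and u: "u \<in> carrier R" and B: "B \<subseteq> carrier M"
  shows "lincomb R M (\<lambda>b. u \<otimes> c b) = u \<odot>\<^bsub>M\<^esub> lincomb R M c"
proof -
  let ?D = "{b. c b \<noteq> \<zero>}"
  have D: "?D \<subseteq> carrier M" "finite ?D"
    using assms by (auto simp: fin_supp_funs_def)
  have sub: "{b. u \<otimes> c b \<noteq> \<zero>} \<subseteq> ?D" using u by auto
  have cl: "\<And>b. c b \<in> carrier R"
    using c by (auto simp: fin_supp_funs_def)
  have "lincomb R M (\<lambda>b. u \<otimes> c b) = (\<Oplus>\<^bsub>M\<^esub>b \<in> ?D. (u \<otimes> c b) \<odot>\<^bsub>M\<^esub> b)"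
    by (rule lincomb_superset[OF fin_supp_funs_smult[OF c u] sub D])
  also have "\<dots> = (\<Oplus>\<^bsub>M\<^esub>b \<in> ?D. u \<odot>\<^bsub>M\<^esub> (c b \<odot>\<^bsub>M\<^esub> b))"
    by (rule M.finsum_cong') (use D cl u in \<open>auto simp: smult_assoc1 subset_iff\<close>)
  also have "\<dots> = u \<odot>\<^bsub>M\<^esub> lincomb R M c"
    unfolding lincomb_def
    by (rule finsum_smult_ldistr[symmetric]) (use D cl u in \<open>auto simp: subset_iff\<close>)
  finally show ?thesis .
qed

lemma lincomb_zero: "lincomb R M (\<lambda>b. \<zero>) = \<zero>\<^bsub>M\<^esub>"
  by (simp add: lincomb_def)

lemma lincomb_unit:
  assumes "b \<in> carrier M"
  shows "lincomb R M (\<lambda>x. if x = b then \<one> else \<zero>) = b"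
proof -
  have "lincomb R M (\<lambda>x. if x = b then \<one> else \<zero>)
      = (\<Oplus>\<^bsub>M\<^esub>x \<in> {b}. (if x = b then \<one> else \<zero>) \<odot>\<^bsub>M\<^esub> x)"
    by (rule lincomb_superset[where B = "{b}"]) (use assms fin_supp_funs_unit[of b "{b}"] in auto)
  then show ?thesis using assms by simp
qed

end

lemma module_basisI:
  fixes R (structure) and M :: "('a, 'b) module" (structure)
  assumes "module R M" and B: "B \<subseteq> carrier M"
    and span: "\<And>x. x \<in> carrier M \<Longrightarrow> \<exists>c \<in> fin_supp_funs R B. x = lincomb R M c"
    and indep: "\<And>c. c \<in> fin_supp_funs R B \<Longrightarrow> lincomb R M c = \<zero>\<^bsub>M\<^esub> \<Longrightarrow> c = (\<lambda>b. \<zero>)"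
  shows "module_basis R M B"
  unfolding module_basis_iff
proof (intro conjI ballI B)
  interpret module R M by fact
  fix x assume x: "x \<in> carrier M"
  obtain c where c: "c \<in> fin_supp_funs R B" "x = lincomb R M c" using span[OF x] by blast
  show "\<exists>!c. c \<in> fin_supp_funs R B \<and> x = lincomb R M c"
  proof (rule ex1I[of _ c])
    fix d assume d: "d \<in> fin_supp_funs R B \<and> x = lincomb R M d"
    \<comment> \<open>The opposite family is written with the scalar
      \<open>\<ominus> \<one>\<close>, so that additivity and homogeneity of \<open>lincomb\<close>
      cover the difference of \<open>c\<close> and \<open>d\<close>.\<close>
    let ?m = "\<lambda>b. \<ominus> \<one> \<otimes> d b"
    have m: "?m \<in> fin_supp_funs R B"
      by (rule fin_supp_funs_smult) (use d in auto)
    have "lincomb R M (\<lambda>b. c b \<oplus> ?m b) = x \<oplus>\<^bsub>M\<^esub> (\<ominus> \<one>) \<odot>\<^bsub>M\<^esub> x"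
      using lincomb_add[OF c(1) m B] lincomb_smult[of d B "\<ominus> \<one>"] c d B by simp
    also have "\<dots> = \<zero>\<^bsub>M\<^esub>"
      using x by (simp add: smult_l_minus M.r_neg)
    finally have z: "(\<lambda>b. c b \<oplus> ?m b) = (\<lambda>b. \<zero>)"
      using indep fin_supp_funs_add[OF c(1) m] by blast
    show "d = c"
    proof
      fix b
      have "c b \<oplus> \<ominus> \<one> \<otimes> d b = \<zero>" using z by (rule fun_cong)
      then show "d b = c b"
        using fin_supp_funs_closed[OF c(1), of b] fin_supp_funs_closed[OF conjunct1[OF d], of b]
        by (metis R.add.inv_closed R.l_minus R.l_one R.minus_equality R.minus_minus R.one_closed R.add.m_comm)
    qed
  qed (use c in simp)
qed

section \<open>Tensor products and flatness\<close>

lemma tensor_relations_carrier: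
  assumes "module A N" "module A P"
  shows "tensor_relations A N P \<subseteq> carrier (free_Abelian_group (carrier N \<times> carrier P))"
proof -
  interpret N: module A N by fact
  interpret P: module A P by fact
  show ?thesis
    unfolding tensor_relations_def
    by (auto dest!: subsetD[OF keys_diff])
qed

lemma subgroup_tensor_kernel:
  assumes "module A N" "module A P"
  shows "subgroup (tensor_kernel A N P) (free_Abelian_group (carrier N \<times> carrier P))"
  unfolding tensor_kernel_def
  by (rule group.generate_is_subgroup[OF group_free_Abelian_group tensor_relations_carrier[OF assms]])

lemma tensor_kernel_zero:
  "0 \<in> tensor_kernel A N P"
  unfolding tensor_kernel_def
  using generate.one[of "free_Abelian_group (carrier N \<times> carrier P)"] by simp

lemma tensor_kernel_add:
  assumes "z \<in> tensor_kernel A N P" "w \<in> tensor_kernel A N P"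
  shows "z + w \<in> tensor_kernel A N P"
  using generate.eng[of z "free_Abelian_group (carrier N \<times> carrier P)" _ w] assms
  unfolding tensor_kernel_def by simp

lemma tensor_kernel_keys:
  assumes "module A N" "module A P" "z \<in> tensor_kernel A N P"
  shows "Poly_Mapping.keys z \<subseteq> carrier N \<times> carrier P"
  using subgroup.mem_carrier[OF subgroup_tensor_kernel[OF assms(1,2)] assms(3)] by simp

lemma tensor_kernel_minus:
  assumes "module A N" "module A P" "z \<in> tensor_kernel A N P"
  shows "- z \<in> tensor_kernel A N P"
  using subgroup.m_inv_closed[OF subgroup_tensor_kernel[OF assms(1,2)] assms(3)]
    tensor_kernel_keys[OF assms] by simp

lemma tensor_kernel_diff:
  assumes "module A N" "module A P" "z \<in> tensor_kernel A N P" "w \<in> tensor_kernel A N P"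
  shows "z - w \<in> tensor_kernel A N P"
  using tensor_kernel_add[OF assms(3) tensor_kernel_minus[OF assms(1,2,4)]] by simp

lemma tensor_relations_mem:
  "x \<in> carrier N \<Longrightarrow> y \<in> carrier N \<Longrightarrow> p \<in> carrier P \<Longrightarrow>
     frag_of (x \<oplus>\<^bsub>N\<^esub> y, p) - frag_of (x, p) - frag_of (y, p) \<in> tensor_kernel A N P"
  "x \<in> carrier N \<Longrightarrow> p \<in> carrier P \<Longrightarrow> q \<in> carrier P \<Longrightarrow>
     frag_of (x, p \<oplus>\<^bsub>P\<^esub> q) - frag_of (x, p) - frag_of (x, q) \<in> tensor_kernel A N P"
  "c \<in> carrier A \<Longrightarrow> x \<in> carrier N \<Longrightarrow> p \<in> carrier P \<Longrightarrow>
     frag_of (c \<odot>\<^bsub>N\<^esub> x, p) - frag_of (x, c \<odot>\<^bsub>P\<^esub> p) \<in> tensor_kernel A N P"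
  unfolding tensor_kernel_def tensor_relations_def
  by (blast intro!: generate.incl)+

text \<open>For the sum of zero with itself the additivity relation collapses to minus the
  generator.\<close>

lemma tensor_kernel_zero_left:
  assumes "module A N" "module A P" "p \<in> carrier P"
  shows "frag_of (\<zero>\<^bsub>N\<^esub>, p) \<in> tensor_kernel A N P"
proof -
  interpret N: module A N by fact
  have "frag_of (\<zero>\<^bsub>N\<^esub> \<oplus>\<^bsub>N\<^esub> \<zero>\<^bsub>N\<^esub>, p) - frag_of (\<zero>\<^bsub>N\<^esub>, p) - frag_of (\<zero>\<^bsub>N\<^esub>, p) \<in> tensor_kernel A N P"
    by (rule tensor_relations_mem) (use assms in auto)
  then show ?thesis using tensor_kernel_minus[OF assms(1,2)] by fastforce
qed

lemma tensor_kernel_zero_right: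
  assumes "module A N" "module A P" "x \<in> carrier N"
  shows "frag_of (x, \<zero>\<^bsub>P\<^esub>) \<in> tensor_kernel A N P"
proof -
  interpret P: module A P by fact
  have "frag_of (x, \<zero>\<^bsub>P\<^esub> \<oplus>\<^bsub>P\<^esub> \<zero>\<^bsub>P\<^esub>) - frag_of (x, \<zero>\<^bsub>P\<^esub>) - frag_of (x, \<zero>\<^bsub>P\<^esub>) \<in> tensor_kernel A N P"
    by (rule tensor_relations_mem) (use assms in auto)
  then show ?thesis using tensor_kernel_minus[OF assms(1,2)] by fastforce
qed

lemma hom_free_Abelian_group_diff:
  assumes "group T" "h \<in> hom (free_Abelian_group S) T"
    "Poly_Mapping.keys x \<subseteq> S" "Poly_Mapping.keys y \<subseteq> S"
  shows "h (x - y) = h x \<otimes>\<^bsub>T\<^esub> inv\<^bsub>T\<^esub> h y"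
proof -
  interpret h: group_hom "free_Abelian_group S" T h
    using assms by (simp add: group_hom_def group_hom_axioms_def)
  have "h (x \<otimes>\<^bsub>free_Abelian_group S\<^esub> inv\<^bsub>free_Abelian_group S\<^esub> y) = h x \<otimes>\<^bsub>T\<^esub> inv\<^bsub>T\<^esub> h y"
    using assms h.hom_mult[of x "inv\<^bsub>free_Abelian_group S\<^esub> y"] h.hom_inv[of y]
      h.G.inv_closed[of y] by (simp del: mult_free_Abelian_group inv_free_Abelian_group)
  then show ?thesis using assms by simp
qed

text \<open>The universal property of the tensor product, kept on the level of the free abelian
  group: the map is extended from generators and checked on the relations, so nothing has to be
  defined on cosets.\<close>

lemma balanced_map_extends:
  assumes T: "comm_group T" and N: "module A N" and P: "module A P"
    and closed: "\<And>x p. x \<in> carrier N \<Longrightarrow> p \<in> carrier P \<Longrightarrow> f x p \<in> carrier T"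
    and add_left: "\<And>x y p. x \<in> carrier N \<Longrightarrow> y \<in> carrier N \<Longrightarrow> p \<in> carrier P \<Longrightarrow>
       f (x \<oplus>\<^bsub>N\<^esub> y) p = f x p \<otimes>\<^bsub>T\<^esub> f y p"
    and add_right: "\<And>x p q. x \<in> carrier N \<Longrightarrow> p \<in> carrier P \<Longrightarrow> q \<in> carrier P \<Longrightarrow>
       f x (p \<oplus>\<^bsub>P\<^esub> q) = f x p \<otimes>\<^bsub>T\<^esub> f x q"
    and balanced: "\<And>c x p. c \<in> carrier A \<Longrightarrow> x \<in> carrier N \<Longrightarrow> p \<in> carrier P \<Longrightarrow>
       f (c \<odot>\<^bsub>N\<^esub> x) p = f x (c \<odot>\<^bsub>P\<^esub> p)"
  obtains h where "h \<in> hom (free_Abelian_group (carrier N \<times> carrier P)) T"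
    "\<And>x p. x \<in> carrier N \<Longrightarrow> p \<in> carrier P \<Longrightarrow> h (frag_of (x, p)) = f x p"
    "\<And>z. z \<in> tensor_kernel A N P \<Longrightarrow> h z = \<one>\<^bsub>T\<^esub>"
proof -
  interpret T: comm_group T by fact
  interpret N: module A N by fact
  interpret P: module A P by fact
  let ?F = "free_Abelian_group (carrier N \<times> carrier P)"
  obtain h where h: "h \<in> hom ?F T"
    "\<And>u. u \<in> carrier N \<times> carrier P \<Longrightarrow> h (frag_of u) = case_prod f u"
    by (rule T.free_Abelian_group_universal[of "case_prod f" "carrier N \<times> carrier P"])
       (use closed in auto)
  have hf: "h (frag_of (x, p)) = f x p" if "x \<in> carrier N" "p \<in> carrier P" for x p
    using h(2)[of "(x, p)"] that by simp
  interpret h: group_hom ?F T h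
    using h T.is_group by (simp add: group_hom_def group_hom_axioms_def)
  have hd: "h (x - y) = h x \<otimes>\<^bsub>T\<^esub> inv\<^bsub>T\<^esub> h y"
    if "Poly_Mapping.keys x \<subseteq> carrier N \<times> carrier P"
       "Poly_Mapping.keys y \<subseteq> carrier N \<times> carrier P" for x y
    using hom_free_Abelian_group_diff[OF T.is_group h(1) that] .
  have kd: "Poly_Mapping.keys (frag_of u - frag_of v) \<subseteq> carrier N \<times> carrier P"
    if "u \<in> carrier N \<times> carrier P" "v \<in> carrier N \<times> carrier P"
    for u v
    using that keys_diff[of "frag_of u" "frag_of v"] by auto
  \<comment> \<open>Both additivity relations are sent to an expression of this shape.\<close>
  have cancel: "u \<otimes>\<^bsub>T\<^esub> v \<otimes>\<^bsub>T\<^esub> inv\<^bsub>T\<^esub> u \<otimes>\<^bsub>T\<^esub> inv\<^bsub>T\<^esub> v = \<one>\<^bsub>T\<^esub>"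
    if "u \<in> carrier T" "v \<in> carrier T" for u v
    using that T.m_comm[of u v] by (simp add: T.m_assoc)
  have "tensor_relations A N P \<subseteq> kernel ?F T h"
  proof
    fix z assume z: "z \<in> tensor_relations A N P"
    have "h z = \<one>\<^bsub>T\<^esub>"
      using z unfolding tensor_relations_def
    proof (elim UnE CollectE exE conjE)
      fix x y p assume *: "z = frag_of (x \<oplus>\<^bsub>N\<^esub> y, p) - frag_of (x, p) - frag_of (y, p)"
        "x \<in> carrier N" "y \<in> carrier N" "p \<in> carrier P"
      then show ?thesis
        using closed by (simp add: hd kd hf add_left cancel)
    next
      fix x p q assume *: "z = frag_of (x, p \<oplus>\<^bsub>P\<^esub> q) - frag_of (x, p) - frag_of (x, q)"
        "x \<in> carrier N" "p \<in> carrier P" "q \<in> carrier P"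
      then show ?thesis
        using closed by (simp add: hd kd hf add_right cancel)
    next
      fix c x p assume *: "z = frag_of (c \<odot>\<^bsub>N\<^esub> x, p) - frag_of (x, c \<odot>\<^bsub>P\<^esub> p)"
        "c \<in> carrier A" "x \<in> carrier N" "p \<in> carrier P"
      then show ?thesis
        using closed
        by (simp add: hd kd hf balanced)
    qed
    then show "z \<in> kernel ?F T h"
      using subsetD[OF tensor_relations_carrier[OF N P] z] by (simp add: kernel_def)
  qed
  then have "tensor_kernel A N P \<subseteq> kernel ?F T h"
    unfolding tensor_kernel_def
    by (rule h.G.generate_subgroup_incl[OF _ h.subgroup_kernel])
  then show ?thesis using that[OF h(1) hf] by (auto simp: kernel_def)
qed

lemma tensor_kernel_sum:
  assumes "\<And>b. b \<in> E \<Longrightarrow> f b \<in> tensor_kernel A N P"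
  shows "sum f E \<in> tensor_kernel A N P"
  using assms
  by (induction E rule: infinite_finite_induct) (auto intro: tensor_kernel_zero tensor_kernel_add)

lemma tensor_finsum_right:
  assumes N: "module A N" and P: "module A P" and x: "x \<in> carrier N"
    and E: "finite E" "g \<in> E \<rightarrow> carrier P"
  shows "frag_of (x, \<Oplus>\<^bsub>P\<^esub>b \<in> E. g b) - (\<Sum>b\<in>E. frag_of (x, g b)) \<in> tensor_kernel A N P"
  using E
proof (induction E rule: finite_induct)
  case empty
  interpret P: module A P by fact
  show ?case using tensor_kernel_zero_right[OF N P x] by simp
next
  case (insert b E)
  interpret P: module A P by fact
  let ?s = "\<Oplus>\<^bsub>P\<^esub>b \<in> E. g b"
  have cl: "g b \<in> carrier P" "g \<in> E \<rightarrow> carrier P" "?s \<in> carrier P"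
    using insert by auto
  have "frag_of (x, g b \<oplus>\<^bsub>P\<^esub> ?s) - frag_of (x, g b) - frag_of (x, ?s) \<in> tensor_kernel A N P"
    by (rule tensor_relations_mem) (use x cl in auto)
  from tensor_kernel_add[OF this insert.IH[OF cl(2)]] show ?case
    using insert cl by (simp add: algebra_simps)
qed

lemma tensor_diff_left:
  assumes N: "module A N" and P: "module A P"
    and x: "x \<in> carrier N" "y \<in> carrier N" "p \<in> carrier P"
  shows "frag_of (x \<oplus>\<^bsub>N\<^esub> \<ominus>\<^bsub>N\<^esub> y, p) - (frag_of (x, p) - frag_of (y, p)) \<in> tensor_kernel A N P"
proof -
  interpret N: module A N by fact
  let ?y = "\<ominus>\<^bsub>N\<^esub> y"
  have "frag_of (x \<oplus>\<^bsub>N\<^esub> ?y, p) - frag_of (x, p) - frag_of (?y, p) \<in> tensor_kernel A N P"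
    by (rule tensor_relations_mem) (use x in auto)
  moreover have "frag_of (y \<oplus>\<^bsub>N\<^esub> ?y, p) - frag_of (y, p) - frag_of (?y, p) \<in> tensor_kernel A N P"
    by (rule tensor_relations_mem) (use x in auto)
  \<comment> \<open>Subtracting the relation for \<open>y \<oplus> \<ominus> y\<close> removes the
    generator with \<open>\<ominus> y\<close>; what is left over is a generator with first entry
    zero, itself in the kernel.\<close>
  ultimately have "(frag_of (x \<oplus>\<^bsub>N\<^esub> ?y, p) - frag_of (x, p) - frag_of (?y, p)) -
    (frag_of (y \<oplus>\<^bsub>N\<^esub> ?y, p) - frag_of (y, p) - frag_of (?y, p)) +
    frag_of (\<zero>\<^bsub>N\<^esub>, p) \<in> tensor_kernel A N P"
    using tensor_kernel_zero_left[OF N P x(3)]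
    by (rule tensor_kernel_add[OF tensor_kernel_diff[OF N P]])
  then show ?thesis using x by (simp add: N.M.r_neg algebra_simps)
qed

section \<open>Coordinates in a basis, and tensor products with a free module\<close>

definition coef :: "('a, 'm) ring_scheme \<Rightarrow> ('a, 'b) module \<Rightarrow> 'b set \<Rightarrow> 'b \<Rightarrow> 'b \<Rightarrow> 'a" where
  "coef A P B p = (THE c. c \<in> fin_supp_funs A B \<and> p = lincomb A P c)"

context
  fixes A :: "('a, 'm) ring_scheme" and P :: "('a, 'b) module" and B :: "'b set"
  assumes P: "module A P" and basis: "module_basis A P B"
begin

interpretation P: module A P by (rule P)

lemma basis_subset: "B \<subseteq> carrier P"
  using basis by (simp add: module_basis_def)

lemma coef_fin_supp: "p \<in> carrier P \<Longrightarrow> coef A P B p \<in> fin_supp_funs A B"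
  and lincomb_coef: "p \<in> carrier P \<Longrightarrow> lincomb A P (coef A P B p) = p"
  using theI'[of "\<lambda>c. c \<in> fin_supp_funs A B \<and> p = lincomb A P c"] basis
  by (auto simp: coef_def module_basis_iff)

text \<open>Coordinates are computed by exhibiting a candidate: a finitely supported family with the
  right linear combination must be the coordinate family.\<close>

lemma coef_unique:
  assumes "c \<in> fin_supp_funs A B" "lincomb A P c = p"
  shows "coef A P B p = c"
proof -
  have "p \<in> carrier P" using P.lincomb_closed[OF assms(1) basis_subset] assms(2) by simp
  then show ?thesis
    using assms coef_fin_supp lincomb_coef basis unfolding module_basis_iff by metis
qed

lemma coef_closed: "p \<in> carrier P \<Longrightarrow> coef A P B p b \<in> carrier A"
  using coef_fin_supp by (rule fin_supp_funs_closed)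

lemma coef_add:
  "p \<in> carrier P \<Longrightarrow> q \<in> carrier P \<Longrightarrow>
    coef A P B (p \<oplus>\<^bsub>P\<^esub> q) b = coef A P B p b \<oplus>\<^bsub>A\<^esub> coef A P B q b"
  using coef_unique[OF P.fin_supp_funs_add[OF coef_fin_supp coef_fin_supp], of p q]
    P.lincomb_add[OF coef_fin_supp coef_fin_supp basis_subset, of p q]
  by (simp add: lincomb_coef)

lemma coef_smult:
  "c \<in> carrier A \<Longrightarrow> p \<in> carrier P \<Longrightarrow> coef A P B (c \<odot>\<^bsub>P\<^esub> p) b = c \<otimes>\<^bsub>A\<^esub> coef A P B p b"
  using coef_unique[OF P.fin_supp_funs_smult[OF coef_fin_supp], of p c]
    P.lincomb_smult[OF coef_fin_supp _ basis_subset, of p c]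
  by (simp add: lincomb_coef)

lemma coef_finsum:
  assumes "finite E" "g \<in> E \<rightarrow> carrier P"
  shows "coef A P B (\<Oplus>\<^bsub>P\<^esub>i\<in>E. g i) b = (\<Oplus>\<^bsub>A\<^esub>i\<in>E. coef A P B (g i) b)"
  using assms
proof (induction E rule: finite_induct)
  case empty
  have "coef A P B \<zero>\<^bsub>P\<^esub> = (\<lambda>b. \<zero>\<^bsub>A\<^esub>)"
    by (rule coef_unique[OF P.fin_supp_funs_zero P.lincomb_zero])
  then show ?case by simp
next
  case (insert i E)
  then show ?case by (simp add: coef_add coef_closed Pi_def)
qed

lemma coef_basis: "b \<in> B \<Longrightarrow> coef A P B b = (\<lambda>x. if x = b then \<one>\<^bsub>A\<^esub> else \<zero>\<^bsub>A\<^esub>)"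
  using coef_unique[OF P.fin_supp_funs_unit P.lincomb_unit] basis_subset by blast

text \<open>The map \<open>z \<mapsto> (H b z)\<^sub>b\<close> realises the isomorphism of \<open>N \<otimes> P\<close> with a direct sum of copies of \<open>N\<close>.\<close>

lemma tensor_coordinates:
  assumes N: "module A N"
  obtains H where
    "\<And>b. H b \<in> hom (free_Abelian_group (carrier N \<times> carrier P)) (add_monoid N)"
    "\<And>b x p. x \<in> carrier N \<Longrightarrow> p \<in> carrier P \<Longrightarrow> H b (frag_of (x, p)) = coef A P B p b \<odot>\<^bsub>N\<^esub> x"
    "\<And>z. Poly_Mapping.keys z \<subseteq> carrier N \<times> carrier P \<Longrightarrow>
       z \<in> tensor_kernel A N P \<longleftrightarrow> (\<forall>b. H b z = \<zero>\<^bsub>N\<^esub>)"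
proof -
  interpret N: module A N by fact
  let ?F = "free_Abelian_group (carrier N \<times> carrier P)"
  let ?K = "tensor_kernel A N P"
  \<comment> \<open>Using the \<open>b\<close>-th coordinate of the second entry as a scalar is
    balanced, because moving \<open>c\<close> across multiplies that coordinate by
    \<open>c\<close>.\<close>
  have "\<exists>h. h \<in> hom ?F (add_monoid N) \<and>
      (\<forall>x p. x \<in> carrier N \<longrightarrow> p \<in> carrier P \<longrightarrow> h (frag_of (x, p)) = coef A P B p b \<odot>\<^bsub>N\<^esub> x) \<and>
      (\<forall>z \<in> ?K. h z = \<zero>\<^bsub>N\<^esub>)" for b
  proof (rule balanced_map_extends[of "add_monoid N" A N P "\<lambda>x p. coef A P B p b \<odot>\<^bsub>N\<^esub> x"])
    show "comm_group (add_monoid N)" by (rule N.a_comm_group)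
    show "coef A P B p b \<odot>\<^bsub>N\<^esub> (c \<odot>\<^bsub>N\<^esub> x) = coef A P B (c \<odot>\<^bsub>P\<^esub> p) b \<odot>\<^bsub>N\<^esub> x"
      if "c \<in> carrier A" "x \<in> carrier N" "p \<in> carrier P" for c x p
    proof -
      have "coef A P B p b \<odot>\<^bsub>N\<^esub> (c \<odot>\<^bsub>N\<^esub> x) = (coef A P B p b \<otimes>\<^bsub>A\<^esub> c) \<odot>\<^bsub>N\<^esub> x"
        using that coef_closed by (simp add: N.smult_assoc1)
      then show ?thesis using that coef_closed by (simp add: coef_smult P.m_comm)
    qed
  qed (use N P coef_closed in \<open>auto simp: coef_add N.smult_l_distr N.smult_r_distr\<close>)
  then obtain H where hom: "\<And>b. H b \<in> hom ?F (add_monoid N)"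
    and H: "\<And>b x p. x \<in> carrier N \<Longrightarrow> p \<in> carrier P \<Longrightarrow> H b (frag_of (x, p)) = coef A P B p b \<odot>\<^bsub>N\<^esub> x"
    and HK: "\<And>b z. z \<in> ?K \<Longrightarrow> H b z = \<zero>\<^bsub>N\<^esub>"
    by metis
  have H0: "H b 0 = \<zero>\<^bsub>N\<^esub>" for b
    by (rule HK[OF tensor_kernel_zero])
  have Hcl: "H b z \<in> carrier N" if "Poly_Mapping.keys z \<subseteq> carrier N \<times> carrier P" for b z
    using hom_in_carrier[OF hom[of b], of z] that by simp
  have Hdiff: "H b (z - w) = H b z \<oplus>\<^bsub>N\<^esub> \<ominus>\<^bsub>N\<^esub> H b w"
    if "Poly_Mapping.keys z \<subseteq> carrier N \<times> carrier P"
       "Poly_Mapping.keys w \<subseteq> carrier N \<times> carrier P" for b z w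
    using hom_free_Abelian_group_diff[OF N.M.a_group hom that] by (simp add: a_inv_def)
  \<comment> \<open>Modulo the relations \<open>z\<close> equals the sum of the tensors of
    \<open>H b z\<close> with \<open>b\<close>. Allowing every finite \<open>E\<close> above some
    \<open>D\<close> gives the two terms of a difference a common index set in the
    induction.\<close>
  have *: "\<exists>D. finite D \<and> D \<subseteq> B \<and> (\<forall>E. finite E \<longrightarrow> D \<subseteq> E \<longrightarrow> E \<subseteq> B \<longrightarrow>
      z - (\<Sum>b\<in>E. frag_of (H b z, b)) \<in> ?K)"
    if "Poly_Mapping.keys z \<subseteq> carrier N \<times> carrier P" for z
    using that
  proof (induction z rule: free_Abelian_group_induct[consumes 1])
    case 1
    have "- (\<Sum>b\<in>E. frag_of (\<zero>\<^bsub>N\<^esub>, b)) \<in> ?K" if "E \<subseteq> B" for E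
      by (intro tensor_kernel_minus[OF N P] tensor_kernel_sum tensor_kernel_zero_left[OF N P])
         (use that basis_subset in auto)
    then show ?case
      by (intro exI[of _ "{}"]) (simp add: H0)
  next
    case (2 z w)
    obtain D1 where D1: "finite D1" "D1 \<subseteq> B" "\<And>E. finite E \<Longrightarrow> D1 \<subseteq> E \<Longrightarrow> E \<subseteq> B \<Longrightarrow>
      z - (\<Sum>b\<in>E. frag_of (H b z, b)) \<in> ?K" using 2 by blast
    obtain D2 where D2: "finite D2" "D2 \<subseteq> B" "\<And>E. finite E \<Longrightarrow> D2 \<subseteq> E \<Longrightarrow> E \<subseteq> B \<Longrightarrow>
      w - (\<Sum>b\<in>E. frag_of (H b w, b)) \<in> ?K" using 2 by blast
    show ?case
    proof (intro exI[of _ "D1 \<union> D2"] conjI allI impI)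
      fix E assume E: "finite E" "D1 \<union> D2 \<subseteq> E" "E \<subseteq> B"
      have s: "(\<Sum>b\<in>E. frag_of (H b (z - w), b) - (frag_of (H b z, b) - frag_of (H b w, b))) \<in> ?K"
      proof (rule tensor_kernel_sum)
        fix b assume "b \<in> E"
        then have "b \<in> carrier P" using E basis_subset by blast
        then show "frag_of (H b (z - w), b) - (frag_of (H b z, b) - frag_of (H b w, b)) \<in> ?K"
          using tensor_diff_left[OF N P, of "H b z" "H b w" b] Hcl 2(1,2) by (simp add: Hdiff)
      qed
      have "(z - (\<Sum>b\<in>E. frag_of (H b z, b))) - (w - (\<Sum>b\<in>E. frag_of (H b w, b)))
        - (\<Sum>b\<in>E. frag_of (H b (z - w), b) - (frag_of (H b z, b) - frag_of (H b w, b))) \<in> ?K"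
        using E by (intro tensor_kernel_diff[OF N P tensor_kernel_diff[OF N P D1(3) D2(3)] s]) auto
      then show "z - w - (\<Sum>b\<in>E. frag_of (H b (z - w), b)) \<in> ?K"
        by (simp add: sum_subtractf sum.distrib algebra_simps)
    qed (use D1 D2 in auto)
  next
    case (3 u)
    obtain x p where u: "u = (x, p)" "x \<in> carrier N" "p \<in> carrier P" using 3 by blast
    let ?c = "coef A P B p"
    show ?case
    proof (intro exI[of _ "{b. ?c b \<noteq> \<zero>\<^bsub>A\<^esub>}"] conjI allI impI)
      fix E assume E: "finite E" "{b. ?c b \<noteq> \<zero>\<^bsub>A\<^esub>} \<subseteq> E" "E \<subseteq> B"
      have EP: "E \<subseteq> carrier P" using E basis_subset by blast
      have p: "(\<Oplus>\<^bsub>P\<^esub>b\<in>E. ?c b \<odot>\<^bsub>P\<^esub> b) = p"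
        using P.lincomb_superset[OF coef_fin_supp[OF u(3)] E(2) EP E(1)] lincomb_coef[OF u(3)] by simp
      have "frag_of (x, \<Oplus>\<^bsub>P\<^esub>b\<in>E. ?c b \<odot>\<^bsub>P\<^esub> b) - (\<Sum>b\<in>E. frag_of (x, ?c b \<odot>\<^bsub>P\<^esub> b)) \<in> ?K"
        by (rule tensor_finsum_right[OF N P u(2) E(1)]) (use EP u coef_closed in auto)
      then have 1: "frag_of u - (\<Sum>b\<in>E. frag_of (x, ?c b \<odot>\<^bsub>P\<^esub> b)) \<in> ?K"
        using p u by simp
      have 2: "(\<Sum>b\<in>E. frag_of (H b (frag_of u), b) - frag_of (x, ?c b \<odot>\<^bsub>P\<^esub> b)) \<in> ?K"
      proof (rule tensor_kernel_sum)
        fix b assume "b \<in> E"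
        then show "frag_of (H b (frag_of u), b) - frag_of (x, ?c b \<odot>\<^bsub>P\<^esub> b) \<in> ?K"
          using tensor_relations_mem(3)[of "?c b" A x N b P] u EP coef_closed by (auto simp: H)
      qed
      show "frag_of u - (\<Sum>b\<in>E. frag_of (H b (frag_of u), b)) \<in> ?K"
        using tensor_kernel_diff[OF N P 1 2] by (simp add: sum_subtractf)
    qed (use coef_fin_supp[OF u(3)] in \<open>auto simp: fin_supp_funs_def\<close>)
  qed
  \<comment> \<open>If all coordinates vanish, that sum consists of generators with first entry
    zero.\<close>
  have "z \<in> ?K" if z: "Poly_Mapping.keys z \<subseteq> carrier N \<times> carrier P" "\<forall>b. H b z = \<zero>\<^bsub>N\<^esub>" for z
  proof -
    obtain D where D: "finite D" "D \<subseteq> B" "z - (\<Sum>b\<in>D. frag_of (H b z, b)) \<in> ?K"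
      using *[OF z(1)] by blast
    have "(\<Sum>b\<in>D. frag_of (H b z, b)) \<in> ?K"
      by (rule tensor_kernel_sum)
         (use z D basis_subset tensor_kernel_zero_left[OF N P] in auto)
    from tensor_kernel_add[OF D(3) this] show ?thesis by simp
  qed
  then show ?thesis using that[of H] hom H HK by blast
qed

end

text \<open>In coordinates the map induced by \<open>\<phi>\<close> is \<open>\<phi>\<close> applied
  to each coordinate separately, so it is injective because \<open>\<phi>\<close> is.\<close>

lemma free_imp_flat:
  assumes P: "module A P" and basis: "module_basis A P B"
  shows "flat U A P"
  unfolding flat_def
proof (intro conjI P allI impI; elim conjE)
  fix N' N :: "('a, 'a + 'u) module" and \<phi>
  assume N': "module A N'" and N: "module A N" and \<phi>: "\<phi> \<in> module_hom A N' N"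
    and inj: "inj_on \<phi> (carrier N')"
  interpret N': module A N' by fact
  interpret N: module A N by fact
  let ?F' = "free_Abelian_group (carrier N' \<times> carrier P)"
  let ?F = "free_Abelian_group (carrier N \<times> carrier P)"
  let ?K' = "tensor_kernel A N' P" and ?K = "tensor_kernel A N P"
  obtain H' where H': "\<And>b. H' b \<in> hom ?F' (add_monoid N')"
    "\<And>b x p. x \<in> carrier N' \<Longrightarrow> p \<in> carrier P \<Longrightarrow> H' b (frag_of (x, p)) = coef A P B p b \<odot>\<^bsub>N'\<^esub> x"
    "\<And>z. Poly_Mapping.keys z \<subseteq> carrier N' \<times> carrier P \<Longrightarrow> z \<in> ?K' \<longleftrightarrow> (\<forall>b. H' b z = \<zero>\<^bsub>N'\<^esub>)"
    using tensor_coordinates[OF P basis N'] by blast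
  obtain H where H: "\<And>b. H b \<in> hom ?F (add_monoid N)"
    "\<And>b x p. x \<in> carrier N \<Longrightarrow> p \<in> carrier P \<Longrightarrow> H b (frag_of (x, p)) = coef A P B p b \<odot>\<^bsub>N\<^esub> x"
    "\<And>z. Poly_Mapping.keys z \<subseteq> carrier N \<times> carrier P \<Longrightarrow> z \<in> ?K \<longleftrightarrow> (\<forall>b. H b z = \<zero>\<^bsub>N\<^esub>)"
    using tensor_coordinates[OF P basis N] by blast
  have \<phi>c: "\<phi> x \<in> carrier N" if "x \<in> carrier N'" for x
    using \<phi> that by (auto simp: module_hom_def hom_def)
  have \<phi>s: "\<phi> (c \<odot>\<^bsub>N'\<^esub> x) = c \<odot>\<^bsub>N\<^esub> \<phi> x" if "c \<in> carrier A" "x \<in> carrier N'" for c x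
    using \<phi> that by (auto simp: module_hom_def)
  interpret \<phi>: group_hom "add_monoid N'" "add_monoid N" \<phi>
    using \<phi> N'.M.a_group N.M.a_group
    by (simp add: group_hom_def group_hom_axioms_def module_hom_def)
  have \<phi>0: "\<phi> x = \<zero>\<^bsub>N\<^esub> \<longleftrightarrow> x = \<zero>\<^bsub>N'\<^esub>" if "x \<in> carrier N'" for x
    using \<phi>.hom_one inj_onD[OF inj, of x "\<zero>\<^bsub>N'\<^esub>"] that by auto
  define h where "h = frag_extend (\<lambda>(x, p). frag_of (\<phi> x, p :: 'c))"
  have hk: "Poly_Mapping.keys (h z) \<subseteq> carrier N \<times> carrier P"
    if "Poly_Mapping.keys z \<subseteq> carrier N' \<times> carrier P" for z
  proof
    fix u assume "u \<in> Poly_Mapping.keys (h z)"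
    then obtain v where v: "v \<in> Poly_Mapping.keys z"
      "u \<in> Poly_Mapping.keys (case v of (x, p) \<Rightarrow> frag_of (\<phi> x, p))"
      using keys_frag_extend[of "\<lambda>(x, p). frag_of (\<phi> x, p)" z] unfolding h_def by blast
    then show "u \<in> carrier N \<times> carrier P"
      using that \<phi>c by (cases v) auto
  qed
  have Hh: "H b (h z) = \<phi> (H' b z)" if "Poly_Mapping.keys z \<subseteq> carrier N' \<times> carrier P" for b z
    using that
  proof (induction z rule: free_Abelian_group_induct[consumes 1])
    case 1
    have "H b 0 = \<zero>\<^bsub>N\<^esub>" "H' b 0 = \<zero>\<^bsub>N'\<^esub>"
      using H(3)[of 0] H'(3)[of 0] tensor_kernel_zero[of A N P] tensor_kernel_zero[of A N' P] by auto
    then show ?case using \<phi>.hom_one by (simp add: h_def)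
  next
    case (2 x y)
    have "H' b x \<in> carrier N'" "H' b y \<in> carrier N'"
      using hom_in_carrier[OF H'(1)[of b]] 2 by auto
    then have "\<phi> (H' b (x - y)) = \<phi> (H' b x) \<otimes>\<^bsub>add_monoid N\<^esub> inv\<^bsub>add_monoid N\<^esub> \<phi> (H' b y)"
      using hom_free_Abelian_group_diff[OF N'.M.a_group H'(1) 2(1,2)]
        \<phi>.hom_mult[of "H' b x" "inv\<^bsub>add_monoid N'\<^esub> H' b y"] \<phi>.hom_inv[of "H' b y"]
      by (simp add: a_inv_def)
    moreover have "H b (h x - h y) = H b (h x) \<otimes>\<^bsub>add_monoid N\<^esub> inv\<^bsub>add_monoid N\<^esub> H b (h y)"
      by (rule hom_free_Abelian_group_diff[OF N.M.a_group H(1) hk[OF 2(1)] hk[OF 2(2)]])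
    ultimately show ?case using 2(3,4) by (simp add: h_def frag_extend_diff)
  next
    case (3 u)
    then show ?case
      using \<phi>s[OF coef_closed[OF P basis]] \<phi>c by (auto simp: h_def H H')
  qed
  \<comment> \<open>Both directions matter: one makes the induced map well defined on classes, the
    other makes it injective.\<close>
  have ker: "h z \<in> ?K \<longleftrightarrow> z \<in> ?K'" if "Poly_Mapping.keys z \<subseteq> carrier N' \<times> carrier P" for z
  proof -
    have "H' b z \<in> carrier N'" for b using hom_in_carrier[OF H'(1)[of b], of z] that by simp
    then show ?thesis using H(3)[OF hk[OF that]] H'(3)[OF that] Hh[OF that] \<phi>0 by simp
  qed
  have normal: "?K \<lhd> ?F"
    by (rule comm_group.subgroup_imp_normal[OF abelian_free_Abelian_group
          subgroup_tensor_kernel[OF N P]])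
  interpret K: normal ?K ?F by (rule normal)
  let ?T = "tensor_product A N P"
  have hhom: "h \<in> hom ?F' ?F"
    using hk by (intro homI) (auto simp: h_def frag_extend_add)
  have comp: "(\<lambda>z. ?K #>\<^bsub>?F\<^esub> h z) \<in> hom ?F' ?T"
    using hom_compose[OF hhom K.r_coset_hom_Mod] by (simp add: tensor_product_def comp_def)
  interpret g: group_hom ?F' ?T "\<lambda>z. ?K #>\<^bsub>?F\<^esub> h z"
    using comp K.factorgroup_is_group
    by (simp add: group_hom_def group_hom_axioms_def tensor_product_def)
  let ?g = "\<lambda>z. ?K #>\<^bsub>?F\<^esub> h z"
  have T1: "\<one>\<^bsub>?T\<^esub> = ?K" by (simp add: tensor_product_def)
  have coset_eq: "?g z = ?K \<longleftrightarrow> h z \<in> ?K"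
    if "Poly_Mapping.keys z \<subseteq> carrier N' \<times> carrier P" for z
  proof
    assume "?g z = ?K"
    then show "h z \<in> ?K"
      using group.rcos_self[OF group_free_Abelian_group _ subgroup_tensor_kernel[OF N P], of "h z"]
        hk[OF that] by simp
  next
    assume "h z \<in> ?K"
    then show "?g z = ?K"
      by (rule subgroup.rcos_const[OF subgroup_tensor_kernel[OF N P] group_free_Abelian_group])
  qed
  have kernel: "kernel ?F' ?T ?g = ?K'"
  proof (rule Set.set_eqI)
    fix z
    show "z \<in> kernel ?F' ?T ?g \<longleftrightarrow> z \<in> ?K'"
    proof (cases "Poly_Mapping.keys z \<subseteq> carrier N' \<times> carrier P")
      case True
      then show ?thesis unfolding kernel_def T1 using coset_eq ker by simp
    next
      case False
      then show ?thesis using tensor_kernel_keys[OF N' P, of z] by (auto simp: kernel_def)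
    qed
  qed
  \<comment> \<open>The first isomorphism theorem for the composite with kernel \<open>?K'\<close>
    yields the map on classes and its injectivity together; \<open>the_elem\<close> extracts the
    common value of the composite on a coset.\<close>
  have "(\<lambda>X. the_elem (?g ` X)) \<in> hom (tensor_product A N' P) ?T"
    using g.FactGroup_hom unfolding kernel tensor_product_def[of A N' P] .
  moreover have "inj_on (\<lambda>X. the_elem (?g ` X)) (carrier (tensor_product A N' P))"
    using g.FactGroup_inj_on unfolding kernel tensor_product_def[of A N' P] .
  moreover have "the_elem (?g ` pure_tensor A N' P x p) = pure_tensor A N P (\<phi> x) p"
    if x: "x \<in> carrier N'" and p: "p \<in> carrier P" for x p
  proof -
    let ?C = "?K' #>\<^bsub>?F'\<^esub> frag_of (x, p)"
    have xp: "frag_of (x, p) \<in> carrier ?F'" using x p by simp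
    have "?g w = ?g (frag_of (x, p))" if w: "w \<in> ?C" for w
    proof -
      obtain k where k: "k \<in> ?K'" "w = k \<otimes>\<^bsub>?F'\<^esub> frag_of (x, p)"
        using w unfolding r_coset_def by blast
      have "k \<in> carrier ?F'" "?g k = \<one>\<^bsub>?T\<^esub>"
        using equalityD2[OF kernel, THEN subsetD, OF k(1)] unfolding kernel_def by blast+
      then have "?g w = \<one>\<^bsub>?T\<^esub> \<otimes>\<^bsub>?T\<^esub> ?g (frag_of (x, p))"
        unfolding k(2) using g.hom_mult[OF _ xp] by presburger
      then show ?thesis using g.H.l_one[OF g.hom_closed[OF xp]] by presburger
    qed
    moreover have "frag_of (x, p) \<in> ?C"
      by (rule group.rcos_self[OF group_free_Abelian_group xp subgroup_tensor_kernel[OF N' P]])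
    ultimately have "?g ` ?C = {?g (frag_of (x, p))}" by blast
    then have "the_elem (?g ` ?C) = ?g (frag_of (x, p))" by (simp only: the_elem_eq)
    moreover have "h (frag_of (x, p)) = frag_of (\<phi> x, p)" by (simp add: h_def)
    ultimately show ?thesis by (simp only: pure_tensor_def)
  qed
  ultimately show "\<exists>h\<in>hom (tensor_product A N' P) (tensor_product A N P).
     (\<forall>x\<in>carrier N'. \<forall>p\<in>carrier P. h (pure_tensor A N' P x p) = pure_tensor A N P (\<phi> x) p) \<and>
     inj_on h (carrier (tensor_product A N' P))"
    by (intro bexI[of _ "\<lambda>X. the_elem (?g ` X)"] conjI ballI)
qed

text \<open>An ideal as a module whose carrier lies in the type \<open>'a + 'u\<close> over which
  \<open>flat\<close> quantifies. The tag \<open>Inl\<close> is stripped by \<open>projl\<close>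
  before each ring operation.\<close>

definition inl_module :: "('a, 'm) ring_scheme \<Rightarrow> 'a set \<Rightarrow> ('a, 'a + 'u) module" where
  "inl_module A I =
     \<lparr>carrier = Inl ` I, mult = undefined, one = undefined, ring.zero = Inl \<zero>\<^bsub>A\<^esub>,
      add = (\<lambda>x y. Inl (projl x \<oplus>\<^bsub>A\<^esub> projl y)), smult = (\<lambda>c x. Inl (c \<otimes>\<^bsub>A\<^esub> projl x))\<rparr>"

lemma module_inl_module:
  fixes A :: "('a, 'm) ring_scheme"
  assumes "cring A" "ideal I A"
  shows "module A (inl_module A I :: ('a, 'a + 'u) module)" (is "module A ?N")
proof -
  interpret A: cring A by fact
  interpret I: ideal I A by fact
  have IA: "x \<in> carrier A" if "x \<in> I" for x using that by simp
  have "abelian_group ?N"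
  proof (rule abelian_groupI)
    fix x y z
    assume "x \<in> carrier ?N" "y \<in> carrier ?N" "z \<in> carrier ?N"
    then show "x \<oplus>\<^bsub>?N\<^esub> y \<oplus>\<^bsub>?N\<^esub> z
        = x \<oplus>\<^bsub>?N\<^esub> (y \<oplus>\<^bsub>?N\<^esub> z)"
      using IA by (auto simp: inl_module_def A.a_assoc)
  next
    fix x y
    assume "x \<in> carrier ?N" "y \<in> carrier ?N"
    then show "x \<oplus>\<^bsub>?N\<^esub> y = y \<oplus>\<^bsub>?N\<^esub> x"
      "x \<oplus>\<^bsub>?N\<^esub> y \<in> carrier ?N"
      using IA A.a_comm by (auto simp: inl_module_def)
  next
    fix x
    assume x: "x \<in> carrier ?N"
    then show "\<zero>\<^bsub>?N\<^esub> \<oplus>\<^bsub>?N\<^esub> x = x"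
      using IA by (auto simp: inl_module_def)
    obtain d where d: "d \<in> I" "x = Inl d" using x by (auto simp: inl_module_def)
    then show "\<exists>y\<in>carrier ?N. y \<oplus>\<^bsub>?N\<^esub> x = \<zero>\<^bsub>?N\<^esub>"
      using A.l_neg[OF IA[OF d(1)]] I.a_inv_closed[OF d(1)]
      by (intro bexI[of _ "Inl (\<ominus>\<^bsub>A\<^esub> d)"]) (simp_all add: inl_module_def)
  qed (simp add: inl_module_def)
  then show ?thesis
    by (rule moduleI[OF A.is_cring])
       (use IA in \<open>auto simp: inl_module_def I.I_l_closed A.m_assoc A.l_distr A.r_distr\<close>)
qed

text \<open>In \<open>A \<otimes> P\<close> the tensor of \<open>w\<close> and \<open>p\<close>
  equals that of one and \<open>w p\<close>, which is zero. Injectivity of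
  \<open>I \<otimes> P\<close> into \<open>A \<otimes> P\<close> makes the tensor vanish already
  over \<open>I\<close>, and every balanced map must then send it to the neutral element.\<close>

lemma flat_balanced_map_zero:
  fixes U :: "'u itself" and A :: "('a, 'm) ring_scheme"
  assumes flat: "flat U A P" and A: "cring A" and I: "ideal I A"
    and w: "w \<in> I" and p: "p \<in> carrier P" "w \<odot>\<^bsub>P\<^esub> p = \<zero>\<^bsub>P\<^esub>"
    and T: "comm_group T"
    and closed: "\<And>d q. d \<in> I \<Longrightarrow> q \<in> carrier P \<Longrightarrow> f d q \<in> carrier T"
    and add_left: "\<And>d e q. d \<in> I \<Longrightarrow> e \<in> I \<Longrightarrow> q \<in> carrier P \<Longrightarrow> f (d \<oplus>\<^bsub>A\<^esub> e) q = f d q \<otimes>\<^bsub>T\<^esub> f e q"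
    and add_right: "\<And>d q q'. d \<in> I \<Longrightarrow> q \<in> carrier P \<Longrightarrow> q' \<in> carrier P \<Longrightarrow>
      f d (q \<oplus>\<^bsub>P\<^esub> q') = f d q \<otimes>\<^bsub>T\<^esub> f d q'"
    and balanced: "\<And>c d q. c \<in> carrier A \<Longrightarrow> d \<in> I \<Longrightarrow> q \<in> carrier P \<Longrightarrow> f (c \<otimes>\<^bsub>A\<^esub> d) q = f d (c \<odot>\<^bsub>P\<^esub> q)"
  shows "f w p = \<one>\<^bsub>T\<^esub>"
proof -
  interpret cring A by fact
  interpret I: ideal I A by fact
  let ?N' = "inl_module A I :: ('a, 'a + 'u) module"
  let ?N = "inl_module A (carrier A) :: ('a, 'a + 'u) module"
  have P: "module A P" using flat by (simp add: flat_def)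
  have N': "module A ?N'" by (rule module_inl_module[OF A I])
  have N: "module A ?N" by (rule module_inl_module[OF A oneideal])
  have carr: "carrier ?N' = Inl ` I" "carrier ?N = Inl ` carrier A"
    by (simp_all add: inl_module_def)
  interpret N: module A ?N by (rule N)
  let ?K' = "tensor_kernel A ?N' P" and ?K = "tensor_kernel A ?N P"
  let ?F' = "free_Abelian_group (carrier ?N' \<times> carrier P)"
  let ?F = "free_Abelian_group (carrier ?N \<times> carrier P)"
  have id: "id \<in> module_hom A ?N' ?N"
    by (auto simp: module_hom_def hom_def inl_module_def)
  obtain h where inj: "inj_on h (carrier (tensor_product A ?N' P))"
    and hhom: "h \<in> hom (tensor_product A ?N' P) (tensor_product A ?N P)"
    and h: "\<And>x q. x \<in> carrier ?N' \<Longrightarrow> q \<in> carrier P \<Longrightarrow> h (pure_tensor A ?N' P x q) = pure_tensor A ?N P x q"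
  proof -
    have "inj_on id (carrier ?N')" by simp
    from flat[unfolded flat_def, THEN conjunct2, THEN spec, THEN spec, THEN spec, THEN mp,
        OF conjI[OF N' conjI[OF N conjI[OF id this]]]]
    show ?thesis using that unfolding id_apply by blast
  qed
  have sub': "subgroup ?K' ?F'" by (rule subgroup_tensor_kernel[OF N' P])
  have sub: "subgroup ?K ?F" by (rule subgroup_tensor_kernel[OF N P])
  have pt': "pure_tensor A ?N' P x q \<in> carrier (tensor_product A ?N' P)"
    if "x \<in> carrier ?N'" "q \<in> carrier P" for x q
    using that unfolding pure_tensor_def tensor_product_def carrier_FactGroup
    by (intro imageI) simp
  have mem: "frag_of (x, q) \<in> ?K' \<longleftrightarrow> pure_tensor A ?N' P x q = ?K'"
    if "x \<in> carrier ?N'" "q \<in> carrier P" for x q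
  proof
    assume "frag_of (x, q) \<in> ?K'"
    then show "pure_tensor A ?N' P x q = ?K'"
      unfolding pure_tensor_def by (rule subgroup.rcos_const[OF sub' group_free_Abelian_group])
  next
    assume "pure_tensor A ?N' P x q = ?K'"
    moreover have "frag_of (x, q) \<in> carrier ?F'" using that by simp
    ultimately show "frag_of (x, q) \<in> ?K'"
      using group.rcos_self[OF group_free_Abelian_group _ sub', of "frag_of (x, q)"]
      unfolding pure_tensor_def by blast
  qed
  have w': "Inl w \<in> carrier ?N'" "Inl w \<in> carrier ?N" "Inl \<one>\<^bsub>A\<^esub> \<in> carrier ?N" "w \<in> carrier A"
    using w by (auto simp: carr)
  \<comment> \<open>Over all of \<open>A\<close>, unlike over \<open>I\<close>, the element one is
    present, so \<open>w\<close> can be moved to \<open>p\<close> as a scalar.\<close>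
  have "frag_of (w \<odot>\<^bsub>?N\<^esub> Inl \<one>\<^bsub>A\<^esub>, p) - frag_of (Inl \<one>\<^bsub>A\<^esub>, w \<odot>\<^bsub>P\<^esub> p) \<in> ?K"
    by (rule tensor_relations_mem) (use w' p in auto)
  moreover have "w \<odot>\<^bsub>?N\<^esub> Inl \<one>\<^bsub>A\<^esub> = Inl w" using w' by (simp add: inl_module_def)
  moreover have "frag_of (Inl \<one>\<^bsub>A\<^esub>, w \<odot>\<^bsub>P\<^esub> p) \<in> ?K"
    using tensor_kernel_zero_right[OF N P w'(3)] p by simp
  ultimately have "frag_of (Inl w, p) \<in> ?K"
    using tensor_kernel_add[of "frag_of (Inl w, p) - frag_of (Inl \<one>\<^bsub>A\<^esub>, w \<odot>\<^bsub>P\<^esub> p)" A ?N P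
      "frag_of (Inl \<one>\<^bsub>A\<^esub>, w \<odot>\<^bsub>P\<^esub> p)"] by simp
  then have "pure_tensor A ?N P (Inl w) p = ?K"
    unfolding pure_tensor_def by (rule subgroup.rcos_const[OF sub group_free_Abelian_group])
  then have "h (pure_tensor A ?N' P (Inl w) p) = ?K"
    by (simp only: h[OF w'(1) p(1)])
  moreover have "h ?K' = ?K"
  proof -
    have "group (tensor_product A ?N' P)" "group (tensor_product A ?N P)"
      unfolding tensor_product_def
      by (intro normal.factorgroup_is_group comm_group.subgroup_imp_normal[OF abelian_free_Abelian_group] sub sub')+
    from hom_one[OF hhom this] show ?thesis by (simp add: tensor_product_def)
  qed
  moreover have "?K' \<in> carrier (tensor_product A ?N' P)"
    using subgroup.subgroup_in_rcosets[OF sub' group_free_Abelian_group]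
    by (simp add: tensor_product_def FactGroup_def)
  ultimately have "pure_tensor A ?N' P (Inl w) p = ?K'"
    by (intro inj_onD[OF inj _ pt'[OF w'(1) p(1)]]) simp_all
  then have wK: "frag_of (Inl w, p) \<in> ?K'" using mem[OF w'(1) p(1)] by simp
  obtain g where g: "\<And>x q. x \<in> carrier ?N' \<Longrightarrow> q \<in> carrier P \<Longrightarrow> g (frag_of (x, q)) = f (projl x) q"
    "\<And>z. z \<in> ?K' \<Longrightarrow> g z = \<one>\<^bsub>T\<^esub>"
    by (rule balanced_map_extends[OF T N' P, of "\<lambda>x q. f (projl x) q"])
       (use closed add_left add_right balanced in \<open>auto simp: inl_module_def\<close>)
  show ?thesis using g(1)[OF w'(1) p(1)] g(2)[OF wK] by simp
qed

section \<open>Invariance of rank\<close>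

text \<open>Gaussian elimination on the equations: a pivot in the equation \<open>i0\<close> uses up
  one equation and one unknown, so the strict inequality of the cardinalities is kept.\<close>

lemma (in field) homogeneous_system_nontrivial_solution:
  assumes "finite I" "finite J" "card I < card J" "\<And>i j. i \<in> I \<Longrightarrow> j \<in> J \<Longrightarrow> c i j \<in> carrier R"
  shows "\<exists>x. (\<forall>j \<in> J. x j \<in> carrier R) \<and> (\<exists>j \<in> J. x j \<noteq> \<zero>) \<and> (\<forall>i \<in> I. (\<Oplus>j \<in> J. c i j \<otimes> x j) = \<zero>)"
  using assms
proof (induction I arbitrary: J c rule: finite_induct)
  case empty
  then obtain j where "j \<in> J" by (metis card.empty ex_in_conv less_irrefl)
  then show ?case by (intro exI[of _ "\<lambda>_. \<one>"]) auto
next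
  case (insert i0 I)
  have card: "card I < card J" using insert by simp
  show ?case
  proof (cases "\<forall>j \<in> J. c i0 j = \<zero>")
    case True
    obtain x where x: "\<forall>j \<in> J. x j \<in> carrier R" "\<exists>j \<in> J. x j \<noteq> \<zero>"
      "\<forall>i \<in> I. (\<Oplus>j \<in> J. c i j \<otimes> x j) = \<zero>"
      using insert.IH[OF insert.prems(1) card, of c] insert.prems(3) by auto
    have "(\<Oplus>j \<in> J. c i0 j \<otimes> x j) = (\<Oplus>j \<in> J. \<zero>)"
      by (rule finsum_cong') (use True x in auto)
    then show ?thesis using x by (intro exI[of _ x]) simp
  next
    case False
    then obtain k where k: "k \<in> J" "c i0 k \<noteq> \<zero>" by blast
    have ck: "c i0 k \<in> carrier R" using insert.prems k by simp
    then have U: "c i0 k \<in> Units R" using k field_Units by simp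
    define J' where "J' = J - {k}"
    have J: "J = insert k J'" "k \<notin> J'" "finite J'" using k insert.prems by (auto simp: J'_def)
    have card': "card I < card J'"
      using insert by (simp add: J)
    have cl: "c i j \<in> carrier R" if "i \<in> insert i0 I" "j \<in> J" for i j
      using insert.prems that by blast
    \<comment> \<open>The multiple of the pivot equation that removes the unknown \<open>k\<close>
      from equation \<open>i\<close>.\<close>
    let ?u = "\<lambda>i. c i k \<otimes> inv (c i0 k)"
    have ucl: "?u i \<in> carrier R" if "i \<in> insert i0 I" for i using cl[OF that k(1)] U by simp
    define c' where "c' = (\<lambda>i j. c i j \<oplus> \<ominus> (?u i \<otimes> c i0 j))"
    have "\<exists>x. (\<forall>j \<in> J'. x j \<in> carrier R) \<and> (\<exists>j \<in> J'. x j \<noteq> \<zero>) \<and> (\<forall>i \<in> I. (\<Oplus>j \<in> J'. c' i j \<otimes> x j) = \<zero>)"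
      by (rule insert.IH[OF J(3) card']) (use cl ucl J(1) in \<open>auto simp: c'_def\<close>)
    then obtain x where x: "\<And>j. j \<in> J' \<Longrightarrow> x j \<in> carrier R" "\<exists>j \<in> J'. x j \<noteq> \<zero>"
      "\<And>i. i \<in> I \<Longrightarrow> (\<Oplus>j \<in> J'. c' i j \<otimes> x j) = \<zero>"
      by blast
    define s where "s = (\<lambda>i. \<Oplus>j \<in> J'. c i j \<otimes> x j)"
    have scl: "s i \<in> carrier R" if "i \<in> insert i0 I" for i
      unfolding s_def by (rule finsum_closed) (use that cl x J in auto)
    \<comment> \<open>Back substitution: \<open>y k\<close> is the value that solves the pivot
      equation; the other unknowns keep their values from the smaller system.\<close>
    define y where "y = x(k := \<ominus> (inv (c i0 k) \<otimes> s i0))"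
    have ycl: "y j \<in> carrier R" if "j \<in> J" for j
      using that x(1) scl[of i0] U by (auto simp: y_def J)
    have sum: "(\<Oplus>j \<in> J. c i j \<otimes> y j) = c i k \<otimes> y k \<oplus> s i" if "i \<in> insert i0 I" for i
    proof -
      have "(\<Oplus>j \<in> J'. c i j \<otimes> y j) = s i"
        unfolding s_def by (rule finsum_cong') (use that J cl x in \<open>auto simp: y_def\<close>)
      then show ?thesis
        using finsum_insert[OF J(3,2), of "\<lambda>j. c i j \<otimes> y j"] that cl ycl by (simp add: J)
    qed
    have e: "c i k \<otimes> y k = \<ominus> (?u i \<otimes> s i0)" if "i \<in> insert i0 I" for i
      using cl[OF that k(1)] U scl[of i0] by (simp add: y_def r_minus m_assoc)
    have 0: "(\<Oplus>j \<in> J. c i0 j \<otimes> y j) = \<zero>"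
      using sum[of i0] e[of i0] U scl[of i0] by (simp add: l_neg)
    have "(\<Oplus>j \<in> J. c i j \<otimes> y j) = \<zero>" if i: "i \<in> I" for i
    proof -
      have "\<zero> = (\<Oplus>j \<in> J'. c i j \<otimes> x j \<oplus> (\<ominus> ?u i) \<otimes> (c i0 j \<otimes> x j))"
        unfolding x(3)[OF i, symmetric]
        by (rule finsum_cong')
           (use i cl ucl[of i] x J in \<open>auto simp: c'_def l_distr l_minus m_assoc\<close>)
      also have "\<dots> = s i \<oplus> (\<Oplus>j \<in> J'. (\<ominus> ?u i) \<otimes> (c i0 j \<otimes> x j))"
        unfolding s_def by (rule finsum_addf) (use i cl ucl[of i] x J in auto)
      also have "(\<Oplus>j \<in> J'. (\<ominus> ?u i) \<otimes> (c i0 j \<otimes> x j)) = (\<ominus> ?u i) \<otimes> s i0"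
        unfolding s_def by (rule finsum_rdistr[symmetric]) (use i cl ucl[of i] x J in auto)
      finally have "s i \<oplus> \<ominus> (?u i \<otimes> s i0) = \<zero>"
        using ucl[of i] scl i by (simp add: l_minus)
      then show ?thesis using sum[of i] e[of i] i scl ucl[of i] by (simp add: a_comm)
    qed
    moreover have "\<exists>j\<in>J. y j \<noteq> \<zero>" using x(2) J by (auto simp: y_def)
    ultimately show ?thesis using 0 ycl by (intro exI[of _ y]) auto
  qed
qed

context
  fixes A :: "('a, 'm) ring_scheme" and N :: "('a, 'b) module"
  assumes N: "module A N" and nontrivial: "\<one>\<^bsub>A\<^esub> \<noteq> \<zero>\<^bsub>A\<^esub>"
begin

interpretation N: module A N by (rule N)

text \<open>If \<open>b\<close> occurred in no expansion of an element of \<open>S\<close>, its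
  coordinate would vanish on \<open>S\<close> and hence on everything that \<open>S\<close> spans,
  but it is one at \<open>b\<close> itself.\<close>

lemma basis_subset_coef_supports:
  assumes B: "module_basis A N B" and S: "module_basis A N S"
  shows "B \<subseteq> (\<Union>s\<in>S. {b. coef A N B s b \<noteq> \<zero>\<^bsub>A\<^esub>})"
proof
  fix b assume b: "b \<in> B"
  show "b \<in> (\<Union>s\<in>S. {b. coef A N B s b \<noteq> \<zero>\<^bsub>A\<^esub>})"
  proof (rule ccontr)
    assume "\<not> ?thesis"
    then have z: "coef A N B s b = \<zero>\<^bsub>A\<^esub>" if "s \<in> S" for s using that by blast
    have bN: "b \<in> carrier N" using b basis_subset[OF N B] by blast
    let ?c = "coef A N S b"
    let ?D = "{s. ?c s \<noteq> \<zero>\<^bsub>A\<^esub>}"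
    have c: "?c \<in> fin_supp_funs A S" by (rule coef_fin_supp[OF N S bN])
    have SN: "S \<subseteq> carrier N" by (rule basis_subset[OF N S])
    have D: "?D \<subseteq> S" "finite ?D" "?D \<subseteq> carrier N"
      using c SN by (auto simp: fin_supp_funs_def)
    have "coef A N B (\<Oplus>\<^bsub>N\<^esub>s\<in>?D. ?c s \<odot>\<^bsub>N\<^esub> s) b = (\<Oplus>\<^bsub>A\<^esub>s\<in>?D. coef A N B (?c s \<odot>\<^bsub>N\<^esub> s) b)"
      by (rule coef_finsum[OF N B D(2)]) (use D c in \<open>auto simp: fin_supp_funs_def\<close>)
    also have "\<dots> = (\<Oplus>\<^bsub>A\<^esub>s\<in>?D. \<zero>\<^bsub>A\<^esub>)"
    proof (rule N.R.finsum_cong')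
      fix s assume "s \<in> ?D"
      then have "s \<in> S" "s \<in> carrier N" using D by auto
      then show "coef A N B (?c s \<odot>\<^bsub>N\<^esub> s) b = \<zero>\<^bsub>A\<^esub>"
        using z fin_supp_funs_closed[OF c] by (simp add: coef_smult[OF N B])
    qed auto
    also have "\<dots> = \<zero>\<^bsub>A\<^esub>" by simp
    finally have "coef A N B b b = \<zero>\<^bsub>A\<^esub>"
      using lincomb_coef[OF N S bN] by (simp add: lincomb_def)
    then show False using coef_basis[OF N B b] nontrivial by simp
  qed
qed

text \<open>Expansions have finite support, so \<open>B\<close> is covered by a family of finite
  sets indexed by \<open>S\<close>.\<close>

lemma countable_basis_transfer:
  assumes B: "module_basis A N B" and S: "module_basis A N S"
  shows "finite S \<Longrightarrow> finite B" "countable S \<Longrightarrow> countable B"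
proof -
  have fin: "finite {b. coef A N B s b \<noteq> \<zero>\<^bsub>A\<^esub>}" if "s \<in> S" for s
    using coef_fin_supp[OF N B, of s] basis_subset[OF N S] that by (auto simp: fin_supp_funs_def)
  show "finite B" if "finite S"
    by (rule finite_subset[OF basis_subset_coef_supports[OF B S]]) (use fin that in auto)
  show "countable B" if "countable S"
    by (rule countable_subset[OF basis_subset_coef_supports[OF B S]])
       (use fin that in \<open>auto intro: countable_finite\<close>)
qed

text \<open>Over \<open>F\<close> the matrix expressing a larger \<open>B\<close> in terms of
  \<open>S\<close> has a non-trivial kernel vector. A lift \<open>y\<close> of it gives a vector
  whose \<open>S\<close>-coordinates die in \<open>F\<close>. Its \<open>B\<close>-coordinates are
  \<open>A\<close>-combinations of those and die too, yet they are the entries of \<open>y\<close>,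
  which do not all die.\<close>

lemma finite_basis_card_le:
  assumes B: "module_basis A N B" and S: "module_basis A N S" and fin: "finite S"
    and F: "field F" and \<pi>: "\<pi> \<in> ring_hom A F" "\<pi> ` carrier A = carrier F"
  shows "card B \<le> card S"
proof (rule ccontr)
  assume "\<not> ?thesis"
  then have less: "card S < card B" by simp
  have finB: "finite B" using countable_basis_transfer(1)[OF B S fin] .
  interpret F: field F by fact
  interpret \<pi>: ring_hom_cring A F \<pi>
    by (intro ring_hom_cring.intro ring_hom_cring_axioms.intro \<pi> F.is_cring N.R.is_cring)
  have BN: "B \<subseteq> carrier N" and SN: "S \<subseteq> carrier N"
    using basis_subset[OF N B] basis_subset[OF N S] by auto
  have cl: "coef A N S b s \<in> carrier A" if "b \<in> B" for b s
    using coef_closed[OF N S] BN that by blast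
  obtain x where x: "\<And>b. b \<in> B \<Longrightarrow> x b \<in> carrier F" "\<exists>b\<in>B. x b \<noteq> \<zero>\<^bsub>F\<^esub>"
    "\<And>s. s \<in> S \<Longrightarrow> (\<Oplus>\<^bsub>F\<^esub>b\<in>B. \<pi> (coef A N S b s) \<otimes>\<^bsub>F\<^esub> x b) = \<zero>\<^bsub>F\<^esub>"
  proof -
    have "\<exists>x. (\<forall>b \<in> B. x b \<in> carrier F) \<and> (\<exists>b \<in> B. x b \<noteq> \<zero>\<^bsub>F\<^esub>) \<and>
        (\<forall>s \<in> S. (\<Oplus>\<^bsub>F\<^esub>b \<in> B. \<pi> (coef A N S b s) \<otimes>\<^bsub>F\<^esub> x b) = \<zero>\<^bsub>F\<^esub>)"
      by (rule F.homogeneous_system_nontrivial_solution[OF fin finB less]) (use cl in auto)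
    then show ?thesis using that by blast
  qed
  have "\<exists>y \<in> carrier A. \<pi> y = x b" if "b \<in> B" for b
    using x(1)[OF that] \<pi>(2) by (metis imageE)
  then obtain y where y: "\<And>b. b \<in> B \<Longrightarrow> y b \<in> carrier A" "\<And>b. b \<in> B \<Longrightarrow> \<pi> (y b) = x b"
    by metis
  let ?v = "\<Oplus>\<^bsub>N\<^esub>b\<in>B. y b \<odot>\<^bsub>N\<^esub> b"
  have vN: "?v \<in> carrier N" by (rule N.M.finsum_closed) (use y BN in auto)
  have 1: "\<pi> (coef A N S ?v s) = \<zero>\<^bsub>F\<^esub>" if s: "s \<in> S" for s
  proof -
    have "coef A N S ?v s = (\<Oplus>\<^bsub>A\<^esub>b\<in>B. coef A N S (y b \<odot>\<^bsub>N\<^esub> b) s)"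
      by (rule coef_finsum[OF N S finB]) (use y BN in auto)
    moreover have "(\<lambda>b. coef A N S (y b \<odot>\<^bsub>N\<^esub> b) s) \<in> B \<rightarrow> carrier A"
      using y BN coef_closed[OF N S] by auto
    ultimately have "\<pi> (coef A N S ?v s) = (\<Oplus>\<^bsub>F\<^esub>b\<in>B. (\<pi> \<circ> (\<lambda>b. coef A N S (y b \<odot>\<^bsub>N\<^esub> b) s)) b)"
      by (simp add: comp_def)
    also have "\<dots> = (\<Oplus>\<^bsub>F\<^esub>b\<in>B. \<pi> (coef A N S b s) \<otimes>\<^bsub>F\<^esub> x b)"
      by (rule F.finsum_cong')
         (use y BN cl x(1) in \<open>auto simp: coef_smult[OF N S] subset_iff F.m_comm\<close>)
    finally show ?thesis using x(3)[OF s] by simp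
  qed
  have 2: "\<pi> (coef A N B ?v b) = \<zero>\<^bsub>F\<^esub>" if "b \<in> B" for b
  proof -
    have "?v = (\<Oplus>\<^bsub>N\<^esub>s\<in>S. coef A N S ?v s \<odot>\<^bsub>N\<^esub> s)"
      using lincomb_coef[OF N S vN] N.lincomb_superset[OF coef_fin_supp[OF N S vN] _ SN fin]
        coef_fin_supp[OF N S vN] by (simp add: fin_supp_funs_def)
    then have "coef A N B ?v b = coef A N B (\<Oplus>\<^bsub>N\<^esub>s\<in>S. coef A N S ?v s \<odot>\<^bsub>N\<^esub> s) b" by simp
    also have "\<dots> = (\<Oplus>\<^bsub>A\<^esub>s\<in>S. coef A N B (coef A N S ?v s \<odot>\<^bsub>N\<^esub> s) b)"
      by (rule coef_finsum[OF N B fin]) (use coef_closed[OF N S vN] SN in auto)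
    finally have "coef A N B ?v b = \<dots>" .
    moreover have "(\<lambda>s. coef A N B (coef A N S ?v s \<odot>\<^bsub>N\<^esub> s) b) \<in> S \<rightarrow> carrier A"
      using coef_closed[OF N S vN] SN coef_closed[OF N B] by auto
    ultimately have "\<pi> (coef A N B ?v b) = (\<Oplus>\<^bsub>F\<^esub>s\<in>S. (\<pi> \<circ> (\<lambda>s. coef A N B (coef A N S ?v s \<odot>\<^bsub>N\<^esub> s) b)) s)"
      by (simp add: comp_def)
    also have "\<dots> = (\<Oplus>\<^bsub>F\<^esub>s\<in>S. \<zero>\<^bsub>F\<^esub>)"
      by (rule F.finsum_cong')
         (use coef_closed[OF N S vN] SN coef_closed[OF N B] 1 in \<open>auto simp: coef_smult[OF N B] subset_iff\<close>)
    finally show ?thesis by simp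
  qed
  \<comment> \<open>Extended by zero, \<open>y\<close> is a finitely supported family, and by
    uniqueness it is the coordinate family of the vector.\<close>
  let ?y = "\<lambda>b. if b \<in> B then y b else \<zero>\<^bsub>A\<^esub>"
  have yf: "?y \<in> fin_supp_funs A B"
    by (rule fin_supp_funsI[where D = B]) (use y finB in auto)
  have "lincomb A N ?y = (\<Oplus>\<^bsub>N\<^esub>b\<in>B. ?y b \<odot>\<^bsub>N\<^esub> b)"
    by (rule N.lincomb_superset[OF yf _ BN finB]) auto
  also have "\<dots> = ?v" by (rule N.M.finsum_cong') (use y BN in auto)
  finally have "coef A N B ?v = ?y" by (rule coef_unique[OF N B yf])
  then show False using 2 y(2) x(2) by auto
qed

text \<open>If \<open>S\<close> is finite, so is \<open>B\<close>, and the cardinalities are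
  compared in both directions through \<open>F\<close>. If \<open>S\<close> is infinite, both are
  countably infinite and hence in bijection with the natural numbers.\<close>

lemma rank_is_card_countable:
  assumes S: "module_basis A N S" and cnt: "countable S"
    and F: "field F" and \<pi>: "\<pi> \<in> ring_hom A F" "\<pi> ` carrier A = carrier F"
  shows "rank_is_card A N S"
  unfolding rank_is_card_def
proof (intro conjI exI[of _ S] S allI impI)
  fix B assume B: "module_basis A N B"
  show "B \<approx> S"
  proof (cases "finite S")
    case True
    then have "finite B" using countable_basis_transfer[OF B S] by simp
    moreover have "card B = card S"
      using finite_basis_card_le[OF B S True F \<pi>] finite_basis_card_le[OF S B \<open>finite B\<close> F \<pi>] by simp
    ultimately show ?thesis using True eqpoll_iff_card by blast
  next
    case False
    then have "infinite B" "countable B"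
      using countable_basis_transfer[OF B S] countable_basis_transfer[OF S B] cnt by auto
    then show ?thesis using False cnt
      by (meson bij_betw_from_nat_into bij_betw_trans to_nat_on_infinite eqpoll_def)
  qed
qed

end

section \<open>Quotient modules\<close>

context
  fixes A :: "('a, 'm) ring_scheme" and N :: "('a, 'b) module" and H :: "'b set"
  assumes N: "module A N" and H: "submodule H A N"
begin

interpretation N: module A N by (rule N)
interpretation H: submodule H A N by (rule H)

interpretation H: abelian_subgroup H N
  by (rule abelian_subgroupI3) (simp_all add: additive_subgroup_def H.subgroup_axioms N.M.abelian_group_axioms)

lemma carrier_quotient_module: "carrier (quotient_module N H) = (\<lambda>x. H +>\<^bsub>N\<^esub> x) ` carrier N"
  by (auto simp: quotient_module_def A_RCOSETS_def RCOSETS_def a_r_coset_def)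

lemma coset_in_quotient_module: "x \<in> carrier N \<Longrightarrow> H +>\<^bsub>N\<^esub> x \<in> carrier (quotient_module N H)"
  by (simp add: carrier_quotient_module)

lemma coset_eq_iff:
  assumes "x \<in> carrier N" "y \<in> carrier N"
  shows "H +>\<^bsub>N\<^esub> x = H +>\<^bsub>N\<^esub> y \<longleftrightarrow> x \<oplus>\<^bsub>N\<^esub> \<ominus>\<^bsub>N\<^esub> y \<in> H"
proof
  assume "H +>\<^bsub>N\<^esub> x = H +>\<^bsub>N\<^esub> y"
  then have "x \<in> H +>\<^bsub>N\<^esub> y" using H.a_rcos_self[OF assms(1)] by simp
  then show "x \<oplus>\<^bsub>N\<^esub> \<ominus>\<^bsub>N\<^esub> y \<in> H" by (rule H.a_rcos_module_imp[OF assms(2)])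
next
  assume "x \<oplus>\<^bsub>N\<^esub> \<ominus>\<^bsub>N\<^esub> y \<in> H"
  then have "x \<in> H +>\<^bsub>N\<^esub> y" by (rule H.a_rcos_module_rev[OF assms(2,1)])
  then show "H +>\<^bsub>N\<^esub> x = H +>\<^bsub>N\<^esub> y" using H.a_repr_independence'[OF _ assms(2)] by simp
qed

lemma zero_quotient_module: "\<zero>\<^bsub>quotient_module N H\<^esub> = H"
  by (simp add: quotient_module_def)

lemma coset_zero_iff:
  assumes "x \<in> carrier N"
  shows "H +>\<^bsub>N\<^esub> x = \<zero>\<^bsub>quotient_module N H\<^esub> \<longleftrightarrow> x \<in> H"
proof -
  have "H +>\<^bsub>N\<^esub> \<zero>\<^bsub>N\<^esub> = H" using N.M.a_coset_add_zero H.subset by simp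
  then show ?thesis
    using coset_eq_iff[OF assms N.M.zero_closed] assms
      \<comment> \<open>This composition is the fact that the negative of zero in \<open>N\<close>
        is zero.\<close>
      trans[OF sym[OF N.M.l_zero[OF N.M.a_inv_closed[OF N.M.zero_closed]]] N.M.r_neg[OF N.M.zero_closed]]
    by (simp add: zero_quotient_module)
qed

lemma add_quotient_module:
  "x \<in> carrier N \<Longrightarrow> y \<in> carrier N \<Longrightarrow>
    (H +>\<^bsub>N\<^esub> x) \<oplus>\<^bsub>quotient_module N H\<^esub> (H +>\<^bsub>N\<^esub> y) = H +>\<^bsub>N\<^esub> (x \<oplus>\<^bsub>N\<^esub> y)"
  by (simp add: quotient_module_def H.a_rcos_sum)

text \<open>The product is defined as a union over all representatives; closure of \<open>H\<close>
  under scalars makes all members of the union the same coset.\<close>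

lemma smult_quotient_module:
  assumes c: "c \<in> carrier A" and x: "x \<in> carrier N"
  shows "c \<odot>\<^bsub>quotient_module N H\<^esub> (H +>\<^bsub>N\<^esub> x) = H +>\<^bsub>N\<^esub> (c \<odot>\<^bsub>N\<^esub> x)"
proof -
  have "H +>\<^bsub>N\<^esub> (c \<odot>\<^bsub>N\<^esub> y) = H +>\<^bsub>N\<^esub> (c \<odot>\<^bsub>N\<^esub> x)" if y: "y \<in> H +>\<^bsub>N\<^esub> x" for y
  proof -
    have yN: "y \<in> carrier N" by (rule H.a_elemrcos_carrier[OF x y])
    have "y \<oplus>\<^bsub>N\<^esub> \<ominus>\<^bsub>N\<^esub> x \<in> H" by (rule H.a_rcos_module_imp[OF x y])
    then have "c \<odot>\<^bsub>N\<^esub> (y \<oplus>\<^bsub>N\<^esub> \<ominus>\<^bsub>N\<^esub> x) \<in> H" using c by simp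
    then show ?thesis
      using c x yN by (simp add: coset_eq_iff N.smult_r_distr N.smult_r_minus)
  qed
  then have "(\<Union>y\<in>H +>\<^bsub>N\<^esub> x. H +>\<^bsub>N\<^esub> (c \<odot>\<^bsub>N\<^esub> y)) = H +>\<^bsub>N\<^esub> (c \<odot>\<^bsub>N\<^esub> x)"
    by (intro UN_constant_eq[OF H.a_rcos_self[OF x]] ballI)
  then show ?thesis by (simp only: quotient_module_def module.simps)
qed

lemma module_quotient_module: "module A (quotient_module N H)"
proof -
  let ?Q = "quotient_module N H"
  have Q: "carrier ?Q = (\<lambda>x. H +>\<^bsub>N\<^esub> x) ` carrier N" by (rule carrier_quotient_module)
  have zero: "\<zero>\<^bsub>?Q\<^esub> = H +>\<^bsub>N\<^esub> \<zero>\<^bsub>N\<^esub>" using coset_zero_iff[of "\<zero>\<^bsub>N\<^esub>"] by simp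
  have "abelian_group ?Q"
  proof (rule abelian_groupI)
    fix C assume "C \<in> carrier ?Q"
    then obtain x where x: "x \<in> carrier N" "C = H +>\<^bsub>N\<^esub> x" unfolding Q by blast
    then show "\<exists>D\<in>carrier ?Q. D \<oplus>\<^bsub>?Q\<^esub> C = \<zero>\<^bsub>?Q\<^esub>"
      by (intro bexI[of _ "H +>\<^bsub>N\<^esub> \<ominus>\<^bsub>N\<^esub> x"])
         (auto simp: zero add_quotient_module N.M.l_neg coset_in_quotient_module)
  qed (auto simp: Q zero add_quotient_module N.M.a_ac)
  then show ?thesis
    by (rule moduleI[OF N.is_cring])
       (auto simp: Q smult_quotient_module add_quotient_module N.smult_l_distr N.smult_r_distr
          N.smult_assoc1)
qed

lemma finsum_quotient_module:
  assumes "finite I" "g \<in> I \<rightarrow> carrier N"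
  shows "(\<Oplus>\<^bsub>quotient_module N H\<^esub>i\<in>I. H +>\<^bsub>N\<^esub> g i) = H +>\<^bsub>N\<^esub> (\<Oplus>\<^bsub>N\<^esub>i\<in>I. g i)"
proof -
  interpret Q: module A "quotient_module N H" by (rule module_quotient_module)
  show ?thesis
    using assms
  proof (induction I rule: finite_induct)
    case empty
    show ?case using coset_zero_iff[of "\<zero>\<^bsub>N\<^esub>"] by simp
  next
    case (insert i I)
    then show ?case by (simp add: coset_in_quotient_module add_quotient_module Pi_def)
  qed
qed

end

section \<open>Homogeneous components\<close>

definition component :: "('a, 'm) ring_scheme \<Rightarrow> (nat \<Rightarrow> 'a set) \<Rightarrow> 'a \<Rightarrow> nat \<Rightarrow> 'a" where
  "component A \<A> x = (THE h. (\<forall>i. h i \<in> \<A> i) \<and> finite {i. h i \<noteq> \<zero>\<^bsub>A\<^esub>} \<and>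
     x = (\<Oplus>\<^bsub>A\<^esub>i \<in> {i. h i \<noteq> \<zero>\<^bsub>A\<^esub>}. h i))"

context
  fixes A :: "('a, 'm) ring_scheme" and a :: enat and \<A> :: "nat \<Rightarrow> 'a set"
  assumes graded: "graded_ring A a \<A>"
begin

interpretation A: cring A using graded by (simp add: graded_ring_def)

lemma subgroup_graded: "subgroup (\<A> i) (add_monoid A)"
  using graded by (simp add: graded_ring_def)

lemma graded_closed: "x \<in> \<A> i \<Longrightarrow> x \<in> carrier A"
  using subgroup.mem_carrier[OF subgroup_graded] by simp

lemma graded_zero: "\<zero>\<^bsub>A\<^esub> \<in> \<A> i"
  using subgroup.one_closed[OF subgroup_graded] by simp

lemma graded_add: "x \<in> \<A> i \<Longrightarrow> y \<in> \<A> i \<Longrightarrow> x \<oplus>\<^bsub>A\<^esub> y \<in> \<A> i"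
  using subgroup.m_closed[OF subgroup_graded] by simp

lemma graded_mult: "x \<in> \<A> i \<Longrightarrow> y \<in> \<A> j \<Longrightarrow> x \<otimes>\<^bsub>A\<^esub> y \<in> \<A> (i + j)"
  using graded unfolding graded_ring_def set_mult_def by blast

lemma component_spec:
  assumes "x \<in> carrier A"
  shows "(\<forall>i. component A \<A> x i \<in> \<A> i) \<and> finite {i. component A \<A> x i \<noteq> \<zero>\<^bsub>A\<^esub>} \<and>
     x = (\<Oplus>\<^bsub>A\<^esub>i \<in> {i. component A \<A> x i \<noteq> \<zero>\<^bsub>A\<^esub>}. component A \<A> x i)"
proof -
  have "\<exists>!h. (\<forall>i. h i \<in> \<A> i) \<and> finite {i. h i \<noteq> \<zero>\<^bsub>A\<^esub>} \<and>
        x = (\<Oplus>\<^bsub>A\<^esub>i \<in> {i. h i \<noteq> \<zero>\<^bsub>A\<^esub>}. h i)"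
    using graded assms by (simp add: graded_ring_def)
  from theI'[OF this] show ?thesis unfolding component_def .
qed

lemma component_mem: "x \<in> carrier A \<Longrightarrow> component A \<A> x i \<in> \<A> i"
  using component_spec by blast

lemma component_closed: "x \<in> carrier A \<Longrightarrow> component A \<A> x i \<in> carrier A"
  using component_mem graded_closed by blast

lemma finite_component: "x \<in> carrier A \<Longrightarrow> finite {i. component A \<A> x i \<noteq> \<zero>\<^bsub>A\<^esub>}"
  using component_spec by blast

lemma finsum_component:
  assumes "x \<in> carrier A" "finite D" "{i. component A \<A> x i \<noteq> \<zero>\<^bsub>A\<^esub>} \<subseteq> D"
  shows "(\<Oplus>\<^bsub>A\<^esub>i \<in> D. component A \<A> x i) = x"
proof -
  have "(\<Oplus>\<^bsub>A\<^esub>i \<in> {i. component A \<A> x i \<noteq> \<zero>\<^bsub>A\<^esub>}. component A \<A> x i) = (\<Oplus>\<^bsub>A\<^esub>i \<in> D. component A \<A> x i)"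
    by (rule A.add.finprod_mono_neutral_cong_left) (use assms component_closed in auto)
  then show ?thesis using component_spec[OF assms(1)] by simp
qed

lemma component_unique:
  assumes h: "\<And>i. h i \<in> \<A> i" and D: "finite D" "{i. h i \<noteq> \<zero>\<^bsub>A\<^esub>} \<subseteq> D"
    and x: "x = (\<Oplus>\<^bsub>A\<^esub>i \<in> D. h i)"
  shows "component A \<A> x = h"
proof -
  have hc: "h i \<in> carrier A" for i using h graded_closed by blast
  have xc: "x \<in> carrier A" unfolding x by (rule A.finsum_closed) (use hc in auto)
  have "(\<Oplus>\<^bsub>A\<^esub>i \<in> {i. h i \<noteq> \<zero>\<^bsub>A\<^esub>}. h i) = (\<Oplus>\<^bsub>A\<^esub>i \<in> D. h i)"
    by (rule A.add.finprod_mono_neutral_cong_left) (use D hc in auto)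
  then have "(\<forall>i. h i \<in> \<A> i) \<and> finite {i. h i \<noteq> \<zero>\<^bsub>A\<^esub>} \<and> x = (\<Oplus>\<^bsub>A\<^esub>i \<in> {i. h i \<noteq> \<zero>\<^bsub>A\<^esub>}. h i)"
    using h D x finite_subset by auto
  moreover have "\<exists>!h. (\<forall>i. h i \<in> \<A> i) \<and> finite {i. h i \<noteq> \<zero>\<^bsub>A\<^esub>} \<and>
        x = (\<Oplus>\<^bsub>A\<^esub>i \<in> {i. h i \<noteq> \<zero>\<^bsub>A\<^esub>}. h i)"
    using graded xc by (simp add: graded_ring_def)
  ultimately show ?thesis using component_spec[OF xc] by blast
qed

lemma component_add:
  assumes x: "x \<in> carrier A" and y: "y \<in> carrier A"
  shows "component A \<A> (x \<oplus>\<^bsub>A\<^esub> y) i = component A \<A> x i \<oplus>\<^bsub>A\<^esub> component A \<A> y i"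
proof -
  let ?D = "{i. component A \<A> x i \<noteq> \<zero>\<^bsub>A\<^esub>} \<union> {i. component A \<A> y i \<noteq> \<zero>\<^bsub>A\<^esub>}"
  have D: "finite ?D" using finite_component x y by simp
  have "component A \<A> (x \<oplus>\<^bsub>A\<^esub> y) = (\<lambda>i. component A \<A> x i \<oplus>\<^bsub>A\<^esub> component A \<A> y i)"
  proof (rule component_unique[OF _ D])
    show "x \<oplus>\<^bsub>A\<^esub> y = (\<Oplus>\<^bsub>A\<^esub>i\<in>?D. component A \<A> x i \<oplus>\<^bsub>A\<^esub> component A \<A> y i)"
      using A.finsum_addf[of "component A \<A> x" ?D "component A \<A> y"] component_closed x y
        finsum_component[OF x D] finsum_component[OF y D] by (simp add: Pi_def)
  qed (use x y component_mem graded_add in auto)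
  then show ?thesis by simp
qed

lemma component_homogeneous: "x \<in> \<A> i \<Longrightarrow> component A \<A> x j = (if j = i then x else \<zero>\<^bsub>A\<^esub>)"
proof -
  assume x: "x \<in> \<A> i"
  have "component A \<A> x = (\<lambda>j. if j = i then x else \<zero>\<^bsub>A\<^esub>)"
    by (rule component_unique[of _ "{i}"]) (use x graded_zero graded_closed[OF x] in auto)
  then show ?thesis by simp
qed

lemma component_zero: "component A \<A> \<zero>\<^bsub>A\<^esub> i = \<zero>\<^bsub>A\<^esub>"
  using component_homogeneous[OF graded_zero] by simp

lemma component_finsum:
  assumes "finite I" "g \<in> I \<rightarrow> carrier A"
  shows "component A \<A> (\<Oplus>\<^bsub>A\<^esub>j\<in>I. g j) i = (\<Oplus>\<^bsub>A\<^esub>j\<in>I. component A \<A> (g j) i)"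
  using assms
  by (induction I rule: finite_induct)
     (simp_all add: component_zero component_add component_closed Pi_def)

text \<open>A factor of degree \<open>i\<close> shifts every degree by \<open>i\<close>, so nothing
  lands below \<open>i\<close>; the case distinction guards the truncated subtraction. Products of
  total degree at least \<open>a\<close> are zero by themselves, so the bound \<open>a\<close> does
  not appear.\<close>

lemma component_mult_homogeneous:
  assumes c: "c \<in> carrier A" and d: "d \<in> \<A> i"
  shows "component A \<A> (c \<otimes>\<^bsub>A\<^esub> d) k = (if k < i then \<zero>\<^bsub>A\<^esub> else component A \<A> c (k - i) \<otimes>\<^bsub>A\<^esub> d)"
proof -
  let ?h = "\<lambda>k. if k < i then \<zero>\<^bsub>A\<^esub> else component A \<A> c (k - i) \<otimes>\<^bsub>A\<^esub> d"
  let ?D = "{j. component A \<A> c j \<noteq> \<zero>\<^bsub>A\<^esub>}"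
  have dc: "d \<in> carrier A" using d by (rule graded_closed)
  have "component A \<A> (c \<otimes>\<^bsub>A\<^esub> d) = ?h"
  proof (rule component_unique[of _ "(\<lambda>j. j + i) ` ?D"])
    fix k
    show "?h k \<in> \<A> k"
      using graded_mult[OF component_mem[OF c, of "k - i"] d] graded_zero by auto
  next
    show "finite ((\<lambda>j. j + i) ` ?D)" using finite_component[OF c] by simp
  next
    show "{k. ?h k \<noteq> \<zero>\<^bsub>A\<^esub>} \<subseteq> (\<lambda>j. j + i) ` ?D"
    proof
      fix k assume "k \<in> {k. ?h k \<noteq> \<zero>\<^bsub>A\<^esub>}"
      then have "k = (k - i) + i" "component A \<A> c (k - i) \<noteq> \<zero>\<^bsub>A\<^esub>"
        using dc by (auto split: if_splits)
      then show "k \<in> (\<lambda>j. j + i) ` ?D" by blast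
    qed
  next
    have "(\<Oplus>\<^bsub>A\<^esub>k\<in>(\<lambda>j. j + i) ` ?D. ?h k) = (\<Oplus>\<^bsub>A\<^esub>j\<in>?D. ?h (j + i))"
      by (rule A.finsum_reindex) (use c dc component_closed in \<open>auto simp: inj_on_def\<close>)
    also have "\<dots> = (\<Oplus>\<^bsub>A\<^esub>j\<in>?D. component A \<A> c j \<otimes>\<^bsub>A\<^esub> d)" by simp
    also have "\<dots> = (\<Oplus>\<^bsub>A\<^esub>j\<in>?D. component A \<A> c j) \<otimes>\<^bsub>A\<^esub> d"
      by (rule A.finsum_ldistr[symmetric]) (use finite_component[OF c] dc component_closed[OF c] in auto)
    also have "\<dots> = c \<otimes>\<^bsub>A\<^esub> d"
      using finsum_component[OF c finite_component[OF c]] by simp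
    finally show "c \<otimes>\<^bsub>A\<^esub> d = (\<Oplus>\<^bsub>A\<^esub>k\<in>(\<lambda>j. j + i) ` ?D. ?h k)" by simp
  qed
  then show ?thesis by simp
qed

text \<open>By the shift of degrees only the degree 0 component of \<open>d\<close> can contribute.
  This is the multiplicativity behind the ring homomorphism from \<open>A\<close> onto
  \<open>k\<close>.\<close>

lemma component_mult_0:
  assumes c: "c \<in> carrier A" and d: "d \<in> carrier A"
  shows "component A \<A> (c \<otimes>\<^bsub>A\<^esub> d) 0 = component A \<A> c 0 \<otimes>\<^bsub>A\<^esub> component A \<A> d 0"
proof -
  \<comment> \<open>Index 0 is removed and then inserted again, so that its summand is present even
    when that component is zero.\<close>
  define D where "D = {j. component A \<A> d j \<noteq> \<zero>\<^bsub>A\<^esub>} - {0}"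
  have D: "finite D" "0 \<notin> D" using finite_component[OF d] by (simp_all add: D_def)
  have "d = (\<Oplus>\<^bsub>A\<^esub>j\<in>insert 0 D. component A \<A> d j)"
    by (rule finsum_component[symmetric]) (use d D in \<open>auto simp: D_def\<close>)
  then have "c \<otimes>\<^bsub>A\<^esub> d = c \<otimes>\<^bsub>A\<^esub> (\<Oplus>\<^bsub>A\<^esub>j\<in>insert 0 D. component A \<A> d j)" by simp
  also have "\<dots> = (\<Oplus>\<^bsub>A\<^esub>j\<in>insert 0 D. c \<otimes>\<^bsub>A\<^esub> component A \<A> d j)"
    by (rule A.finsum_rdistr) (use D c d component_closed in auto)
  finally have "component A \<A> (c \<otimes>\<^bsub>A\<^esub> d) 0
      = (\<Oplus>\<^bsub>A\<^esub>j\<in>insert 0 D. component A \<A> (c \<otimes>\<^bsub>A\<^esub> component A \<A> d j) 0)"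
    using component_finsum[of "insert 0 D" "\<lambda>j. c \<otimes>\<^bsub>A\<^esub> component A \<A> d j" 0] D c component_closed[OF d]
    by simp
  also have "\<dots> = (\<Oplus>\<^bsub>A\<^esub>j\<in>insert 0 D. if j = 0 then component A \<A> c 0 \<otimes>\<^bsub>A\<^esub> component A \<A> d 0 else \<zero>\<^bsub>A\<^esub>)"
    by (rule A.finsum_cong')
       (use c d component_closed in \<open>auto simp: component_mult_homogeneous[OF c component_mem[OF d]]\<close>)
  also have "\<dots> = component A \<A> c 0 \<otimes>\<^bsub>A\<^esub> component A \<A> d 0"
  proof -
    have z: "(\<Oplus>\<^bsub>A\<^esub>j\<in>D. if j = 0 then component A \<A> c 0 \<otimes>\<^bsub>A\<^esub> component A \<A> d 0 else \<zero>\<^bsub>A\<^esub>) = (\<Oplus>\<^bsub>A\<^esub>j\<in>D. \<zero>\<^bsub>A\<^esub>)"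
      by (rule A.finsum_cong') (use D in auto)
    show ?thesis using D c d component_closed by (simp add: Pi_def z)
  qed
  finally show ?thesis .
qed

lemma component_minus:
  assumes "x \<in> carrier A"
  shows "component A \<A> (\<ominus>\<^bsub>A\<^esub> x) i = \<ominus>\<^bsub>A\<^esub> component A \<A> x i"
proof -
  have "component A \<A> (\<ominus>\<^bsub>A\<^esub> x) i \<oplus>\<^bsub>A\<^esub> component A \<A> x i = \<zero>\<^bsub>A\<^esub>"
    using component_add[of "\<ominus>\<^bsub>A\<^esub> x" x i] assms by (simp add: A.l_neg component_zero)
  then show ?thesis
    using assms component_closed A.minus_equality[of "component A \<A> (\<ominus>\<^bsub>A\<^esub> x) i" "component A \<A> x i"] by simp
qed

text \<open>The kernel of the projection to degree 0. It contains every homogeneous element of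
  positive degree, which later separates the leading coefficients that are not units from those that
  are.\<close>

lemma irrelevant_ideal: "ideal {c \<in> carrier A. component A \<A> c 0 = \<zero>\<^bsub>A\<^esub>} A"
proof (rule idealI[OF A.ring_axioms])
  show "subgroup {c \<in> carrier A. component A \<A> c 0 = \<zero>\<^bsub>A\<^esub>} (add_monoid A)"
    by (rule A.add.subgroupI)
       (use component_zero component_minus component_add in \<open>auto simp: a_inv_def[symmetric]\<close>)
qed (auto simp: component_mult_0 component_closed)

end

section \<open>Residue field, units and one-dimensional pieces of a graded tdvr\<close>

context
  fixes A :: "('a, 'm) ring_scheme" and a :: enat and \<A> :: "nat \<Rightarrow> 'a set"
  assumes tdvr: "graded_tdvr A a \<A>"
begin

lemma graded_tdvr_graded: "graded_ring A a \<A>"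
  and graded_tdvr_subfield: "subfield (\<A> 0) A"
  using tdvr by (simp_all add: graded_tdvr_def)

interpretation A: cring A using graded_tdvr_graded by (simp add: graded_ring_def)
interpretation k: subfield "\<A> 0" A by (rule graded_tdvr_subfield)

lemma residue_field: "field (A\<lparr>carrier := \<A> 0\<rparr>)"
  using A.subfield_iff(2)[OF graded_tdvr_subfield] .

text \<open>Together with surjectivity this provides the map to a field through which finite bases
  of an \<open>A\<close>-module are compared.\<close>

lemma residue_map_hom: "(\<lambda>c. component A \<A> c 0) \<in> ring_hom A (A\<lparr>carrier := \<A> 0\<rparr>)"
  by (rule ring_hom_memI)
     (simp_all add: component_mem[OF graded_tdvr_graded] component_mult_0[OF graded_tdvr_graded]
       component_add[OF graded_tdvr_graded] component_homogeneous[OF graded_tdvr_graded k.one_closed])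

lemma residue_map_surj: "(\<lambda>c. component A \<A> c 0) ` carrier A = carrier (A\<lparr>carrier := \<A> 0\<rparr>)"
proof -
  have "x \<in> (\<lambda>c. component A \<A> c 0) ` carrier A" if "x \<in> \<A> 0" for x
    using component_homogeneous[OF graded_tdvr_graded that] graded_closed[OF graded_tdvr_graded that]
    by (intro image_eqI[of _ _ x]) simp_all
  then show ?thesis using component_mem[OF graded_tdvr_graded] by auto
qed

lemma one_neq_zero: "\<one>\<^bsub>A\<^esub> \<noteq> \<zero>\<^bsub>A\<^esub>"
  using domain.one_not_zero[OF field.axioms(1)[OF residue_field]] by simp

lemma degree_0_Units: "c \<in> \<A> 0 \<Longrightarrow> c \<noteq> \<zero>\<^bsub>A\<^esub> \<Longrightarrow> c \<in> Units A"
  using A.subfield_m_inv(1)[OF graded_tdvr_subfield, of c]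
    A.subfield_m_inv(2)[OF graded_tdvr_subfield, of c] graded_closed[OF graded_tdvr_graded, of _ 0]
    A.subfield_m_inv(3)[OF graded_tdvr_subfield, of c]
  unfolding Units_def by blast

text \<open>A multiple of an element of positive degree has nothing in degree 0, where one
  lives.\<close>

lemma homogeneous_Units_degree_0:
  assumes c: "c \<in> \<A> i" and U: "c \<in> Units A"
  shows "i = 0"
proof (rule ccontr)
  assume i: "i \<noteq> 0"
  have d: "inv\<^bsub>A\<^esub> c \<in> carrier A" using U by simp
  have "component A \<A> (inv\<^bsub>A\<^esub> c \<otimes>\<^bsub>A\<^esub> c) 0 = \<zero>\<^bsub>A\<^esub>"
    using component_mult_homogeneous[OF graded_tdvr_graded d c, of 0] i by simp
  then have "component A \<A> \<one>\<^bsub>A\<^esub> 0 = \<zero>\<^bsub>A\<^esub>" using U by simp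
  then show False
    using component_homogeneous[OF graded_tdvr_graded k.one_closed] one_neq_zero by simp
qed

lemma homogeneous_val: "c \<in> \<A> i \<Longrightarrow> c \<noteq> \<zero>\<^bsub>A\<^esub> \<Longrightarrow> val \<A> c = i"
  unfolding val_def
  by (rule the_equality)
     (use component_homogeneous[OF graded_tdvr_graded] in \<open>metis\<close>)+

text \<open>Any non-zero vector spans a one-dimensional space. This allows a homogeneous module
  element to be divided by its leading coefficient although that coefficient need not be a
  unit.\<close>

lemma homogeneous_part_eq_multiples:
  assumes i: "enat i < a" and w: "w \<in> \<A> i" "w \<noteq> \<zero>\<^bsub>A\<^esub>" and d: "d \<in> \<A> i"
  shows "\<exists>c \<in> \<A> 0. d = c \<otimes>\<^bsub>A\<^esub> w"
proof -
  have dim: "A.dimension 1 (\<A> 0) (\<A> i)"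
    using tdvr i unfolding graded_tdvr_def by blast
  \<comment> \<open>Both \<open>w\<close> and \<open>d\<close> are compared with this spanning
    vector; the scalar of \<open>w\<close> can be inverted in \<open>k\<close> because
    \<open>w\<close> is non-zero.\<close>
  obtain v where v: "v \<in> carrier A" "v \<noteq> \<zero>\<^bsub>A\<^esub>" "\<A> i = A.line_extension (\<A> 0) v {\<zero>\<^bsub>A\<^esub>}"
    using dim by (auto elim!: A.dimension.cases)
  have mult: "\<exists>c \<in> \<A> 0. x = c \<otimes>\<^bsub>A\<^esub> v" if "x \<in> \<A> i" for x
    using that graded_closed[OF graded_tdvr_graded] v(1)
    unfolding v(3) A.line_extension_mem_iff by auto
  obtain c where c: "c \<in> \<A> 0" "w = c \<otimes>\<^bsub>A\<^esub> v" using mult[OF w(1)] by blast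
  obtain e where e: "e \<in> \<A> 0" "d = e \<otimes>\<^bsub>A\<^esub> v" using mult[OF d] by blast
  have c0: "c \<in> \<A> 0 - {\<zero>\<^bsub>A\<^esub>}" using c w v by auto
  note inv = A.subfield_m_inv[OF graded_tdvr_subfield c0]
  have cl: "c \<in> carrier A" "e \<in> carrier A" "inv\<^bsub>A\<^esub> c \<in> carrier A"
    using c e inv graded_closed[OF graded_tdvr_graded] by blast+
  have "(e \<otimes>\<^bsub>A\<^esub> inv\<^bsub>A\<^esub> c) \<otimes>\<^bsub>A\<^esub> w = e \<otimes>\<^bsub>A\<^esub> (inv\<^bsub>A\<^esub> c \<otimes>\<^bsub>A\<^esub> c) \<otimes>\<^bsub>A\<^esub> v"
    unfolding c(2) using cl v(1) by (simp add: A.m_assoc)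
  also have "\<dots> = d" using cl v(1) inv e by simp
  finally have "d = (e \<otimes>\<^bsub>A\<^esub> inv\<^bsub>A\<^esub> c) \<otimes>\<^bsub>A\<^esub> w" by simp
  moreover have "e \<otimes>\<^bsub>A\<^esub> inv\<^bsub>A\<^esub> c \<in> \<A> 0" using e(1) inv(1) by simp
  ultimately show ?thesis by blast
qed

end

section \<open>Term orders are well-founded\<close>

lemma nat_incseq_subsequence:
  fixes s :: "nat \<Rightarrow> nat"
  obtains f where "strict_mono f" "incseq (s \<circ> f)"
proof -
  obtain f :: "nat \<Rightarrow> nat" where f: "strict_mono f" "monoseq (\<lambda>n. s (f n))"
    using seq_monosub[of s] by blast
  show ?thesis
  proof (cases "incseq (\<lambda>n. s (f n))")
    case True
    then show ?thesis using f that by (simp add: comp_def)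
  next
    case False
    then have dec: "decseq (\<lambda>n. s (f n))" using f(2) by (simp add: monoseq_iff)
    \<comment> \<open>A decreasing sequence of natural numbers is constant from an index on at which
      its minimum is attained; dropping the earlier terms makes it weakly increasing.\<close>
    obtain N where N: "\<And>m. s (f N) \<le> s (f m)"
      using ex_has_least_nat[of "\<lambda>_. True" 0 "\<lambda>n. s (f n)"] by auto
    have "s (f (N + i)) = s (f N)" for i
      using decseqD[OF dec, of N "N + i"] N[of "N + i"] by simp
    then show ?thesis
      using f(1) by (intro that[of "\<lambda>i. f (N + i)"]) (auto simp: strict_mono_def incseq_def)
  qed
qed

text \<open>Subsequences of increasing sequences stay increasing, so the members of the family can
  be treated one after the other.\<close>

lemma finite_family_incseq_subsequence:
  fixes C :: "(nat \<Rightarrow> nat) set"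
  assumes "finite C"
  shows "\<exists>f :: nat \<Rightarrow> nat. strict_mono f \<and> (\<forall>c \<in> C. incseq (c \<circ> f))"
  using assms
proof (induction C rule: finite_induct)
  case empty
  show ?case by (intro exI[of _ id]) (simp add: strict_mono_def)
next
  case (insert c C)
  then obtain f :: "nat \<Rightarrow> nat" where f: "strict_mono f" "\<And>c. c \<in> C \<Longrightarrow> incseq (c \<circ> f)" by blast
  obtain g :: "nat \<Rightarrow> nat" where g: "strict_mono g" "incseq ((c \<circ> f) \<circ> g)"
    using nat_incseq_subsequence[of "c \<circ> f"] by blast
  have "incseq (d \<circ> (f \<circ> g))" if "d \<in> insert c C" for d
  proof (cases "d = c")
    case True
    then show ?thesis using g(2) by (simp add: comp_assoc)
  next
    case False
    then have "incseq (d \<circ> f)" using f(2) that by simp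
    then show ?thesis using g(1) by (simp add: incseq_def strict_mono_less_eq)
  qed
  then show ?case using strict_mono_o[OF f(1) g(1)] by blast
qed

section \<open>Divisibility of module monomials and Dickson's lemma\<close>

lemma monoms_add: "x \<in> monoms n \<Longrightarrow> y \<in> monoms n \<Longrightarrow> x + y \<in> monoms n"
  by (auto simp: monoms_def)

lemma monoms_subset: "y \<subseteq># x \<Longrightarrow> x \<in> monoms n \<Longrightarrow> y \<in> monoms n"
  using set_mset_mono[of y x] by (auto simp: monoms_def)

lemma zero_monoms: "{#} \<in> monoms n"
  by (simp add: monoms_def)

lemma module_monoms_iff: "(z, l) \<in> module_monoms n r \<longleftrightarrow> z \<in> monoms n \<and> l \<in> {1..r}"
  by (simp add: module_monoms_def)

lemma monom_act_module_monoms: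
  "x \<in> monoms n \<Longrightarrow> X \<in> module_monoms n r \<Longrightarrow> monom_act x X \<in> module_monoms n r"
  by (cases X) (simp add: module_monoms_iff monoms_add)

lemma monom_dvd_iff:
  "X \<in> module_monoms n r \<Longrightarrow> Y \<in> module_monoms n r \<Longrightarrow>
    monom_dvd n X Y \<longleftrightarrow> fst X \<subseteq># fst Y \<and> snd X = snd Y"
proof (cases X; cases Y)
  fix x l y k assume *: "X \<in> module_monoms n r" "Y \<in> module_monoms n r" "X = (x, l)" "Y = (y, k)"
  show ?thesis
  proof
    assume "monom_dvd n X Y"
    then show "fst X \<subseteq># fst Y \<and> snd X = snd Y" using * by (auto simp: monom_dvd_def)
  next
    assume d: "fst X \<subseteq># fst Y \<and> snd X = snd Y"
    have "y - x \<in> monoms n" using * monoms_subset[OF diff_subset_eq_self] by (auto simp: module_monoms_iff)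
    then show "monom_dvd n X Y"
      unfolding monom_dvd_def using * d by (intro bexI[of _ "y - x"]) (auto simp: subset_mset.add_diff_inverse)
  qed
qed

lemma monom_dvd_refl: "monom_dvd n X X"
  unfolding monom_dvd_def by (rule bexI[OF _ zero_monoms]) (cases X, simp)

lemma monom_dvd_trans: "monom_dvd n X Y \<Longrightarrow> monom_dvd n Y Z \<Longrightarrow> monom_dvd n X Z"
proof -
  assume "monom_dvd n X Y" "monom_dvd n Y Z"
  then obtain x y where "x \<in> monoms n" "Y = monom_act x X" "y \<in> monoms n" "Z = monom_act y Y"
    unfolding monom_dvd_def by blast
  then show ?thesis
    unfolding monom_dvd_def
    by (cases X) (auto intro!: bexI[of _ "y + x"] simp: monoms_add add.assoc)
qed

lemma dickson:
  fixes X :: "nat \<Rightarrow> module_monom"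
  assumes X: "\<And>i. X i \<in> module_monoms n r"
  shows "\<exists>i j. i < j \<and> monom_dvd n (X i) (X j)"
proof -
  \<comment> \<open>Besides the exponents, both the index of the basis vector and its reflection at
    \<open>r\<close> are made increasing; together they force equal indices in the pair.\<close>
  let ?C = "(\<lambda>v i. count (fst (X i)) v) ` {1..n} \<union> {\<lambda>i. snd (X i), \<lambda>i. r - snd (X i)}"
  obtain f :: "nat \<Rightarrow> nat" where f: "strict_mono f" "\<And>c. c \<in> ?C \<Longrightarrow> incseq (c \<circ> f)"
    using finite_family_incseq_subsequence[of ?C] by auto
  let ?i = "f 0" and ?j = "f 1"
  have le: "c ?i \<le> c ?j" if "c \<in> ?C" for c
    using incseqD[OF f(2)[OF that], of 0 1] by simp
  have "count (fst (X ?i)) v \<le> count (fst (X ?j)) v" for v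
  proof (cases "v \<in> {1..n}")
    case True
    then show ?thesis using le[of "\<lambda>i. count (fst (X i)) v"] by blast
  next
    case False
    then have "v \<notin># fst (X ?i)" using X[of ?i] by (auto simp: module_monoms_def monoms_def)
    then show ?thesis by (simp add: not_in_iff)
  qed
  moreover have "snd (X ?i) \<le> snd (X ?j)" "r - snd (X ?i) \<le> r - snd (X ?j)"
    using le[of "\<lambda>i. snd (X i)"] le[of "\<lambda>i. r - snd (X i)"] by auto
  moreover have "snd (X ?i) \<le> r" "snd (X ?j) \<le> r"
    using X by (auto simp: module_monoms_def mem_Times_iff)
  ultimately have "monom_dvd n (X ?i) (X ?j)"
    unfolding monom_dvd_iff[OF X X] by (simp add: subseteq_mset_def)
  moreover have "?i < ?j" using f(1) by (simp add: strict_mono_def)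
  ultimately show ?thesis by blast
qed

section \<open>Consequences of the axioms of a term order\<close>

context
  fixes n r :: nat and prec :: "module_monom \<Rightarrow> module_monom \<Rightarrow> bool"
  assumes order: "term_order n r prec"
begin

lemma prec_irrefl: "X \<in> module_monoms n r \<Longrightarrow> \<not> prec X X"
  using order unfolding term_order_def by (meson irreflp_onD)

lemma prec_trans:
  "X \<in> module_monoms n r \<Longrightarrow> Y \<in> module_monoms n r \<Longrightarrow> Z \<in> module_monoms n r \<Longrightarrow>
    prec X Y \<Longrightarrow> prec Y Z \<Longrightarrow> prec X Z"
  using order unfolding term_order_def by (meson transp_onD)

lemma prec_act:
  "X \<in> module_monoms n r \<Longrightarrow> Y \<in> module_monoms n r \<Longrightarrow> x \<in> monoms n \<Longrightarrow> prec X Y \<Longrightarrow>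
    prec (monom_act x X) (monom_act x Y)"
  using order unfolding term_order_def by blast

lemma dvd_imp_prec_or_eq:
  assumes "X \<in> module_monoms n r" "monom_dvd n X Y"
  shows "X = Y \<or> prec X Y"
proof -
  obtain x where x: "x \<in> monoms n" "Y = monom_act x X" using assms(2) by (auto simp: monom_dvd_def)
  show ?thesis
  proof (cases "x = {#}")
    case True
    then show ?thesis using x by (cases X) simp
  next
    case False
    then show ?thesis using order x assms(1) unfolding term_order_def by blast
  qed
qed

text \<open>A term order extends divisibility, so in a strictly descending chain no earlier monomial
  can divide a later one, contrary to Dickson's lemma.\<close>

lemma wf_prec: "wf {(X, Y). X \<in> module_monoms n r \<and> Y \<in> module_monoms n r \<and> prec X Y}"
  unfolding wf_iff_no_infinite_down_chain
proof
  assume "\<exists>X. \<forall>i. (X (Suc i), X i) \<in> {(X, Y). X \<in> module_monoms n r \<and> Y \<in> module_monoms n r \<and> prec X Y}"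
  then obtain X where X: "\<And>i. X i \<in> module_monoms n r" "\<And>i. prec (X (Suc i)) (X i)" by blast
  have desc: "prec (X (Suc (i + k))) (X i)" for i k
  proof (induction k)
    case 0
    show ?case using X by simp
  next
    case (Suc k)
    then show ?case using prec_trans[OF X(1) X(1) X(1) X(2)] by simp
  qed
  obtain i j where "i < j" "monom_dvd n (X i) (X j)" using dickson[of X, OF X(1)] by blast
  then have "X i = X j \<or> prec (X i) (X j)" "prec (X j) (X i)"
    using dvd_imp_prec_or_eq[OF X(1)] desc[of i "j - Suc i"] by auto
  then show False using prec_irrefl[OF X(1)] prec_trans[OF X(1) X(1) X(1)] by metis
qed

lemma lp_eqI:
  assumes f: "f \<in> fin_supp_funs A (module_monoms n r)" and Y: "f Y \<noteq> \<zero>\<^bsub>A\<^esub>"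
    and less: "\<And>Z. f Z \<noteq> \<zero>\<^bsub>A\<^esub> \<Longrightarrow> Z \<noteq> Y \<Longrightarrow> prec Z Y"
  shows "lp A prec f = Y"
  unfolding lp_def
proof (rule the_equality)
  fix X assume X: "f X \<noteq> \<zero>\<^bsub>A\<^esub> \<and> (\<forall>Z. f Z \<noteq> \<zero>\<^bsub>A\<^esub> \<longrightarrow> Z \<noteq> X \<longrightarrow> prec Z X)"
  have "X \<in> module_monoms n r" "Y \<in> module_monoms n r"
    using f X Y by (auto simp: fin_supp_funs_def)
  then show "X = Y" using X Y less prec_irrefl prec_trans by metis
qed (use Y less in blast)

lemma lp_properties:
  assumes f: "f \<in> fin_supp_funs A (module_monoms n r)" and nz: "f \<noteq> (\<lambda>X. \<zero>\<^bsub>A\<^esub>)"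
  shows "f (lp A prec f) \<noteq> \<zero>\<^bsub>A\<^esub>" "lp A prec f \<in> module_monoms n r"
    "\<And>Z. f Z \<noteq> \<zero>\<^bsub>A\<^esub> \<Longrightarrow> Z \<noteq> lp A prec f \<Longrightarrow> prec Z (lp A prec f)"
proof -
  let ?S = "{X. f X \<noteq> \<zero>\<^bsub>A\<^esub>}"
  have S: "finite ?S" "?S \<noteq> {}" "?S \<subseteq> module_monoms n r"
    using f nz by (auto simp: fin_supp_funs_def)
  have "transp_on ?S prec" "totalp_on ?S prec"
    using order S(3) unfolding term_order_def by (auto intro: transp_on_subset totalp_on_subset)
  then obtain Y where Y: "Y \<in> ?S" "\<And>X. X \<in> ?S \<Longrightarrow> X \<noteq> Y \<Longrightarrow> prec X Y"
    using Finite_Set.bex_greatest_element[OF S(1,2)] by blast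
  have "lp A prec f = Y" by (rule lp_eqI[OF f]) (use Y in auto)
  then show "f (lp A prec f) \<noteq> \<zero>\<^bsub>A\<^esub>" "lp A prec f \<in> module_monoms n r"
    "\<And>Z. f Z \<noteq> \<zero>\<^bsub>A\<^esub> \<Longrightarrow> Z \<noteq> lp A prec f \<Longrightarrow> prec Z (lp A prec f)"
    using Y S(3) by auto
qed

end

section \<open>The free module\<close>

text \<open>The products of \<open>mpoly_ring\<close> and \<open>free_module\<close> sum over all
  divisors of a monomial, so these have to be finite in number.\<close>

lemma finite_submultisets: "finite {y :: 'b multiset. y \<subseteq># z}"
proof (rule finite_subset)
  show "{y. y \<subseteq># z} \<subseteq> mset ` {xs. set xs \<subseteq> set_mset z \<and> length xs \<le> size z}"
  proof
    fix y assume "y \<in> {y. y \<subseteq># z}"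
    then have y: "set_mset y \<subseteq> set_mset z" "size y \<le> size z"
      by (auto intro: size_mset_mono dest: mset_subset_eqD)
    obtain xs where "y = mset xs" using ex_mset[of y] by auto
    then show "y \<in> mset ` {xs. set xs \<subseteq> set_mset z \<and> length xs \<le> size z}" using y by auto
  qed
  show "finite (mset ` {xs. set xs \<subseteq> set_mset z \<and> length xs \<le> size z})"
    by (intro finite_imageI finite_lists_length_le) simp
qed

text \<open>The action of the polynomial with the single term \<open>c x\<close>, free of the
  convolution sum; \<open>submodule_term_mult\<close> makes the link.\<close>

definition term_mult :: "('a, 'm) ring_scheme \<Rightarrow> 'a \<Rightarrow> monom \<Rightarrow> (module_monom \<Rightarrow> 'a) \<Rightarrow> module_monom \<Rightarrow> 'a" where
  "term_mult A c x f = (\<lambda>(z, l). if x \<subseteq># z then c \<otimes>\<^bsub>A\<^esub> f (z - x, l) else \<zero>\<^bsub>A\<^esub>)"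

lemma (in abelian_monoid) finsum_delta:
  assumes "finite I" "g x \<in> carrier G"
  shows "(\<Oplus>i \<in> I. if i = x then g i else \<zero>) = (if x \<in> I then g x else \<zero>)"
proof -
  have "(\<Oplus>i \<in> I. if i = x then g i else \<zero>) = (\<Oplus>i \<in> I \<inter> {x}. g i)"
    by (rule add.finprod_mono_neutral_cong_right) (use assms in auto)
  also have "\<dots> = (if x \<in> I then g x else \<zero>)" using assms by simp
  finally show ?thesis .
qed

context
  fixes A :: "('a, 'm) ring_scheme" and n r :: nat
  assumes cring: "cring A"
begin

interpretation A: cring A by (rule cring)

lemma free_module_carrier: "carrier (free_module A n r) = fin_supp_funs A (module_monoms n r)"
  "carrier (free_module_base A n r) = fin_supp_funs A (module_monoms n r)"
  by (simp_all add: free_module_def free_module_base_def)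

lemma module_free_module_base: "module A (free_module_base A n r)"
proof -
  have "abelian_group (free_module_base A n r)"
  proof (rule abelian_groupI)
    fix f assume f: "f \<in> carrier (free_module_base A n r)"
    then have "(\<lambda>X. \<ominus>\<^bsub>A\<^esub> f X) \<in> carrier (free_module_base A n r)" by (simp add: free_module_base_def A.fin_supp_funs_minus)
    moreover have "(\<lambda>X. \<ominus>\<^bsub>A\<^esub> f X) \<oplus>\<^bsub>free_module_base A n r\<^esub> f = \<zero>\<^bsub>free_module_base A n r\<^esub>"
      using f by (auto simp: free_module_base_def fin_supp_funs_closed A.l_neg)
    ultimately show "\<exists>g\<in>carrier (free_module_base A n r). g \<oplus>\<^bsub>free_module_base A n r\<^esub> f = \<zero>\<^bsub>free_module_base A n r\<^esub>" by blast
  qed (auto simp: free_module_base_def A.fin_supp_funs_add A.fin_supp_funs_zero fin_supp_funs_closed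
         A.a_ac)
  then show ?thesis
    by (rule moduleI[OF cring])
       (auto simp: free_module_base_def A.fin_supp_funs_smult fin_supp_funs_closed
         A.l_distr A.r_distr A.m_assoc)
qed

lemma abelian_group_free_module: "abelian_group (free_module A n r)"
proof (rule abelian_groupI)
  fix f assume f: "f \<in> carrier (free_module A n r)"
  then have "(\<lambda>X. \<ominus>\<^bsub>A\<^esub> f X) \<in> carrier (free_module A n r)" by (simp add: free_module_def A.fin_supp_funs_minus)
  moreover have "(\<lambda>X. \<ominus>\<^bsub>A\<^esub> f X) \<oplus>\<^bsub>free_module A n r\<^esub> f = \<zero>\<^bsub>free_module A n r\<^esub>"
    using f by (auto simp: free_module_def fin_supp_funs_closed A.l_neg)
  ultimately show "\<exists>g\<in>carrier (free_module A n r). g \<oplus>\<^bsub>free_module A n r\<^esub> f = \<zero>\<^bsub>free_module A n r\<^esub>" by blast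
qed (auto simp: free_module_def A.fin_supp_funs_add A.fin_supp_funs_zero fin_supp_funs_closed
       A.a_ac)

lemma a_inv_free_module:
  assumes "f \<in> carrier (free_module A n r)"
  shows "\<ominus>\<^bsub>free_module A n r\<^esub> f = (\<lambda>X. \<ominus>\<^bsub>A\<^esub> f X)" "\<ominus>\<^bsub>free_module_base A n r\<^esub> f = (\<lambda>X. \<ominus>\<^bsub>A\<^esub> f X)"
proof -
  interpret L: abelian_group "free_module A n r" by (rule abelian_group_free_module)
  interpret Lb: module A "free_module_base A n r" by (rule module_free_module_base)
  have *: "(\<lambda>X. \<ominus>\<^bsub>A\<^esub> f X) \<in> fin_supp_funs A (module_monoms n r)"
    using assms A.fin_supp_funs_minus by (simp add: free_module_carrier)
  have eq: "(\<lambda>X. \<ominus>\<^bsub>A\<^esub> f X \<oplus>\<^bsub>A\<^esub> f X) = (\<lambda>X. \<zero>\<^bsub>A\<^esub>)"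
    using assms by (auto simp: free_module_carrier fin_supp_funs_closed A.l_neg)
  show "\<ominus>\<^bsub>free_module A n r\<^esub> f = (\<lambda>X. \<ominus>\<^bsub>A\<^esub> f X)"
    by (rule L.minus_equality) (use assms * eq in \<open>simp_all add: free_module_def\<close>)
  show "\<ominus>\<^bsub>free_module_base A n r\<^esub> f = (\<lambda>X. \<ominus>\<^bsub>A\<^esub> f X)"
    by (rule Lb.M.minus_equality) (use assms * eq in \<open>simp_all add: free_module_def free_module_base_def\<close>)
qed

lemma finsum_free_module:
  assumes "finite I" "g \<in> I \<rightarrow> carrier (free_module A n r)"
  shows "(\<Oplus>\<^bsub>free_module A n r\<^esub>i\<in>I. g i) X = (\<Oplus>\<^bsub>A\<^esub>i\<in>I. g i X)" "(\<Oplus>\<^bsub>free_module_base A n r\<^esub>i\<in>I. g i) X = (\<Oplus>\<^bsub>A\<^esub>i\<in>I. g i X)"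
proof -
  interpret L: abelian_group "free_module A n r" by (rule abelian_group_free_module)
  interpret Lb: module A "free_module_base A n r" by (rule module_free_module_base)
  have cl: "g i X \<in> carrier A" if "i \<in> I" for i
    using fin_supp_funs_closed[of "g i" A "module_monoms n r"] Pi_mem[OF assms(2) that]
    by (simp add: free_module_carrier)
  have add: "(f \<oplus>\<^bsub>free_module A n r\<^esub> h) X = f X \<oplus>\<^bsub>A\<^esub> h X" "(f \<oplus>\<^bsub>free_module_base A n r\<^esub> h) X = f X \<oplus>\<^bsub>A\<^esub> h X" for f h
    by (simp_all add: free_module_def free_module_base_def)
  have zero: "\<zero>\<^bsub>free_module A n r\<^esub> X = \<zero>\<^bsub>A\<^esub>" "\<zero>\<^bsub>free_module_base A n r\<^esub> X = \<zero>\<^bsub>A\<^esub>"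
    by (simp_all add: free_module_def free_module_base_def)
  show "(\<Oplus>\<^bsub>free_module A n r\<^esub>i\<in>I. g i) X = (\<Oplus>\<^bsub>A\<^esub>i\<in>I. g i X)"
    using assms cl
    by (induction I rule: finite_induct) (simp_all add: add zero Pi_def)
  show "(\<Oplus>\<^bsub>free_module_base A n r\<^esub>i\<in>I. g i) X = (\<Oplus>\<^bsub>A\<^esub>i\<in>I. g i X)"
    using assms cl
    by (induction I rule: finite_induct) (simp_all add: add zero Pi_def free_module_carrier)
qed

lemma smult_free_module_eq_sum:
  "(p \<odot>\<^bsub>free_module A n r\<^esub> f) (z, l) = (\<Oplus>\<^bsub>A\<^esub>x \<in> {x. x \<subseteq># z}. p x \<otimes>\<^bsub>A\<^esub> f (z - x, l))"
  by (simp add: free_module_def)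

lemma smult_closed_free_module:
  assumes p: "p \<in> carrier (mpoly_ring A n)" and f: "f \<in> carrier (free_module A n r)"
  shows "p \<odot>\<^bsub>free_module A n r\<^esub> f \<in> carrier (free_module A n r)"
proof -
  have p': "p \<in> fin_supp_funs A (monoms n)" using p by (simp add: mpoly_ring_def)
  have f': "f \<in> fin_supp_funs A (module_monoms n r)" using f by (simp add: free_module_carrier)
  note cl = fin_supp_funs_closed[OF p'] fin_supp_funs_closed[OF f']
  \<comment> \<open>The products of elements of the two supports: outside this finite set every
    summand of the convolution has a zero factor.\<close>
  let ?D = "(\<lambda>(x, X). monom_act x X) ` ({x. p x \<noteq> \<zero>\<^bsub>A\<^esub>} \<times> {X. f X \<noteq> \<zero>\<^bsub>A\<^esub>})"
  have "p \<odot>\<^bsub>free_module A n r\<^esub> f \<in> fin_supp_funs A (module_monoms n r)"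
  proof (rule fin_supp_funsI)
    fix X :: module_monom
    obtain z l where X: "X = (z, l)" by (cases X)
    show "(p \<odot>\<^bsub>free_module A n r\<^esub> f) X \<in> carrier A"
      unfolding X smult_free_module_eq_sum by (rule A.finsum_closed) (use cl in auto)
    assume nD: "X \<notin> ?D"
    have "(\<Oplus>\<^bsub>A\<^esub>x \<in> {x. x \<subseteq># z}. p x \<otimes>\<^bsub>A\<^esub> f (z - x, l)) = (\<Oplus>\<^bsub>A\<^esub>x \<in> {x. x \<subseteq># z}. \<zero>\<^bsub>A\<^esub>)"
    proof (rule A.finsum_cong')
      fix x assume "x \<in> {x. x \<subseteq># z}"
      then have "X = monom_act x (z - x, l)" by (simp add: X)
      then have "p x = \<zero>\<^bsub>A\<^esub> \<or> f (z - x, l) = \<zero>\<^bsub>A\<^esub>"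
        using nD image_eqI[of X "\<lambda>(x, X). monom_act x X" "(x, (z - x, l))"] by blast
      then show "p x \<otimes>\<^bsub>A\<^esub> f (z - x, l) = \<zero>\<^bsub>A\<^esub>" using cl by auto
    qed auto
    then show "(p \<odot>\<^bsub>free_module A n r\<^esub> f) X = \<zero>\<^bsub>A\<^esub>" by (simp add: X smult_free_module_eq_sum)
  next
    show "finite ?D" using fin_supp_funs_finite[OF p'] fin_supp_funs_finite[OF f'] by simp
    show "?D \<subseteq> module_monoms n r"
    proof (rule image_subsetI)
      fix u assume "u \<in> {x. p x \<noteq> \<zero>\<^bsub>A\<^esub>} \<times> {X. f X \<noteq> \<zero>\<^bsub>A\<^esub>}"
      then have "fst u \<in> monoms n" "snd u \<in> module_monoms n r"
        using p' f' by (auto simp: fin_supp_funs_def)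
      then show "(\<lambda>(x, X). monom_act x X) u \<in> module_monoms n r"
        using monom_act_module_monoms by (simp add: case_prod_beta)
    qed
  qed
  then show ?thesis by (simp add: free_module_carrier)
qed

text \<open>The locale \<open>submodule\<close> asks for an additive subgroup closed under scalars,
  so this description by coefficient functions rests on the abelian group structure of the free
  module.\<close>

lemma submodule_free_module_iff:
  "submodule H (mpoly_ring A n) (free_module A n r) \<longleftrightarrow> H \<subseteq> carrier (free_module A n r) \<and> (\<lambda>X. \<zero>\<^bsub>A\<^esub>) \<in> H \<and>
     (\<forall>f\<in>H. \<forall>g\<in>H. (\<lambda>X. f X \<oplus>\<^bsub>A\<^esub> g X) \<in> H) \<and> (\<forall>f\<in>H. (\<lambda>X. \<ominus>\<^bsub>A\<^esub> f X) \<in> H) \<and>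
     (\<forall>p \<in> carrier (mpoly_ring A n). \<forall>f \<in> H. p \<odot>\<^bsub>free_module A n r\<^esub> f \<in> H)" (is "_ \<longleftrightarrow> ?R")
proof -
  interpret L: abelian_group "free_module A n r" by (rule abelian_group_free_module)
  have ops: "\<zero>\<^bsub>free_module A n r\<^esub> = (\<lambda>X. \<zero>\<^bsub>A\<^esub>)" "\<And>f g. f \<oplus>\<^bsub>free_module A n r\<^esub> g = (\<lambda>X. f X \<oplus>\<^bsub>A\<^esub> g X)"
    by (simp_all add: free_module_def)
  have inv: "inv\<^bsub>add_monoid (free_module A n r)\<^esub> f = (\<lambda>X. \<ominus>\<^bsub>A\<^esub> f X)" if "f \<in> carrier (free_module A n r)" for f
    using a_inv_free_module(1)[OF that] by (simp add: a_inv_def)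
  show ?thesis
  proof
    assume "submodule H (mpoly_ring A n) (free_module A n r)"
    then interpret H: submodule H "mpoly_ring A n" "free_module A n r" .
    have sub: "H \<subseteq> carrier (free_module A n r)" using H.subset by simp
    have "(\<lambda>X. \<ominus>\<^bsub>A\<^esub> f X) \<in> H" if "f \<in> H" for f
      using H.m_inv_closed[OF that] inv[OF subsetD[OF sub that]] by simp
    then show ?R
      using sub H.one_closed H.m_closed H.smult_closed ops by simp
  next
    assume R: ?R
    show "submodule H (mpoly_ring A n) (free_module A n r)"
    proof (intro submodule.intro subgroup.intro submodule_axioms.intro)
      show "inv\<^bsub>add_monoid (free_module A n r)\<^esub> f \<in> H" if "f \<in> H" for f
        using R that inv by auto
    qed (use R ops in auto)
  qed
qed

lemma submodule_term_mult:
  assumes H: "submodule H (mpoly_ring A n) (free_module A n r)" and c: "c \<in> carrier A" and x: "x \<in> monoms n" and f: "f \<in> H"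
  shows "term_mult A c x f \<in> H"
proof -
  let ?p = "\<lambda>y. if y = x then c else \<zero>\<^bsub>A\<^esub>"
  have p: "?p \<in> carrier (mpoly_ring A n)"
    unfolding mpoly_ring_def by (simp, rule fin_supp_funsI[where D = "{x}"]) (use c x in auto)
  have "f \<in> carrier (free_module A n r)" using H f unfolding submodule_free_module_iff by blast
  then have cl: "f X \<in> carrier A" for X by (simp add: free_module_carrier fin_supp_funs_closed)
  have "?p \<odot>\<^bsub>free_module A n r\<^esub> f = term_mult A c x f"
  proof
    fix X :: module_monom
    obtain z l where X: "X = (z, l)" by (cases X)
    have "(?p \<odot>\<^bsub>free_module A n r\<^esub> f) X = (\<Oplus>\<^bsub>A\<^esub>y \<in> {y. y \<subseteq># z}. if y = x then c \<otimes>\<^bsub>A\<^esub> f (z - y, l) else \<zero>\<^bsub>A\<^esub>)"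
      unfolding X smult_free_module_eq_sum by (rule A.finsum_cong') (use c cl in auto)
    also have "\<dots> = term_mult A c x f X"
      using A.finsum_delta[OF finite_submultisets, of "\<lambda>y. c \<otimes>\<^bsub>A\<^esub> f (z - y, l)" x z] c cl
      by (simp add: X term_mult_def)
    finally show "(?p \<odot>\<^bsub>free_module A n r\<^esub> f) X = term_mult A c x f X" .
  qed
  then show ?thesis using H p f unfolding submodule_free_module_iff by metis
qed

text \<open>Restriction of scalars from \<open>R\<close> to \<open>A\<close>: a constant acts as a
  term with trivial monomial.\<close>

lemma submodule_base:
  assumes H: "submodule H (mpoly_ring A n) (free_module A n r)"
  shows "submodule H A (free_module_base A n r)"
proof -
  interpret Lb: module A "free_module_base A n r" by (rule module_free_module_base)
  note R = H[unfolded submodule_free_module_iff]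
  show ?thesis
  proof (rule Lb.submoduleI)
    show "c \<odot>\<^bsub>free_module_base A n r\<^esub> f \<in> H" if c: "c \<in> carrier A" and f: "f \<in> H" for c f
    proof -
      have "c \<odot>\<^bsub>free_module_base A n r\<^esub> f = term_mult A c {#} f" by (auto simp: free_module_base_def term_mult_def)
      then show ?thesis using submodule_term_mult[OF H c zero_monoms f] by simp
    qed
    show "\<ominus>\<^bsub>free_module_base A n r\<^esub> f \<in> H" if "f \<in> H" for f
      using R that a_inv_free_module(2) by auto
  qed (use R in \<open>auto simp: free_module_def free_module_base_def\<close>)
qed

text \<open>The coefficient of a product at \<open>X\<close> collects contributions from the
  factorisations of \<open>X\<close>, and each coefficient of \<open>f\<close> involved sits at a
  divisor of \<open>X\<close>, whose ideal is contained in \<open>J X\<close>. Such submodules serve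
  as upper bounds for \<open>Lt G\<close>.\<close>

lemma submodule_coefficient_ideals:
  assumes J: "\<And>X. ideal (J X) A" and mono: "\<And>x X. x \<in> monoms n \<Longrightarrow> J X \<subseteq> J (monom_act x X)"
  shows "submodule {f \<in> carrier (free_module A n r). \<forall>X. f X \<in> J X} (mpoly_ring A n) (free_module A n r)"
  unfolding submodule_free_module_iff
proof (intro conjI ballI)
  have add: "additive_subgroup (J X) A" for X using J by (rule ideal.axioms(1))
  show "(\<lambda>X. \<zero>\<^bsub>A\<^esub>) \<in> {f \<in> carrier (free_module A n r). \<forall>X. f X \<in> J X}"
    using A.fin_supp_funs_zero additive_subgroup.zero_closed[OF add] by (simp add: free_module_carrier)
  show "(\<lambda>X. f X \<oplus>\<^bsub>A\<^esub> g X) \<in> {f \<in> carrier (free_module A n r). \<forall>X. f X \<in> J X}"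
    if "f \<in> {f \<in> carrier (free_module A n r). \<forall>X. f X \<in> J X}" "g \<in> {f \<in> carrier (free_module A n r). \<forall>X. f X \<in> J X}" for f g
    using that A.fin_supp_funs_add[of f "module_monoms n r" g] additive_subgroup.a_closed[OF add]
    by (simp add: free_module_carrier)
  show "(\<lambda>X. \<ominus>\<^bsub>A\<^esub> f X) \<in> {f \<in> carrier (free_module A n r). \<forall>X. f X \<in> J X}"
    if "f \<in> {f \<in> carrier (free_module A n r). \<forall>X. f X \<in> J X}" for f
    using that A.fin_supp_funs_minus[of f "module_monoms n r"] additive_subgroup.a_inv_closed[OF add]
    by (simp add: free_module_carrier)
  show "p \<odot>\<^bsub>free_module A n r\<^esub> f \<in> {f \<in> carrier (free_module A n r). \<forall>X. f X \<in> J X}"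
    if p: "p \<in> carrier (mpoly_ring A n)" and f: "f \<in> {f \<in> carrier (free_module A n r). \<forall>X. f X \<in> J X}" for p f
  proof (intro CollectI conjI allI)
    show "p \<odot>\<^bsub>free_module A n r\<^esub> f \<in> carrier (free_module A n r)" by (rule smult_closed_free_module) (use p f in auto)
    fix X :: module_monom
    obtain z l where X: "X = (z, l)" by (cases X)
    have p': "p \<in> fin_supp_funs A (monoms n)" using p by (simp add: mpoly_ring_def)
    \<comment> \<open>Monotonicity of \<open>J\<close> is known for monomials in the
      \<open>n\<close> variables; at all others the coefficient of \<open>p\<close> is zero.\<close>
    have summand: "p x \<otimes>\<^bsub>A\<^esub> f (z - x, l) \<in> J (z, l)" if "x \<subseteq># z" for x
    proof (cases "x \<in> monoms n")
      case True
      have "f (z - x, l) \<in> J (monom_act x (z - x, l))" using f mono[OF True] by blast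
      then show ?thesis
        using ideal.I_l_closed[OF J] fin_supp_funs_closed[OF p'] that by simp
    next
      case False
      then have "p x = \<zero>\<^bsub>A\<^esub>" by (rule fin_supp_funs_zero_outside[OF p'])
      moreover have "f (z - x, l) \<in> carrier A"
        using f fin_supp_funs_closed[of f A "module_monoms n r"] by (simp add: free_module_carrier)
      ultimately show ?thesis using additive_subgroup.zero_closed[OF add] by simp
    qed
    have "(\<Oplus>\<^bsub>A\<^esub>x\<in>E. p x \<otimes>\<^bsub>A\<^esub> f (z - x, l)) \<in> J (z, l)" if "finite E" "E \<subseteq> {x. x \<subseteq># z}" for E
      using that
    proof (induction E rule: finite_induct)
      case empty
      then show ?case using additive_subgroup.zero_closed[OF add] by simp
    next
      case (insert x E)
      have "p y \<otimes>\<^bsub>A\<^esub> f (z - y, l) \<in> carrier A" for y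
        using f fin_supp_funs_closed[OF p'] fin_supp_funs_closed[of f A "module_monoms n r"]
        by (simp add: free_module_carrier)
      then show ?case
        using insert summand additive_subgroup.a_closed[OF add] by (simp add: Pi_def)
    qed
    from this[OF finite_submultisets subset_refl] show "(p \<odot>\<^bsub>free_module A n r\<^esub> f) X \<in> J X"
      unfolding X smult_free_module_eq_sum .
  qed
qed auto

end

section \<open>Flatness of the quotient\<close>

lemma free_module_simps:
  "\<zero>\<^bsub>free_module A n r\<^esub> = (\<lambda>X. \<zero>\<^bsub>A\<^esub>)" "\<zero>\<^bsub>free_module_base A n r\<^esub> = (\<lambda>X. \<zero>\<^bsub>A\<^esub>)"
  "f \<oplus>\<^bsub>free_module_base A n r\<^esub> g = (\<lambda>X. f X \<oplus>\<^bsub>A\<^esub> g X)"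
  "c \<odot>\<^bsub>free_module_base A n r\<^esub> f = (\<lambda>X. c \<otimes>\<^bsub>A\<^esub> f X)"
  by (simp_all add: free_module_def free_module_base_def)

lemma Lt_subset:
  assumes "submodule H (mpoly_ring A n) (free_module A n r)"
    "\<And>f. f \<in> S \<Longrightarrow> f \<noteq> (\<lambda>X. \<zero>\<^bsub>A\<^esub>) \<Longrightarrow> lt A prec f \<in> H"
  shows "Lt A n r prec S \<subseteq> H"
  using assms unfolding Lt_def submodule_generated_def by (auto simp: free_module_simps)

lemma lt_in_Lt:
  "f \<in> S \<Longrightarrow> f \<noteq> (\<lambda>X. \<zero>\<^bsub>A\<^esub>) \<Longrightarrow> lt A prec f \<in> Lt A n r prec S"
  unfolding Lt_def submodule_generated_def by (auto simp: free_module_simps)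

locale homogeneous_groebner =
  fixes A :: "('a, 'm) ring_scheme" and a :: enat and \<A> :: "nat \<Rightarrow> 'a set" and n r :: nat
    and prec :: "module_monom \<Rightarrow> module_monom \<Rightarrow> bool"
    and M G :: "(module_monom \<Rightarrow> 'a) set"
  assumes tdvr: "graded_tdvr A a \<A>"
    and order: "term_order n r prec"
    and graded_M: "graded_submodule A \<A> n r M"
    and groebner: "groebner_basis A n r prec M G"
    and homogeneous_G: "\<forall>g \<in> G. homogeneous A a \<A> n r g"
begin

lemma graded: "graded_ring A a \<A>"
  by (rule graded_tdvr_graded[OF tdvr])

lemma cring: "cring A"
  using graded by (simp add: graded_ring_def)

interpretation A: cring A by (rule cring)

lemma submodule_M: "submodule M (mpoly_ring A n) (free_module A n r)"
  using graded_M by (simp add: graded_submodule_def)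

lemma M_closed: "f \<in> M \<Longrightarrow> f \<in> fin_supp_funs A (module_monoms n r)"
  using submodule_M unfolding submodule_free_module_iff[OF cring] free_module_carrier(1)[OF cring] by blast

lemma M_zero: "(\<lambda>X. \<zero>\<^bsub>A\<^esub>) \<in> M"
  and M_add: "f \<in> M \<Longrightarrow> g \<in> M \<Longrightarrow> (\<lambda>X. f X \<oplus>\<^bsub>A\<^esub> g X) \<in> M"
  and M_minus: "f \<in> M \<Longrightarrow> (\<lambda>X. \<ominus>\<^bsub>A\<^esub> f X) \<in> M"
  using submodule_M unfolding submodule_free_module_iff[OF cring] by blast+

lemma M_smult: "c \<in> carrier A \<Longrightarrow> f \<in> M \<Longrightarrow> (\<lambda>X. c \<otimes>\<^bsub>A\<^esub> f X) \<in> M"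
proof -
  assume c: "c \<in> carrier A" and f: "f \<in> M"
  have "term_mult A c {#} f = (\<lambda>X. c \<otimes>\<^bsub>A\<^esub> f X)" by (auto simp: term_mult_def)
  then show ?thesis using submodule_term_mult[OF cring submodule_M c zero_monoms f] by simp
qed

section \<open>Leading monomials and leading coefficients of the Groebner basis\<close>

lemma G_properties:
  assumes "g \<in> G"
  shows "g \<in> M" "g \<noteq> (\<lambda>X. \<zero>\<^bsub>A\<^esub>)" "lc A prec g \<noteq> \<zero>\<^bsub>A\<^esub>" "lp A prec g \<in> module_monoms n r"
    "\<And>Z. g Z \<noteq> \<zero>\<^bsub>A\<^esub> \<Longrightarrow> Z \<noteq> lp A prec g \<Longrightarrow> prec Z (lp A prec g)"
proof -
  show g: "g \<in> M" "g \<noteq> (\<lambda>X. \<zero>\<^bsub>A\<^esub>)"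
    using groebner assms by (auto simp: groebner_basis_def free_module_simps)
  show "lc A prec g \<noteq> \<zero>\<^bsub>A\<^esub>" "lp A prec g \<in> module_monoms n r"
    "\<And>Z. g Z \<noteq> \<zero>\<^bsub>A\<^esub> \<Longrightarrow> Z \<noteq> lp A prec g \<Longrightarrow> prec Z (lp A prec g)"
    using lp_properties[OF order M_closed[OF g(1)] g(2)] by (simp_all add: lc_def)
qed

lemma G_homogeneous: "g \<in> G \<Longrightarrow> \<exists>i. enat i < a \<and> (\<forall>X. g X \<in> \<A> i)"
  using homogeneous_G by (auto simp: homogeneous_def homog_part_def)

lemma lc_degree:
  assumes "g \<in> G"
  shows "enat (val \<A> (lc A prec g)) < a" "lc A prec g \<in> \<A> (val \<A> (lc A prec g))"
proof -
  obtain i where i: "enat i < a" "lc A prec g \<in> \<A> i"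
    using G_homogeneous[OF assms] unfolding lc_def by blast
  then show "enat (val \<A> (lc A prec g)) < a" "lc A prec g \<in> \<A> (val \<A> (lc A prec g))"
    using homogeneous_val[OF tdvr i(2) G_properties(3)[OF assms]] by simp_all
qed

lemma lc_Units_iff: "g \<in> G \<Longrightarrow> lc A prec g \<in> Units A \<longleftrightarrow> val \<A> (lc A prec g) = 0"
  using homogeneous_Units_degree_0[OF tdvr lc_degree(2)] degree_0_Units[OF tdvr _ G_properties(3)]
    lc_degree(2) by metis

text \<open>
  The coefficient at \<open>X\<close> of an element of \<open>Lt G\<close> is a combination of the leading coefficients of
  those \<open>g \<in> G\<close> whose leading monomial divides \<open>X\<close>.
\<close>

lemma leading_monomial_divides:
  assumes I: "ideal I A" and split: "\<And>g. g \<in> G \<Longrightarrow> P g \<or> lc A prec g \<in> I"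
    and f: "f \<in> M" "f \<noteq> (\<lambda>X. \<zero>\<^bsub>A\<^esub>)" "lc A prec f \<notin> I"
  shows "\<exists>g \<in> G. P g \<and> monom_dvd n (lp A prec g) (lp A prec f)"
proof (rule ccontr)
  assume no: "\<not> ?thesis"
  \<comment> \<open>At multiples of the leading monomial of some \<open>g\<close> with
    \<open>P g\<close> the coefficient is free; elsewhere it must lie in \<open>I\<close>. By
    \<open>split\<close> the leading terms of \<open>G\<close> obey this, hence so does all of
    \<open>Lt G\<close>.\<close>
  define J where "J = (\<lambda>X. if \<exists>g \<in> G. P g \<and> monom_dvd n (lp A prec g) X then carrier A else I)"
  let ?H = "{h \<in> carrier (free_module A n r). \<forall>X. h X \<in> J X}"
  have I_sub: "I \<subseteq> carrier A" using ideal.Icarr[OF I] by blast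
  have act: "monom_dvd n X (monom_act x Y)" if "monom_dvd n X Y" "x \<in> monoms n" for x X Y
    by (rule monom_dvd_trans[OF that(1)]) (use that(2) in \<open>auto simp: monom_dvd_def\<close>)
  have H: "submodule ?H (mpoly_ring A n) (free_module A n r)"
  proof (rule submodule_coefficient_ideals[OF cring])
    show "ideal (J X) A" for X using I A.oneideal by (simp add: J_def)
    show "J X \<subseteq> J (monom_act x X)" if "x \<in> monoms n" for x X
    proof (cases "\<exists>g \<in> G. P g \<and> monom_dvd n (lp A prec g) X")
      case True
      then have "\<exists>g \<in> G. P g \<and> monom_dvd n (lp A prec g) (monom_act x X)" using act[OF _ that] by blast
      then show ?thesis using True by (simp add: J_def)
    next
      case False
      then have "J X = I" unfolding J_def by (rule if_not_P)
      moreover have "I \<subseteq> J (monom_act x X)" using I_sub by (simp add: J_def)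
      ultimately show ?thesis by simp
    qed
  qed
  have "Lt A n r prec G \<subseteq> ?H"
  proof (rule Lt_subset[OF H])
    fix g assume g: "g \<in> G"
    have cl: "g X \<in> carrier A" for X by (rule fin_supp_funs_closed[OF M_closed[OF G_properties(1)[OF g]]])
    have "lt A prec g \<in> fin_supp_funs A (module_monoms n r)"
      by (rule fin_supp_funsI[where D = "{lp A prec g}"])
         (use cl G_properties(4)[OF g] in \<open>auto simp: lt_def lc_def\<close>)
    moreover have "lt A prec g X \<in> J X" for X
    proof (cases "X = lp A prec g")
      case True
      have "lc A prec g \<in> J (lp A prec g)"
        using split[OF g] g monom_dvd_refl[of n "lp A prec g"] cl I_sub by (auto simp: J_def lc_def)
      then show ?thesis using True by (simp add: lt_def)
    next
      case False
      then show ?thesis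
        using additive_subgroup.zero_closed[OF ideal.axioms(1)[OF I]] by (simp add: lt_def J_def)
    qed
    ultimately show "lt A prec g \<in> ?H" by (simp add: free_module_carrier[OF cring])
  qed
  \<comment> \<open>Here the Groebner property enters: \<open>Lt G\<close> contains the leading
    terms of all non-zero elements of \<open>M\<close>.\<close>
  moreover have "lt A prec f \<in> Lt A n r prec G"
    using lt_in_Lt[OF f(1,2)] groebner by (simp add: groebner_basis_def)
  ultimately have "lt A prec f (lp A prec f) \<in> J (lp A prec f)" by blast
  then show False using no f(3) unfolding J_def lt_def by auto
qed

text \<open>By \<open>standard_monoms_eq\<close> this is the set on which \<open>min_val\<close>
  takes the value \<open>a\<close>; divisibility is the form suited to reduction modulo
  \<open>M\<close>.\<close>

definition standard_monoms :: "module_monom set" where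
  "standard_monoms = {X \<in> module_monoms n r. \<forall>g \<in> G. \<not> monom_dvd n (lp A prec g) X}"

lemma standard_monoms_independent:
  assumes f: "f \<in> M" "f \<in> fin_supp_funs A standard_monoms"
  shows "f = (\<lambda>X. \<zero>\<^bsub>A\<^esub>)"
proof (rule ccontr)
  assume nz: "f \<noteq> (\<lambda>X. \<zero>\<^bsub>A\<^esub>)"
  have "f (lp A prec f) \<noteq> \<zero>\<^bsub>A\<^esub>" using lp_properties(1)[OF order M_closed[OF f(1)] nz] .
  then have "lp A prec f \<in> standard_monoms" "lc A prec f \<notin> {\<zero>\<^bsub>A\<^esub>}"
    using fin_supp_funs_supp[OF f(2)] by (auto simp: lc_def)
  moreover have "\<exists>g \<in> G. True \<and> monom_dvd n (lp A prec g) (lp A prec f)"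
    by (rule leading_monomial_divides[OF A.zeroideal _ f(1) nz]) (use calculation in auto)
  ultimately show False by (simp add: standard_monoms_def)
qed

subsection \<open>From flatness to unit leading coefficients\<close>

text \<open>Gradedness of \<open>M\<close> yields homogeneous summands of \<open>f\<close> inside
  \<open>M\<close>. Read coefficient by coefficient they are the homogeneous components, by
  uniqueness, and the one of degree 0 is the function in question.\<close>

lemma component_in_M:
  assumes f: "f \<in> M"
  shows "(\<lambda>X. component A \<A> (f X) 0) \<in> M"
proof -
  obtain h where h: "\<And>i. h i \<in> M \<inter> homog_part A \<A> n r i"
    and fin: "finite {i. h i \<noteq> \<zero>\<^bsub>free_module A n r\<^esub>}"
    and sum: "f = (\<Oplus>\<^bsub>free_module A n r\<^esub>i \<in> {i. h i \<noteq> \<zero>\<^bsub>free_module A n r\<^esub>}. h i)"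
    using graded_M f unfolding graded_submodule_def by blast
  have "component A \<A> (f X) = (\<lambda>i. h i X)" for X
  proof (rule component_unique[OF graded _ fin])
    show "h i X \<in> \<A> i" for i using h[of i] unfolding homog_part_def by blast
    show "{i. h i X \<noteq> \<zero>\<^bsub>A\<^esub>} \<subseteq> {i. h i \<noteq> \<zero>\<^bsub>free_module A n r\<^esub>}"
      by (auto simp: free_module_simps)
    show "f X = (\<Oplus>\<^bsub>A\<^esub>i \<in> {i. h i \<noteq> \<zero>\<^bsub>free_module A n r\<^esub>}. h i X)"
      by (subst sum, rule finsum_free_module(1)[OF cring fin]) (use h in \<open>auto simp: homog_part_def\<close>)
  qed
  then have "(\<lambda>X. component A \<A> (f X) 0) = h 0" by simp
  then show ?thesis using h[of 0] by simp
qed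

text \<open>The sum of \<open>M\<close> and the elements without degree 0 component, since degree 0
  components of elements of \<open>M\<close> lie in \<open>M\<close>. Membership is tested by one
  projection instead of a decomposition.\<close>

definition residue_submodule :: "(module_monom \<Rightarrow> 'a) set" where
  "residue_submodule = {f \<in> fin_supp_funs A (module_monoms n r). (\<lambda>X. component A \<A> (f X) 0) \<in> M}"

lemma M_subset_residue_submodule: "M \<subseteq> residue_submodule"
  using M_closed component_in_M by (auto simp: residue_submodule_def)

lemma submodule_residue_submodule: "submodule residue_submodule A (free_module_base A n r)"
proof -
  interpret Lb: module A "free_module_base A n r" by (rule module_free_module_base[OF cring])
  have cl: "f X \<in> carrier A" if "f \<in> residue_submodule" for f X
    using that fin_supp_funs_closed[of f A "module_monoms n r"] by (simp add: residue_submodule_def)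
  show ?thesis
  proof (rule Lb.submoduleI)
    show "residue_submodule \<subseteq> carrier (free_module_base A n r)"
      by (auto simp: residue_submodule_def free_module_carrier[OF cring])
    show "\<zero>\<^bsub>free_module_base A n r\<^esub> \<in> residue_submodule"
      using M_zero A.fin_supp_funs_zero by (simp add: residue_submodule_def free_module_simps component_zero[OF graded])
    show "\<ominus>\<^bsub>free_module_base A n r\<^esub> f \<in> residue_submodule" if f: "f \<in> residue_submodule" for f
    proof -
      have "f \<in> carrier (free_module A n r)"
        using f by (simp add: residue_submodule_def free_module_carrier[OF cring])
      moreover have "(\<lambda>X. component A \<A> (\<ominus>\<^bsub>A\<^esub> f X) 0) = (\<lambda>X. \<ominus>\<^bsub>A\<^esub> component A \<A> (f X) 0)"
        using component_minus[OF graded cl[OF f]] by simp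
      ultimately show ?thesis
        using f M_minus[of "\<lambda>X. component A \<A> (f X) 0"] A.fin_supp_funs_minus[of f "module_monoms n r"]
        by (simp add: a_inv_free_module[OF cring] residue_submodule_def)
    qed
    show "f \<oplus>\<^bsub>free_module_base A n r\<^esub> g \<in> residue_submodule"
      if f: "f \<in> residue_submodule" and g: "g \<in> residue_submodule" for f g
    proof -
      have "(\<lambda>X. component A \<A> (f X \<oplus>\<^bsub>A\<^esub> g X) 0) = (\<lambda>X. component A \<A> (f X) 0 \<oplus>\<^bsub>A\<^esub> component A \<A> (g X) 0)"
        using component_add[OF graded cl[OF f] cl[OF g]] by simp
      then show ?thesis
        using f g M_add[of "\<lambda>X. component A \<A> (f X) 0" "\<lambda>X. component A \<A> (g X) 0"]
          A.fin_supp_funs_add[of f "module_monoms n r" g]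
        by (simp add: residue_submodule_def free_module_simps)
    qed
    show "c \<odot>\<^bsub>free_module_base A n r\<^esub> f \<in> residue_submodule"
      if c: "c \<in> carrier A" and f: "f \<in> residue_submodule" for c f
    proof -
      have "(\<lambda>X. component A \<A> (c \<otimes>\<^bsub>A\<^esub> f X) 0) = (\<lambda>X. component A \<A> c 0 \<otimes>\<^bsub>A\<^esub> component A \<A> (f X) 0)"
        using component_mult_0[OF graded c cl[OF f]] by simp
      then show ?thesis
        using f c M_smult[of "component A \<A> c 0" "\<lambda>X. component A \<A> (f X) 0"]
          component_closed[OF graded c] A.fin_supp_funs_smult[of f "module_monoms n r" c]
        by (simp add: residue_submodule_def free_module_simps)
    qed
  qed
qed

text \<open>
  If \<open>w\<close> is homogeneous and non-zero and \<open>w f \<in> M\<close>, then flatness makes \<open>w \<otimes> f\<close> vanish in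
  \<open>(w) \<otimes> (L/M)\<close>. It is mapped to the class of \<open>f\<close> by the balanced map
  \<open>(c w, x) \<mapsto> c x\<close> into the quotient of \<open>L/M\<close> by the elements of positive degree, which is
  well-defined because \<open>c w = 0\<close> forces the degree 0 component of \<open>c\<close> to vanish.
\<close>

lemma flat_divisible:
  fixes U :: "'u itself"
  assumes flat: "flat U A (quotient_module (free_module_base A n r) M)"
    and w: "w \<in> \<A> i" "w \<noteq> \<zero>\<^bsub>A\<^esub>"
    and f: "f \<in> fin_supp_funs A (module_monoms n r)" "(\<lambda>X. w \<otimes>\<^bsub>A\<^esub> f X) \<in> M"
  shows "(\<lambda>X. component A \<A> (f X) 0) \<in> M"
proof -
  let ?L = "free_module_base A n r" and ?T = "residue_submodule"
  let ?Q = "quotient_module ?L M" and ?R = "quotient_module ?L ?T"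
  have L: "module A ?L" by (rule module_free_module_base[OF cring])
  interpret L: module A ?L by (rule L)
  have M: "submodule M A ?L" by (rule submodule_base[OF cring submodule_M])
  have T: "submodule ?T A ?L" by (rule submodule_residue_submodule)
  interpret R: module A ?R by (rule module_quotient_module[OF L T])
  note T_props = L.submoduleE[OF T]
  have wc: "w \<in> carrier A" by (rule graded_closed[OF graded w(1)])
  let ?I = "PIdl\<^bsub>A\<^esub> w"
  have I: "ideal ?I A" by (rule A.cgenideal_ideal[OF wc])
  have I_iff: "d \<in> ?I \<longleftrightarrow> (\<exists>c \<in> carrier A. d = c \<otimes>\<^bsub>A\<^esub> w)" for d by (auto simp: cgenideal_def)
  \<comment> \<open>The degree \<open>i\<close> component of \<open>c w\<close> is the degree 0
    component of \<open>c\<close> times \<open>w\<close>. If that component of \<open>c\<close> were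
    non-zero, it could be cancelled and \<open>w\<close> would be zero.\<close>
  have annihilator: "component A \<A> c 0 = \<zero>\<^bsub>A\<^esub>" if c: "c \<in> carrier A" "c \<otimes>\<^bsub>A\<^esub> w = \<zero>\<^bsub>A\<^esub>" for c
  proof (rule ccontr)
    assume nz: "component A \<A> c 0 \<noteq> \<zero>\<^bsub>A\<^esub>"
    have "component A \<A> c 0 \<otimes>\<^bsub>A\<^esub> w = \<zero>\<^bsub>A\<^esub>"
      using component_mult_homogeneous[OF graded c(1) w(1), of i] c(2) by (simp add: component_zero[OF graded])
    moreover have U: "component A \<A> c 0 \<in> Units A"
      by (rule degree_0_Units[OF tdvr component_mem[OF graded c(1)] nz])
    ultimately show False
      using A.m_assoc[of "inv\<^bsub>A\<^esub> (component A \<A> c 0)" "component A \<A> c 0" w] A.Units_l_inv[OF U]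
        A.Units_inv_closed[OF U] A.Units_closed[OF U] wc w(2) by simp
  qed
  \<comment> \<open>The scalar and the representative are chosen arbitrarily;
    \<open>well_defined\<close> removes the dependence on both choices at once.\<close>
  define \<beta> where "\<beta> d C = ?T +>\<^bsub>?L\<^esub> ((SOME c. c \<in> carrier A \<and> d = c \<otimes>\<^bsub>A\<^esub> w)
      \<odot>\<^bsub>?L\<^esub> (SOME x. x \<in> carrier ?L \<and> C = M +>\<^bsub>?L\<^esub> x))" for d C
  have well_defined: "?T +>\<^bsub>?L\<^esub> (c \<odot>\<^bsub>?L\<^esub> x) = ?T +>\<^bsub>?L\<^esub> (c' \<odot>\<^bsub>?L\<^esub> x')"
    if c: "c \<in> carrier A" "c' \<in> carrier A" "c \<otimes>\<^bsub>A\<^esub> w = c' \<otimes>\<^bsub>A\<^esub> w"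
      and x: "x \<in> carrier ?L" "x' \<in> carrier ?L" "M +>\<^bsub>?L\<^esub> x = M +>\<^bsub>?L\<^esub> x'" for c c' x x'
  proof -
    let ?d = "c \<oplus>\<^bsub>A\<^esub> \<ominus>\<^bsub>A\<^esub> c'"
    have dc: "?d \<in> carrier A" using c by simp
    have "?d \<otimes>\<^bsub>A\<^esub> w = \<zero>\<^bsub>A\<^esub>" using c wc by (simp add: A.l_distr A.l_minus A.r_neg)
    then have d0: "component A \<A> ?d 0 = \<zero>\<^bsub>A\<^esub>" by (rule annihilator[OF dc])
    have xf: "x \<in> fin_supp_funs A (module_monoms n r)" using x by (simp add: free_module_carrier[OF cring])
    have "(\<lambda>X. component A \<A> (?d \<otimes>\<^bsub>A\<^esub> x X) 0) = (\<lambda>X. \<zero>\<^bsub>A\<^esub>)"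
      using component_mult_0[OF graded dc fin_supp_funs_closed[OF xf]] d0
        component_closed[OF graded fin_supp_funs_closed[OF xf]] by simp
    then have 1: "?d \<odot>\<^bsub>?L\<^esub> x \<in> ?T"
      using M_zero A.fin_supp_funs_smult[OF xf dc] by (simp add: residue_submodule_def free_module_simps)
    have "x \<oplus>\<^bsub>?L\<^esub> \<ominus>\<^bsub>?L\<^esub> x' \<in> ?T"
      using x(3) coset_eq_iff[OF L M x(1,2)] M_subset_residue_submodule by blast
    then have 2: "c' \<odot>\<^bsub>?L\<^esub> (x \<oplus>\<^bsub>?L\<^esub> \<ominus>\<^bsub>?L\<^esub> x') \<in> ?T" using T_props(4) c by blast
    \<comment> \<open>Changing the scalar costs \<open>?d\<close> times \<open>x\<close>, which has
      no degree 0 component; changing the representative costs a multiple of an element of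
      \<open>M\<close>.\<close>
    have "c \<odot>\<^bsub>?L\<^esub> x \<oplus>\<^bsub>?L\<^esub> \<ominus>\<^bsub>?L\<^esub> (c' \<odot>\<^bsub>?L\<^esub> x') = ?d \<odot>\<^bsub>?L\<^esub> x \<oplus>\<^bsub>?L\<^esub> c' \<odot>\<^bsub>?L\<^esub> (x \<oplus>\<^bsub>?L\<^esub> \<ominus>\<^bsub>?L\<^esub> x')"
      using c x by (simp add: L.smult_l_distr L.smult_r_distr L.smult_l_minus L.smult_r_minus
          L.M.a_assoc L.M.r_neg1 L.M.r_neg2)
    also have "\<dots> \<in> ?T" using T_props(5) 1 2 by blast
    finally show ?thesis using c x coset_eq_iff[OF L T] by simp
  qed
  have \<beta>: "\<beta> (c \<otimes>\<^bsub>A\<^esub> w) (M +>\<^bsub>?L\<^esub> x) = ?T +>\<^bsub>?L\<^esub> (c \<odot>\<^bsub>?L\<^esub> x)"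
    if c: "c \<in> carrier A" and x: "x \<in> carrier ?L" for c x
  proof -
    have 1: "(SOME c'. c' \<in> carrier A \<and> c \<otimes>\<^bsub>A\<^esub> w = c' \<otimes>\<^bsub>A\<^esub> w) \<in> carrier A \<and>
      c \<otimes>\<^bsub>A\<^esub> w = (SOME c'. c' \<in> carrier A \<and> c \<otimes>\<^bsub>A\<^esub> w = c' \<otimes>\<^bsub>A\<^esub> w) \<otimes>\<^bsub>A\<^esub> w"
      by (rule someI[of "\<lambda>c'. c' \<in> carrier A \<and> c \<otimes>\<^bsub>A\<^esub> w = c' \<otimes>\<^bsub>A\<^esub> w" c]) (use c in simp)
    have 2: "(SOME x'. x' \<in> carrier ?L \<and> M +>\<^bsub>?L\<^esub> x = M +>\<^bsub>?L\<^esub> x') \<in> carrier ?L \<and>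
      M +>\<^bsub>?L\<^esub> x = M +>\<^bsub>?L\<^esub> (SOME x'. x' \<in> carrier ?L \<and> M +>\<^bsub>?L\<^esub> x = M +>\<^bsub>?L\<^esub> x')"
      by (rule someI[of "\<lambda>x'. x' \<in> carrier ?L \<and> M +>\<^bsub>?L\<^esub> x = M +>\<^bsub>?L\<^esub> x'" x]) (use x in simp)
    show ?thesis
      unfolding \<beta>_def
      by (rule well_defined[symmetric]) (use 1 2 c x in blast)+
  qed
  have Q: "carrier ?Q = (\<lambda>x. M +>\<^bsub>?L\<^esub> x) ` carrier ?L" by (rule carrier_quotient_module[OF L M])
  have fL: "f \<in> carrier ?L" using f(1) by (simp add: free_module_carrier[OF cring])
  have "\<beta> w (M +>\<^bsub>?L\<^esub> f) = \<one>\<^bsub>add_monoid ?R\<^esub>"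
  proof (rule flat_balanced_map_zero[OF flat cring I, where f = \<beta>])
    show "w \<in> ?I" by (rule A.cgenideal_self[OF wc])
    show "M +>\<^bsub>?L\<^esub> f \<in> carrier ?Q" by (rule coset_in_quotient_module[OF L M fL])
    show "w \<odot>\<^bsub>?Q\<^esub> (M +>\<^bsub>?L\<^esub> f) = \<zero>\<^bsub>?Q\<^esub>"
      using f(2) coset_zero_iff[OF L M, of "w \<odot>\<^bsub>?L\<^esub> f"] wc fL M_closed[OF f(2)]
      by (simp add: free_module_carrier[OF cring] smult_quotient_module[OF L M] free_module_simps(4))
    show "comm_group (add_monoid ?R)" by (rule R.a_comm_group)
    fix d C assume d: "d \<in> ?I" and C: "C \<in> carrier ?Q"
    obtain c where c: "c \<in> carrier A" "d = c \<otimes>\<^bsub>A\<^esub> w" using d I_iff by blast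
    obtain x where x: "x \<in> carrier ?L" "C = M +>\<^bsub>?L\<^esub> x" using C Q by blast
    show "\<beta> d C \<in> carrier (add_monoid ?R)"
      using c x coset_in_quotient_module[OF L T] by (simp add: \<beta>)
    show "\<beta> (d \<oplus>\<^bsub>A\<^esub> e) C = \<beta> d C \<otimes>\<^bsub>add_monoid ?R\<^esub> \<beta> e C" if e: "e \<in> ?I" for e
    proof -
      obtain c' where c': "c' \<in> carrier A" "e = c' \<otimes>\<^bsub>A\<^esub> w" using e I_iff by blast
      have "d \<oplus>\<^bsub>A\<^esub> e = (c \<oplus>\<^bsub>A\<^esub> c') \<otimes>\<^bsub>A\<^esub> w" using c c' wc by (simp add: A.l_distr)
      then show ?thesis using c c' x by (simp add: \<beta> add_quotient_module[OF L T] L.smult_l_distr)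
    qed
    show "\<beta> d (C \<oplus>\<^bsub>?Q\<^esub> C') = \<beta> d C \<otimes>\<^bsub>add_monoid ?R\<^esub> \<beta> d C'" if C': "C' \<in> carrier ?Q" for C'
    proof -
      obtain x' where x': "x' \<in> carrier ?L" "C' = M +>\<^bsub>?L\<^esub> x'" using C' Q by blast
      then show ?thesis
        using c x by (simp add: \<beta> add_quotient_module[OF L M] add_quotient_module[OF L T] L.smult_r_distr)
    qed
    show "\<beta> (e \<otimes>\<^bsub>A\<^esub> d) C = \<beta> d (e \<odot>\<^bsub>?Q\<^esub> C)" if e: "e \<in> carrier A" for e
    proof -
      have "e \<otimes>\<^bsub>A\<^esub> d = (c \<otimes>\<^bsub>A\<^esub> e) \<otimes>\<^bsub>A\<^esub> w" using c e wc by (simp add: A.m_ac)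
      then show ?thesis using c e x by (simp add: \<beta> smult_quotient_module[OF L M] L.smult_assoc1)
    qed
  qed
  \<comment> \<open>With \<open>w\<close> written as one times \<open>w\<close>, the value of the
    balanced map is the class of \<open>f\<close>.\<close>
  moreover have "\<beta> w (M +>\<^bsub>?L\<^esub> f) = ?T +>\<^bsub>?L\<^esub> f"
    using \<beta>[OF A.one_closed fL] wc fL by simp
  ultimately have "f \<in> ?T" using coset_zero_iff[OF L T fL] by simp
  then show ?thesis by (simp add: residue_submodule_def)
qed

lemma flat_imp_unit_lc:
  fixes U :: "'u itself"
  assumes flat: "flat U A (quotient_module (free_module_base A n r) M)" and g: "g \<in> G"
  shows "\<exists>g' \<in> G. lc A prec g' \<in> Units A \<and> monom_dvd n (lp A prec g') (lp A prec g)"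
proof -
  note gp = G_properties[OF g]
  let ?w = "lc A prec g"
  obtain i where i: "enat i < a" "\<And>X. g X \<in> \<A> i" using G_homogeneous[OF g] by blast
  have w: "?w \<in> \<A> i" "?w \<noteq> \<zero>\<^bsub>A\<^esub>" using i gp by (simp_all add: lc_def)
  have wc: "?w \<in> carrier A" by (rule graded_closed[OF graded w(1)])
  \<comment> \<open>The last conjunct prescribes zero where \<open>g\<close> vanishes, so that
    \<open>h\<close> inherits the support of \<open>g\<close> and with it the leading
    monomial.\<close>
  have "\<exists>c. c \<in> \<A> 0 \<and> g X = c \<otimes>\<^bsub>A\<^esub> ?w \<and> (g X = \<zero>\<^bsub>A\<^esub> \<longrightarrow> c = \<zero>\<^bsub>A\<^esub>)" for X
  proof (cases "g X = \<zero>\<^bsub>A\<^esub>")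
    case True
    then show ?thesis using graded_zero[OF graded] wc by auto
  next
    case False
    then show ?thesis using homogeneous_part_eq_multiples[OF tdvr i(1) w i(2)] by blast
  qed
  then obtain h where h: "\<And>X. h X \<in> \<A> 0" "\<And>X. g X = h X \<otimes>\<^bsub>A\<^esub> ?w" "\<And>X. g X = \<zero>\<^bsub>A\<^esub> \<Longrightarrow> h X = \<zero>\<^bsub>A\<^esub>"
    by metis
  have hc: "h X \<in> carrier A" for X by (rule graded_closed[OF graded h(1)])
  have supp: "h X = \<zero>\<^bsub>A\<^esub> \<longleftrightarrow> g X = \<zero>\<^bsub>A\<^esub>" for X using h(2)[of X] h(3)[of X] wc by auto
  have hL: "h \<in> fin_supp_funs A (module_monoms n r)"
    using M_closed[OF gp(1)] hc by (simp add: fin_supp_funs_def supp)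
  have "(\<lambda>X. ?w \<otimes>\<^bsub>A\<^esub> h X) = g" using h(2) hc wc A.m_comm by fastforce
  then have "(\<lambda>X. component A \<A> (h X) 0) \<in> M"
    using flat_divisible[OF flat w hL] gp(1) by simp
  \<comment> \<open>All coefficients of \<open>h\<close> have degree 0, so the projection leaves
    \<open>h\<close> unchanged.\<close>
  then have hM: "h \<in> M" using component_homogeneous[OF graded h(1), of _ 0] by simp
  have lp: "lp A prec h = lp A prec g" by (simp add: lp_def supp)
  have nz: "h (lp A prec g) \<noteq> \<zero>\<^bsub>A\<^esub>" using gp(3) by (simp add: supp lc_def)
  then have h0: "h \<noteq> (\<lambda>X. \<zero>\<^bsub>A\<^esub>)" by auto
  let ?I = "{c \<in> carrier A. component A \<A> c 0 = \<zero>\<^bsub>A\<^esub>}"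
  have "\<exists>g' \<in> G. lc A prec g' \<in> Units A \<and> monom_dvd n (lp A prec g') (lp A prec h)"
  proof (rule leading_monomial_divides[OF irrelevant_ideal[OF graded] _ hM h0])
    show "lc A prec h \<notin> ?I"
      using nz component_homogeneous[OF graded h(1), of "lp A prec g" 0] by (simp add: lc_def lp)
    \<comment> \<open>Leading coefficients of \<open>G\<close> are homogeneous: degree 0 makes them
      units, positive degree puts them into the ideal.\<close>
    show "lc A prec g' \<in> Units A \<or> lc A prec g' \<in> ?I" if g': "g' \<in> G" for g'
      using component_homogeneous[OF graded lc_degree(2)[OF g'], of 0] lc_Units_iff[OF g']
        graded_closed[OF graded lc_degree(2)[OF g']] by auto
  qed
  then show ?thesis by (simp add: lp)
qed

subsection \<open>From unit leading coefficients to a basis\<close>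

abbreviation unit_vector :: "module_monom \<Rightarrow> module_monom \<Rightarrow> 'a" where
  "unit_vector X \<equiv> (\<lambda>Y. if Y = X then \<one>\<^bsub>A\<^esub> else \<zero>\<^bsub>A\<^esub>)"

lemma unit_vector_expansion:
  assumes f: "f \<in> fin_supp_funs A (module_monoms n r)" and D: "finite D" "{X. f X \<noteq> \<zero>\<^bsub>A\<^esub>} \<subseteq> D"
    "D \<subseteq> module_monoms n r"
  shows "(\<Oplus>\<^bsub>free_module_base A n r\<^esub>X\<in>D. f X \<odot>\<^bsub>free_module_base A n r\<^esub> unit_vector X) = f"
proof
  fix Y
  have cl: "f X \<in> carrier A" for X by (rule fin_supp_funs_closed[OF f])
  have "(\<Oplus>\<^bsub>free_module_base A n r\<^esub>X\<in>D. f X \<odot>\<^bsub>free_module_base A n r\<^esub> unit_vector X) Y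
      = (\<Oplus>\<^bsub>A\<^esub>X\<in>D. (f X \<odot>\<^bsub>free_module_base A n r\<^esub> unit_vector X) Y)"
  proof (rule finsum_free_module(2)[OF cring D(1)], rule funcsetI)
    fix X assume "X \<in> D"
    then have "X \<in> module_monoms n r" using D(3) by blast
    then show "f X \<odot>\<^bsub>free_module_base A n r\<^esub> unit_vector X \<in> carrier (free_module A n r)"
      using A.fin_supp_funs_smult[OF A.fin_supp_funs_unit cl]
      by (simp only: free_module_carrier[OF cring] free_module_simps)
  qed
  also have "\<dots> = (\<Oplus>\<^bsub>A\<^esub>X\<in>D. if X = Y then f X else \<zero>\<^bsub>A\<^esub>)"
    by (rule A.finsum_cong') (use cl in \<open>auto simp: free_module_simps\<close>)
  also have "\<dots> = (if Y \<in> D then f Y else \<zero>\<^bsub>A\<^esub>)" by (rule A.finsum_delta[OF D(1) cl])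
  also have "\<dots> = f Y"
  proof (cases "Y \<in> D")
    case False
    then have "f Y = \<zero>\<^bsub>A\<^esub>" using D(2) by blast
    then show ?thesis by simp
  qed simp
  finally show "(\<Oplus>\<^bsub>free_module_base A n r\<^esub>X\<in>D. f X \<odot>\<^bsub>free_module_base A n r\<^esub> unit_vector X) Y = f Y" .
qed

text \<open>The sum of \<open>M\<close> and the span of the standard monomials, described
  elementwise. Under the assumption on unit leading coefficients it turns out to be the whole free
  module.\<close>

definition reducible :: "(module_monom \<Rightarrow> 'a) set" where
  "reducible = {f \<in> fin_supp_funs A (module_monoms n r).
     \<exists>h \<in> fin_supp_funs A standard_monoms. (\<lambda>X. f X \<oplus>\<^bsub>A\<^esub> \<ominus>\<^bsub>A\<^esub> h X) \<in> M}"

lemma reducibleI: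
  "f \<in> fin_supp_funs A (module_monoms n r) \<Longrightarrow> h \<in> fin_supp_funs A standard_monoms \<Longrightarrow>
    (\<lambda>X. f X \<oplus>\<^bsub>A\<^esub> \<ominus>\<^bsub>A\<^esub> h X) \<in> M \<Longrightarrow> f \<in> reducible"
  unfolding reducible_def by blast

lemma reducible_add:
  assumes "f \<in> reducible" "g \<in> reducible"
  shows "(\<lambda>X. f X \<oplus>\<^bsub>A\<^esub> g X) \<in> reducible"
proof -
  obtain h k where f: "f \<in> fin_supp_funs A (module_monoms n r)" and g: "g \<in> fin_supp_funs A (module_monoms n r)"
    and h: "h \<in> fin_supp_funs A standard_monoms" "(\<lambda>X. f X \<oplus>\<^bsub>A\<^esub> \<ominus>\<^bsub>A\<^esub> h X) \<in> M"
    and k: "k \<in> fin_supp_funs A standard_monoms" "(\<lambda>X. g X \<oplus>\<^bsub>A\<^esub> \<ominus>\<^bsub>A\<^esub> k X) \<in> M"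
    using assms unfolding reducible_def by blast
  have "(\<lambda>X. (f X \<oplus>\<^bsub>A\<^esub> g X) \<oplus>\<^bsub>A\<^esub> \<ominus>\<^bsub>A\<^esub> (h X \<oplus>\<^bsub>A\<^esub> k X))
      = (\<lambda>X. (f X \<oplus>\<^bsub>A\<^esub> \<ominus>\<^bsub>A\<^esub> h X) \<oplus>\<^bsub>A\<^esub> (g X \<oplus>\<^bsub>A\<^esub> \<ominus>\<^bsub>A\<^esub> k X))"
    using fin_supp_funs_closed[OF f] fin_supp_funs_closed[OF g] fin_supp_funs_closed[OF h(1)]
      fin_supp_funs_closed[OF k(1)] by (simp add: A.minus_add A.a_ac)
  then show ?thesis
    using M_add[OF h(2) k(2)]
    by (intro reducibleI[OF A.fin_supp_funs_add[OF f g] A.fin_supp_funs_add[OF h(1) k(1)]]) simp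
qed

lemma reducible_smult:
  assumes "f \<in> reducible" and c: "c \<in> carrier A"
  shows "(\<lambda>X. c \<otimes>\<^bsub>A\<^esub> f X) \<in> reducible"
proof -
  obtain h where f: "f \<in> fin_supp_funs A (module_monoms n r)"
    and h: "h \<in> fin_supp_funs A standard_monoms" "(\<lambda>X. f X \<oplus>\<^bsub>A\<^esub> \<ominus>\<^bsub>A\<^esub> h X) \<in> M"
    using assms unfolding reducible_def by blast
  have "(\<lambda>X. c \<otimes>\<^bsub>A\<^esub> f X \<oplus>\<^bsub>A\<^esub> \<ominus>\<^bsub>A\<^esub> (c \<otimes>\<^bsub>A\<^esub> h X)) = (\<lambda>X. c \<otimes>\<^bsub>A\<^esub> (f X \<oplus>\<^bsub>A\<^esub> \<ominus>\<^bsub>A\<^esub> h X))"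
    using fin_supp_funs_closed[OF f] fin_supp_funs_closed[OF h(1)] c by (simp add: A.r_distr A.r_minus)
  then show ?thesis
    using M_smult[OF c h(2)]
    by (intro reducibleI[OF A.fin_supp_funs_smult[OF f c] A.fin_supp_funs_smult[OF h(1) c]]) simp
qed

lemma M_reducible: "f \<in> M \<Longrightarrow> f \<in> reducible"
proof -
  assume f: "f \<in> M"
  have "(\<lambda>X. f X \<oplus>\<^bsub>A\<^esub> \<ominus>\<^bsub>A\<^esub> \<zero>\<^bsub>A\<^esub>) = f"
    using fin_supp_funs_closed[OF M_closed[OF f]] by simp
  then show ?thesis
    using f by (intro reducibleI[OF M_closed[OF f] A.fin_supp_funs_zero]) simp
qed

text \<open>Isolating the monomials that actually occur matters for the induction below, where only
  the smaller ones are known to be reducible.\<close>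

lemma reducible_of_support:
  assumes f: "f \<in> fin_supp_funs A (module_monoms n r)"
    and unit: "\<And>X. f X \<noteq> \<zero>\<^bsub>A\<^esub> \<Longrightarrow> unit_vector X \<in> reducible"
  shows "f \<in> reducible"
proof -
  let ?L = "free_module_base A n r"
  interpret L: module A ?L by (rule module_free_module_base[OF cring])
  have cl: "f X \<in> carrier A" for X by (rule fin_supp_funs_closed[OF f])
  have "(\<Oplus>\<^bsub>?L\<^esub>X\<in>E. f X \<odot>\<^bsub>?L\<^esub> unit_vector X) \<in> reducible"
    if "finite E" "E \<subseteq> {X. f X \<noteq> \<zero>\<^bsub>A\<^esub>}" for E
    using that
  proof (induction E rule: finite_induct)
    case empty
    then show ?case using M_reducible[OF M_zero] by (simp add: free_module_simps)
  next
    case (insert X E)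
    have terms: "f Y \<odot>\<^bsub>?L\<^esub> unit_vector Y \<in> reducible" if "Y \<in> insert X E" for Y
      using reducible_smult[OF unit cl] insert.prems that unfolding free_module_simps(4) by blast
    then have "f Y \<odot>\<^bsub>?L\<^esub> unit_vector Y \<in> carrier ?L" if "Y \<in> insert X E" for Y
      using that unfolding reducible_def free_module_carrier[OF cring] by blast
    then have "(\<Oplus>\<^bsub>?L\<^esub>Y\<in>insert X E. f Y \<odot>\<^bsub>?L\<^esub> unit_vector Y)
        = f X \<odot>\<^bsub>?L\<^esub> unit_vector X \<oplus>\<^bsub>?L\<^esub> (\<Oplus>\<^bsub>?L\<^esub>Y\<in>E. f Y \<odot>\<^bsub>?L\<^esub> unit_vector Y)"
      by (intro L.M.finsum_insert insert.hyps) auto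
    then show ?case
      using reducible_add[OF terms insert.IH] insert.prems unfolding free_module_simps(3) by simp
  qed
  from this[OF fin_supp_funs_finite[OF f] subset_refl] show ?thesis
    by (simp only: unit_vector_expansion[OF f fin_supp_funs_finite[OF f] subset_refl fin_supp_funs_supp[OF f]])
qed

context
  assumes unit_lc: "\<forall>g \<in> G. \<exists>g' \<in> G. lc A prec g' \<in> Units A \<and> monom_dvd n (lp A prec g') (lp A prec g)"
begin

lemma unit_vector_reducible:
  assumes "X \<in> module_monoms n r"
  shows "unit_vector X \<in> reducible"
  using assms
proof (induction X rule: wf_induct_rule[OF wf_prec[OF order]])
  case (1 X)
  have eX: "unit_vector X \<in> fin_supp_funs A (module_monoms n r)" by (rule A.fin_supp_funs_unit[OF 1(2)])
  show ?case
  proof (cases "X \<in> standard_monoms")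
    case True
    have "(\<lambda>Y. unit_vector X Y \<oplus>\<^bsub>A\<^esub> \<ominus>\<^bsub>A\<^esub> unit_vector X Y) \<in> M"
      using M_zero fin_supp_funs_closed[OF eX] by (simp add: A.r_neg)
    then show ?thesis by (rule reducibleI[OF eX A.fin_supp_funs_unit[OF True]])
  next
    case False
    then obtain g where g: "g \<in> G" "lc A prec g \<in> Units A" "monom_dvd n (lp A prec g) X"
      using 1(2) unit_lc monom_dvd_trans unfolding standard_monoms_def by blast
    note gp = G_properties[OF g(1)]
    let ?u = "inv\<^bsub>A\<^esub> (lc A prec g)"
    obtain x where x: "x \<in> monoms n" "X = monom_act x (lp A prec g)" using g(3) by (auto simp: monom_dvd_def)
    have uc: "?u \<in> carrier A" using g(2) by simp
    have cl: "g Y \<in> carrier A" for Y by (rule fin_supp_funs_closed[OF M_closed[OF gp(1)]])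
    \<comment> \<open>The multiple of \<open>g\<close> whose leading term is \<open>X\<close> with
      coefficient one; it exists because the leading coefficient is a unit.\<close>
    define h where "h = term_mult A ?u x g"
    have hM: "h \<in> M" unfolding h_def by (rule submodule_term_mult[OF cring submodule_M uc x(1) gp(1)])
    have hf: "h \<in> fin_supp_funs A (module_monoms n r)" by (rule M_closed[OF hM])
    have hact: "h (monom_act x Y) = ?u \<otimes>\<^bsub>A\<^esub> g Y" for Y by (cases Y) (simp add: h_def term_mult_def)
    have hX: "h X = \<one>\<^bsub>A\<^esub>" using g(2) x(2) by (simp add: hact flip: lc_def)
    have less: "prec Z X" if Z: "h Z \<noteq> \<zero>\<^bsub>A\<^esub>" "Z \<noteq> X" for Z
    proof -
      obtain z l where zl: "Z = (z, l)" by (cases Z)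
      have sub: "x \<subseteq># z" using Z(1) by (auto simp: zl h_def term_mult_def split: if_splits)
      then have Zx: "Z = monom_act x (z - x, l)" by (simp add: zl)
      have "?u \<otimes>\<^bsub>A\<^esub> g (z - x, l) \<noteq> \<zero>\<^bsub>A\<^esub>" using Z(1) unfolding Zx hact .
      then have gz: "g (z - x, l) \<noteq> \<zero>\<^bsub>A\<^esub>" using uc by auto
      then have zl': "(z - x, l) \<in> module_monoms n r"
        using fin_supp_funs_supp[OF M_closed[OF gp(1)]] by blast
      have "(z - x, l) \<noteq> lp A prec g" using Z(2) Zx x(2) by metis
      from prec_act[OF order zl' gp(4) x(1) gp(5)[OF gz this]]
      show ?thesis unfolding Zx x(2) .
    qed
    \<comment> \<open>Subtracting \<open>h\<close> cancels \<open>X\<close> and leaves smaller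
      monomials, to which the induction hypothesis applies; \<open>h\<close> is added back at the
      end, being an element of \<open>M\<close>.\<close>
    let ?d = "\<lambda>Y. unit_vector X Y \<oplus>\<^bsub>A\<^esub> \<ominus>\<^bsub>A\<^esub> h Y"
    have df: "?d \<in> fin_supp_funs A (module_monoms n r)"
      by (rule A.fin_supp_funs_add[OF eX A.fin_supp_funs_minus[OF hf]])
    have "?d \<in> reducible"
    proof (rule reducible_of_support[OF df])
      fix Z assume Z: "?d Z \<noteq> \<zero>\<^bsub>A\<^esub>"
      then have "Z \<noteq> X" using hX by (auto simp: A.r_neg)
      then have "h Z \<noteq> \<zero>\<^bsub>A\<^esub>" using Z by auto
      then have "(Z, X) \<in> {(X, Y). X \<in> module_monoms n r \<and> Y \<in> module_monoms n r \<and> prec X Y}"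
        "Z \<in> module_monoms n r"
        using less \<open>Z \<noteq> X\<close> fin_supp_funs_supp[OF hf] 1(2) by auto
      then show "unit_vector Z \<in> reducible" by (rule 1(1))
    qed
    from reducible_add[OF this M_reducible[OF hM]]
    have "(\<lambda>Y. ?d Y \<oplus>\<^bsub>A\<^esub> h Y) \<in> reducible" .
    moreover have "(\<lambda>Y. ?d Y \<oplus>\<^bsub>A\<^esub> h Y) = unit_vector X"
    proof
      fix Y
      show "?d Y \<oplus>\<^bsub>A\<^esub> h Y = unit_vector X Y"
        using fin_supp_funs_closed[OF hf, of Y] by (simp add: A.a_assoc A.l_neg)
    qed
    ultimately show ?thesis by simp
  qed
qed

lemma all_reducible: "f \<in> fin_supp_funs A (module_monoms n r) \<Longrightarrow> f \<in> reducible"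
  using reducible_of_support unit_vector_reducible fin_supp_funs_supp by blast

section \<open>Cosets of standard monomials as a basis of the quotient\<close>

abbreviation coset :: "(module_monom \<Rightarrow> 'a) \<Rightarrow> (module_monom \<Rightarrow> 'a) set" where
  "coset f \<equiv> M +>\<^bsub>free_module_base A n r\<^esub> f"

lemma standard_monoms_subset: "standard_monoms \<subseteq> module_monoms n r"
  by (auto simp: standard_monoms_def)

lemma fin_supp_standard: "f \<in> fin_supp_funs A standard_monoms \<Longrightarrow> f \<in> fin_supp_funs A (module_monoms n r)"
  using standard_monoms_subset unfolding fin_supp_funs_def by blast

text \<open>Two standard representatives of a coset differ by an element of \<open>M\<close>
  supported on standard monomials, which must be zero.\<close>

lemma coset_eqD:
  assumes "f \<in> fin_supp_funs A standard_monoms" "g \<in> fin_supp_funs A standard_monoms" "coset f = coset g"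
  shows "f = g"
proof -
  have L: "module A (free_module_base A n r)" by (rule module_free_module_base[OF cring])
  have M: "submodule M A (free_module_base A n r)" by (rule submodule_base[OF cring submodule_M])
  have fg: "f \<in> carrier (free_module_base A n r)" "g \<in> carrier (free_module_base A n r)"
    using assms fin_supp_standard by (simp_all add: free_module_carrier[OF cring])
  have "f \<oplus>\<^bsub>free_module_base A n r\<^esub> \<ominus>\<^bsub>free_module_base A n r\<^esub> g \<in> M"
    using coset_eq_iff[OF L M fg] assms(3) by simp
  then have "(\<lambda>X. f X \<oplus>\<^bsub>A\<^esub> \<ominus>\<^bsub>A\<^esub> g X) \<in> M"
    using fg a_inv_free_module(2)[OF cring, of g n r] by (simp add: free_module_simps free_module_carrier[OF cring])
  then have "(\<lambda>X. f X \<oplus>\<^bsub>A\<^esub> \<ominus>\<^bsub>A\<^esub> g X) = (\<lambda>X. \<zero>\<^bsub>A\<^esub>)"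
    by (rule standard_monoms_independent[OF _ A.fin_supp_funs_add[OF assms(1) A.fin_supp_funs_minus[OF assms(2)]]])
  then have "f X \<oplus>\<^bsub>A\<^esub> \<ominus>\<^bsub>A\<^esub> g X = \<zero>\<^bsub>A\<^esub>" for X by (rule fun_cong)
  then have "f X = g X" for X
    using fin_supp_funs_closed[OF assms(1), of X] fin_supp_funs_closed[OF assms(2), of X]
    by (metis A.minus_equality A.minus_minus A.a_inv_closed)
  then show ?thesis by blast
qed

lemma inj_coset: "inj_on (\<lambda>X. coset (unit_vector X)) standard_monoms"
proof (rule inj_onI)
  fix X Y assume XY: "X \<in> standard_monoms" "Y \<in> standard_monoms" "coset (unit_vector X) = coset (unit_vector Y)"
  have "unit_vector X = unit_vector Y"
    by (rule coset_eqD[OF A.fin_supp_funs_unit A.fin_supp_funs_unit]) (use XY in auto)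
  then have "unit_vector X X = unit_vector Y X" by (rule fun_cong)
  then show "X = Y" using one_neq_zero[OF tdvr] by (simp split: if_splits)
qed

lemma quotient_basis:
  "module_basis A (quotient_module (free_module_base A n r) M) ((\<lambda>X. coset (unit_vector X)) ` standard_monoms)"
proof -
  let ?L = "free_module_base A n r" and ?S = standard_monoms and ?e = "\<lambda>X. coset (unit_vector X)"
  let ?Q = "quotient_module ?L M"
  have L: "module A ?L" by (rule module_free_module_base[OF cring])
  interpret L: module A ?L by (rule L)
  have M: "submodule M A ?L" by (rule submodule_base[OF cring submodule_M])
  have Q: "module A ?Q" by (rule module_quotient_module[OF L M])
  interpret Q: module A ?Q by (rule Q)
  have eL: "unit_vector X \<in> carrier ?L" if "X \<in> ?S" for X
    using A.fin_supp_funs_unit[of X "module_monoms n r"] that standard_monoms_subset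
    by (auto simp: free_module_carrier[OF cring])
  have eQ: "?e X \<in> carrier ?Q" if "X \<in> ?S" for X
    by (rule coset_in_quotient_module[OF L M eL[OF that]])
  \<comment> \<open>The basis is a set of cosets, so coefficient families are indexed by cosets.
    Since \<open>inj_coset\<close> makes distinct monomials give distinct cosets, they can be
    exchanged for families indexed by standard monomials.\<close>
  have lincomb: "lincomb A ?Q c = coset f"
    if c: "c \<in> fin_supp_funs A (?e ` ?S)" and f: "f \<in> fin_supp_funs A ?S"
      and cf: "\<And>X. X \<in> ?S \<Longrightarrow> c (?e X) = f X" for c f
  proof -
    let ?D = "{X. f X \<noteq> \<zero>\<^bsub>A\<^esub>}"
    have D: "finite ?D" "?D \<subseteq> ?S" using f by (auto simp: fin_supp_funs_def)
    have fc: "f X \<in> carrier A" for X by (rule fin_supp_funs_closed[OF f])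
    have supp: "{b. c b \<noteq> \<zero>\<^bsub>A\<^esub>} = ?e ` ?D"
    proof
      show "{b. c b \<noteq> \<zero>\<^bsub>A\<^esub>} \<subseteq> ?e ` ?D"
        using fin_supp_funs_supp[OF c] cf by (auto simp del: split_paired_All)
      show "?e ` ?D \<subseteq> {b. c b \<noteq> \<zero>\<^bsub>A\<^esub>}"
        using D(2) cf by (auto simp del: split_paired_All)
    qed
    have "lincomb A ?Q c = (\<Oplus>\<^bsub>?Q\<^esub>X\<in>?D. c (?e X) \<odot>\<^bsub>?Q\<^esub> ?e X)"
      unfolding lincomb_def supp
    proof (rule Q.M.finsum_reindex)
      show "(\<lambda>b. c b \<odot>\<^bsub>?Q\<^esub> b) \<in> ?e ` ?D \<rightarrow> carrier ?Q"
        using fin_supp_funs_closed[OF c] eQ D(2) by blast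
      show "inj_on ?e ?D" by (rule inj_on_subset[OF inj_coset D(2)])
    qed
    also have "\<dots> = (\<Oplus>\<^bsub>?Q\<^esub>X\<in>?D. coset (f X \<odot>\<^bsub>?L\<^esub> unit_vector X))"
    proof (rule Q.M.finsum_cong')
      show "(\<lambda>X. coset (f X \<odot>\<^bsub>?L\<^esub> unit_vector X)) \<in> ?D \<rightarrow> carrier ?Q"
        using coset_in_quotient_module[OF L M L.smult_closed[OF fc eL]] D(2) by blast
      fix X assume "X \<in> ?D"
      then have X: "X \<in> ?S" using D(2) by blast
      show "c (?e X) \<odot>\<^bsub>?Q\<^esub> ?e X = coset (f X \<odot>\<^bsub>?L\<^esub> unit_vector X)"
        unfolding cf[OF X] by (rule smult_quotient_module[OF L M fc eL[OF X]])
    qed simp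
    also have "\<dots> = coset (\<Oplus>\<^bsub>?L\<^esub>X\<in>?D. f X \<odot>\<^bsub>?L\<^esub> unit_vector X)"
      by (rule finsum_quotient_module[OF L M D(1)]) (use L.smult_closed[OF fc eL] D(2) in blast)
    also have "\<dots> = coset f"
      using unit_vector_expansion[OF fin_supp_standard[OF f] D(1) subset_refl] D(2) standard_monoms_subset by simp
    finally show ?thesis .
  qed
  show ?thesis
  proof (rule module_basisI[OF Q])
    show "?e ` ?S \<subseteq> carrier ?Q" using eQ by blast
    fix C assume "C \<in> carrier ?Q"
    then obtain f where f: "f \<in> carrier ?L" "C = coset f" unfolding carrier_quotient_module[OF L M] by blast
    then have "f \<in> reducible" using all_reducible by (simp add: free_module_carrier[OF cring])
    then obtain h where h: "h \<in> fin_supp_funs A ?S" "(\<lambda>X. f X \<oplus>\<^bsub>A\<^esub> \<ominus>\<^bsub>A\<^esub> h X) \<in> M"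
      unfolding reducible_def by blast
    have hL: "h \<in> carrier ?L" using fin_supp_standard[OF h(1)] by (simp add: free_module_carrier[OF cring])
    then have "f \<oplus>\<^bsub>?L\<^esub> \<ominus>\<^bsub>?L\<^esub> h \<in> M"
      using h(2) a_inv_free_module(2)[OF cring, of h n r]
      by (simp add: free_module_simps free_module_carrier[OF cring])
    then have C: "C = coset h" using coset_eq_iff[OF L M f(1) hL] f(2) by simp
    \<comment> \<open>The family \<open>h\<close> is carried over to cosets along the inverse of the
      injection, with zero at all other cosets.\<close>
    define c where "c b = (if b \<in> ?e ` ?S then h (inv_into ?S ?e b) else \<zero>\<^bsub>A\<^esub>)" for b
    have ch: "c (?e X) = h X" if "X \<in> ?S" for X
    proof -
      have "?e X \<in> ?e ` ?S" using that by (rule imageI)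
      then have "c (?e X) = h (inv_into ?S ?e (?e X))" unfolding c_def by (rule if_P)
      then show ?thesis by (simp only: inv_into_f_f[OF inj_coset that])
    qed
    have c: "c \<in> fin_supp_funs A (?e ` ?S)"
    proof (rule fin_supp_funsI[where D = "?e ` {X. h X \<noteq> \<zero>\<^bsub>A\<^esub>}"])
      show "c b \<in> carrier A" for b using fin_supp_funs_closed[OF h(1)] by (simp add: c_def)
      show "c b = \<zero>\<^bsub>A\<^esub>" if nb: "b \<notin> ?e ` {X. h X \<noteq> \<zero>\<^bsub>A\<^esub>}" for b
      proof (cases "b \<in> ?e ` ?S")
        case True
        then obtain X where X: "X \<in> ?S" "b = ?e X" by (rule imageE)
        then have "h X = \<zero>\<^bsub>A\<^esub>" using nb by blast
        then show ?thesis unfolding X(2) ch[OF X(1)] .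
      next
        case False
        then show ?thesis unfolding c_def by (rule if_not_P)
      qed
      show "finite (?e ` {X. h X \<noteq> \<zero>\<^bsub>A\<^esub>})" by (rule finite_imageI[OF fin_supp_funs_finite[OF h(1)]])
      show "?e ` {X. h X \<noteq> \<zero>\<^bsub>A\<^esub>} \<subseteq> ?e ` ?S" by (rule image_mono[OF fin_supp_funs_supp[OF h(1)]])
    qed
    show "\<exists>c \<in> fin_supp_funs A (?e ` ?S). C = lincomb A ?Q c"
      by (rule bexI[OF _ c]) (simp only: C lincomb[OF c h(1) ch])
  next
    fix c assume c: "c \<in> fin_supp_funs A (?e ` ?S)" and zero: "lincomb A ?Q c = \<zero>\<^bsub>?Q\<^esub>"
    let ?f = "\<lambda>X. if X \<in> ?S then c (?e X) else \<zero>\<^bsub>A\<^esub>"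
    have f: "?f \<in> fin_supp_funs A ?S"
    proof (rule fin_supp_funsI[where D = "{X \<in> ?S. c (?e X) \<noteq> \<zero>\<^bsub>A\<^esub>}"])
      show "finite {X \<in> ?S. c (?e X) \<noteq> \<zero>\<^bsub>A\<^esub>}"
      proof (rule finite_imageD)
        show "finite (?e ` {X \<in> ?S. c (?e X) \<noteq> \<zero>\<^bsub>A\<^esub>})"
          by (rule finite_subset[OF _ fin_supp_funs_finite[OF c]]) blast
        show "inj_on ?e {X \<in> ?S. c (?e X) \<noteq> \<zero>\<^bsub>A\<^esub>}" by (rule inj_on_subset[OF inj_coset]) blast
      qed
      show "?f X \<in> carrier A" for X using fin_supp_funs_closed[OF c] by simp
    qed (simp_all add: Collect_subset del: split_paired_All)
    have "coset ?f = \<zero>\<^bsub>?Q\<^esub>" using lincomb[OF c f] zero by simp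
    moreover have "?f \<in> carrier ?L" using fin_supp_standard[OF f] by (simp add: free_module_carrier[OF cring])
    ultimately have "?f \<in> M" using coset_zero_iff[OF L M] by blast
    then have "?f = (\<lambda>X. \<zero>\<^bsub>A\<^esub>)" by (rule standard_monoms_independent[OF _ f])
    then have z: "c (?e X) = \<zero>\<^bsub>A\<^esub>" if "X \<in> ?S" for X using fun_cong[of ?f _ X] that by simp
    show "c = (\<lambda>b. \<zero>\<^bsub>A\<^esub>)"
    proof
      fix b
      show "c b = \<zero>\<^bsub>A\<^esub>"
      proof (cases "b \<in> ?e ` ?S")
        case True
        then show ?thesis using z by blast
      next
        case False
        then show ?thesis by (rule fin_supp_funs_zero_outside[OF c])
      qed
    qed
  qed
qed

lemma flat_quotient:
  fixes U :: "'u itself"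
  shows "flat U A (quotient_module (free_module_base A n r) M)"
  by (rule free_imp_flat[OF module_quotient_module[OF module_free_module_base[OF cring]
        submodule_base[OF cring submodule_M]] quotient_basis])

lemma rank_quotient: "rank_is_card A (quotient_module (free_module_base A n r) M) standard_monoms"
proof -
  let ?Q = "quotient_module (free_module_base A n r) M" and ?e = "\<lambda>X. coset (unit_vector X)"
  have Q: "module A ?Q"
    by (rule module_quotient_module[OF module_free_module_base[OF cring] submodule_base[OF cring submodule_M]])
  \<comment> \<open>Each multiset comes from a list, so there are only countably many monomials;
    \<open>rank_is_card_countable\<close> asks for exactly this.\<close>
  have "countable (range (mset :: nat list \<Rightarrow> nat multiset))" by simp
  then have "countable (UNIV :: nat multiset set)" by (simp add: surj_mset)
  then have "countable (UNIV \<times> UNIV :: module_monom set)" by (intro countable_SIGMA) auto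
  then have "countable standard_monoms" by (rule countable_subset[rotated]) simp
  then have "countable (?e ` standard_monoms)" by simp
  from rank_is_card_countable[OF Q one_neq_zero[OF tdvr] quotient_basis this residue_field[OF tdvr]
      residue_map_hom[OF tdvr] residue_map_surj[OF tdvr]]
  have rank: "rank_is_card A ?Q (?e ` standard_monoms)" .
  show ?thesis
    unfolding rank_is_card_def
  proof (intro conjI allI impI)
    show "\<exists>B. module_basis A ?Q B" using quotient_basis by (rule exI)
    fix B assume "module_basis A ?Q B"
    then have "B \<approx> ?e ` standard_monoms" using rank unfolding rank_is_card_def by simp
    then show "B \<approx> standard_monoms"
      by (rule eqpoll_trans[OF _ inj_on_image_eqpoll_self[OF inj_coset]])
  qed
qed

end

subsection \<open>The numbers \<open>m\<^sub>X\<close>\<close>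

lemma finite_G: "finite G"
  using groebner by (simp add: groebner_basis_def)

lemma min_val_in:
  assumes "\<exists>g \<in> G. monom_dvd n (lp A prec g) X"
  shows "\<exists>g \<in> G. monom_dvd n (lp A prec g) X \<and> min_val A a \<A> n prec G X = enat (val \<A> (lc A prec g))"
proof -
  let ?V = "{enat (val \<A> (lc A prec g)) | g. g \<in> G \<and> monom_dvd n (lp A prec g) X}"
  have "finite ?V" using finite_G by simp
  moreover have "?V \<noteq> {}" using assms by blast
  ultimately have "Min ?V \<in> ?V" by (rule Min_in)
  moreover have "min_val A a \<A> n prec G X = Min ?V" using assms unfolding min_val_def by (rule if_P)
  ultimately show ?thesis by auto
qed

lemma min_val_le:
  assumes "g \<in> G" "monom_dvd n (lp A prec g) X"
  shows "min_val A a \<A> n prec G X \<le> enat (val \<A> (lc A prec g))"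
proof -
  let ?V = "{enat (val \<A> (lc A prec g)) | g. g \<in> G \<and> monom_dvd n (lp A prec g) X}"
  have "finite ?V" using finite_G by simp
  then have "Min ?V \<le> enat (val \<A> (lc A prec g))" using assms by (intro Min_le) blast+
  moreover have "min_val A a \<A> n prec G X = Min ?V" using assms unfolding min_val_def by (intro if_P) blast
  ultimately show ?thesis by simp
qed

text \<open>Leading coefficients are non-zero and homogeneous, so their degrees lie below
  \<open>a\<close>, whether \<open>a\<close> is finite or not. The default value \<open>a\<close>
  therefore marks precisely the monomials that no leading monomial divides.\<close>

lemma standard_monoms_eq: "standard_monoms = {X \<in> module_monoms n r. min_val A a \<A> n prec G X = a}"
proof -
  have "min_val A a \<A> n prec G X = a \<longleftrightarrow> (\<forall>g \<in> G. \<not> monom_dvd n (lp A prec g) X)" for X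
  proof (cases "\<exists>g \<in> G. monom_dvd n (lp A prec g) X")
    case True
    then obtain g where g: "g \<in> G" "monom_dvd n (lp A prec g) X" by blast
    have "min_val A a \<A> n prec G X < a"
      using min_val_le[OF g] lc_degree(1)[OF g(1)] by (rule le_less_trans)
    then show ?thesis using g by auto
  next
    case False
    then show ?thesis by (simp add: min_val_def)
  qed
  then show ?thesis unfolding standard_monoms_def by simp
qed

text \<open>At the leading monomial of an element of \<open>G\<close> the minimum is below
  \<open>a\<close>, so it must be 0 and is attained at a unit. Conversely, by transitivity of
  divisibility, any monomial divisible by some leading monomial is divisible by one with unit
  coefficient, and the minimum there is 0.\<close>

lemma min_val_iff_unit_lc:
  "{min_val A a \<A> n prec G X | X. X \<in> module_monoms n r} \<subseteq> {0, a} \<longleftrightarrow>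
    (\<forall>g \<in> G. \<exists>g' \<in> G. lc A prec g' \<in> Units A \<and> monom_dvd n (lp A prec g') (lp A prec g))"
    (is "?V \<subseteq> _ \<longleftrightarrow> ?unit")
proof
  assume V: "?V \<subseteq> {0, a}"
  show ?unit
  proof
    fix g assume g: "g \<in> G"
    let ?X = "lp A prec g"
    have "min_val A a \<A> n prec G ?X < a"
      using min_val_le[OF g monom_dvd_refl] lc_degree(1)[OF g] by (rule le_less_trans)
    moreover have "min_val A a \<A> n prec G ?X \<in> {0, a}" using V G_properties(4)[OF g] by blast
    ultimately have "min_val A a \<A> n prec G ?X = 0" by auto
    moreover have "\<exists>g' \<in> G. monom_dvd n (lp A prec g') ?X" using g monom_dvd_refl by blast
    ultimately obtain g' where "g' \<in> G" "monom_dvd n (lp A prec g') ?X" "val \<A> (lc A prec g') = 0"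
      using min_val_in[of ?X] by (auto simp: zero_enat_def)
    then show "\<exists>g' \<in> G. lc A prec g' \<in> Units A \<and> monom_dvd n (lp A prec g') ?X"
      using lc_Units_iff by blast
  qed
next
  assume unit: ?unit
  have "min_val A a \<A> n prec G X \<in> {0, a}" for X
  proof (cases "\<exists>g \<in> G. monom_dvd n (lp A prec g) X")
    case True
    then obtain g where g: "g \<in> G" "lc A prec g \<in> Units A" "monom_dvd n (lp A prec g) X"
      using unit monom_dvd_trans by blast
    then have "min_val A a \<A> n prec G X \<le> 0"
      using min_val_le[OF g(1,3)] lc_Units_iff[OF g(1)] by (simp add: zero_enat_def)
    then show ?thesis by simp
  next
    case False
    then show ?thesis by (simp add: min_val_def)
  qed
  then show "?V \<subseteq> {0, a}" by blast
qed

end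

theorem theorem3p3:
  fixes A :: "('a, 'm) ring_scheme"
    and a :: enat
    and \<A> :: "nat \<Rightarrow> 'a set"
    and n r :: nat
    and prec :: "module_monom \<Rightarrow> module_monom \<Rightarrow> bool"
    and M G :: "(module_monom \<Rightarrow> 'a) set"
  defines "Q \<equiv> quotient_module (free_module_base A n r) M"
    and "m \<equiv> min_val A a \<A> n prec G"
  assumes "graded_tdvr A a \<A>"
    and "1 \<le> r"
    and "term_order n r prec"
    and "graded_submodule A \<A> n r M"
    and "M \<noteq> {\<zero>\<^bsub>free_module A n r\<^esub>}"
    and "groebner_basis A n r prec M G"
    and "\<forall>g \<in> G. homogeneous A a \<A> n r g"
  shows "(flat TYPE('u) A Q \<longleftrightarrow> {m X | X. X \<in> module_monoms n r} \<subseteq> {0, a}) \<and>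
    ({m X | X. X \<in> module_monoms n r} \<subseteq> {0, a} \<longleftrightarrow>
       (\<forall>g \<in> G. \<exists>g' \<in> G. lc A prec g' \<in> Units A \<and> monom_dvd n (lp A prec g') (lp A prec g))) \<and>
    (flat TYPE('u) A Q \<longrightarrow> rank_is_card A Q {X \<in> module_monoms n r. m X = a})"
proof -
  interpret homogeneous_groebner A a \<A> n r prec M G
    by (rule homogeneous_groebner.intro) (fact assms)+
  \<comment> \<open>Flatness is tied to unit leading coefficients, and
    \<open>min_val_iff_unit_lc\<close> supplies the remaining condition. Both directions hold for
    every choice of the type \<open>'u\<close>.\<close>
  have flat_iff: "flat TYPE('u) A Q \<longleftrightarrow>
      (\<forall>g \<in> G. \<exists>g' \<in> G. lc A prec g' \<in> Units A \<and> monom_dvd n (lp A prec g') (lp A prec g))"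
    unfolding Q_def using flat_imp_unit_lc flat_quotient by blast
  have rank: "rank_is_card A Q {X \<in> module_monoms n r. m X = a}" if "flat TYPE('u) A Q"
    using rank_quotient[OF flat_iff[THEN iffD1, OF that]] standard_monoms_eq
    unfolding Q_def m_def by simp
  show ?thesis
    unfolding m_def min_val_iff_unit_lc
    using flat_iff rank unfolding m_def by blast
qed

end
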